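(* Let $d\ge1$, $\alpha<1$, let $\mathbf F:S^{d-1}\to\mathbb R^d$ be continuously differentiable, and let $\mathbf G$ be a regularization function as in the context. Let $\mathbf y_*\in S^{d-1}$ be a fixed-point attractor of $d\tilde{\mathbf y}/ds=\mathbf F_s(\tilde{\mathbf y})$ (so $\mathbf F_s(\mathbf y_* )=\mathbf 0$) with $F_r(\mathbf y_* )<0$. Let $\mathbf x^\nu(t)$, $\nu>0$, be the solution of the $\nu$-regularized problem $\dot{\mathbf x}=\mathbf f^\nu(\mathbf x)$ with initial condition $\mathbf x^\nu(t_0)=\mathbf x_0=r_0\mathbf y_0$, where $r_0>0$ and $\mathbf y_0\in\mathcal B(\{\mathbf y_*\})$ is arbitrary, and let $t_b$ be the (finite) blowup time of the solution of the singular system with the same initial condition. Assume that the regularization is expelling and that $\mathbf y_*^{esc}$ is in the basin of attraction $\mathcal B(\mathcal A')$ of an exponentially stable limit cycle $\mathcal A'=\{\tilde{\mathbf Y}_p(S):S\in[0,T)\}$ of $d\tilde{\mathbf Y}/dS=\mathbf F_s(\tilde{\mathbf Y})$ on $S^{d-1}$, with period $T$ and average $\langle F_r\rangle=\frac1T\int_0^TF_r(\tilde{\mathbf Y}_p(S))\,dS>0$. Then there is a constant $c\in\mathbb R$, depending on the regularization, such that for every fixed $\chi\in\mathbb R$ and the sequence $$\nu_n=e^{-T\langle F_r\rangle n+\chi},$$ the limit $\mathbf x(t)=\lim_{n\to\infty}\mathbf x^{\nu_n}(t)$ exists and, for all $t>t_b$, $$\mathbf x(t)=(t-t_b)^{\frac1{1-\alpha}}\,\mathbf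 X_p\left(\ln\left[(t-t_b)^{\frac1{1-\alpha}}\right]+\zeta\right)\quad\text{with}\quad \zeta=c-\chi,$$ where $\mathbf X_p$ is the $T\langle F_r\rangle$-periodic function determined by $\tilde{\mathbf Y}_p$ as described in the context.
   Context: The singular system is $\dot{\mathbf x}=\mathbf f(\mathbf x)=r^\alpha\mathbf F(\mathbf y)$, $r=|\mathbf x|$, $\mathbf y=\mathbf x/r$. Decompose $\mathbf F(\mathbf y)=F_r(\mathbf y)\,\mathbf y+\mathbf F_s(\mathbf y)$ with $F_r(\mathbf y)=\mathbf F(\mathbf y)\cdot\mathbf y$. The blowup time $t_b$ is the maximal time such that the solution of the singular system with $\mathbf x(t_0)=\mathbf x_0$ satisfies $\mathbf x(t)\ne\mathbf 0$ on $[t_0,t_b)$. Regularization: $\mathbf G$ is an $\mathbb R^d$-valued function on the closed unit ball such that for every $\nu>0$ the field $$\mathbf f^\nu(\mathbf x)=\begin{cases}r^\alpha\mathbf F(\mathbf x/r),& r>\nu,\\ \nu^\alpha\mathbf G(\mathbf x/\nu),& r\le\nu,\end{cases}$$ is continuously differentiable on $\mathbb R^d$. Then $\mathbf x^\nu(t)$ exists and is unique globally in time. Rescaled problem: let $\mathbf X(\tau)$ be the unique global solution of $$\frac{d\mathbf X}{d\tau}=\begin{cases}R^\alpha\mathbf F(\mathbf X/R),&R>1,\\ \mathbf G(\mathbf X),&R\le1,\end{cases}\qquad \mathbf X(\tau_{ent})=\mathbf y_*,\quad R=|\mathbf X|,$$ with $\tau_{ent}=-\frac{1}{F_r(\mathbf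 y_* )(\alpha-1)}$. The regularization is expelling if there is a finite $\tau_{esc}>\tau_{ent}$ with $R(\tau_{esc})=1$ and $R(\tau)>1$ for all $\tau>\tau_{esc}$; then $\mathbf y_*^{esc}:=\mathbf X(\tau_{esc})$. Attractors: an attractor of $d\tilde{\mathbf y}/ds=\mathbf F_s(\tilde{\mathbf y})$ on $S^{d-1}$ is a nonempty compact invariant set $\mathcal A$ that has a neighborhood $U_0$ with $\bigcap_{s\ge0}U_s=\mathcal A$, where $U_s$ is the image of $U_0$ under the time-$s$ flow; its basin $\mathcal B(\mathcal A)$ is the set of all points whose trajectories approach $\mathcal A$ asymptotically as $s\to\infty$. A fixed-point attractor is an attractor consisting of a single point. Limit cycle: $\tilde{\mathbf Y}_p(S)$ is a periodic solution, $\tilde{\mathbf Y}_p(S+T)=\tilde{\mathbf Y}_p(S)$, of $d\tilde{\mathbf Y}/dS=\mathbf F_s(\tilde{\mathbf Y})$ on $S^{d-1}$, and $\mathcal A'$ is its orbit. Exponentially stable means that all characteristic (Floquet) exponents of the linearized problem near $\tilde{\mathbf Y}_p$ (on the sphere) have negative real parts, except for the single vanishing exponent responsible for time translations. The function $\mathbf X_p$: set $I(S_1,S_2)=\int_{S_1}^{S_2}F_r(\tilde{\mathbf Y}_p(S))\,dS$ (with $I(S_1,S_2)=-I(S_2,S_1)$ for $S_1>S_2$), $$\varphi(s_1,s_2)=\frac1{1-\alpha}\ln\left[\int_{-\infty}^0e^{-(1-\alpha)I(s_1+s',s_2)}\,ds'\right],\quad \psi(s)=\varphi(s,0),\quad \mathbf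 x_p(s)=e^{-\varphi(s,s)}\tilde{\mathbf Y}_p(s).$$ When $\langle F_r\rangle>0$, the map $\psi:\mathbb R\to\mathbb R$ is invertible, and $\mathbf X_p:=\mathbf x_p\circ\psi^{-1}$. *)

theory Defs
  imports "HOL-Analysis.Analysis"
begin

text \<open>
  The space \<open>\<real>\<^sup>d\<close>, \<open>d \<ge> 1\<close>, is an arbitrary \<open>'a::euclidean_space\<close>, and \<open>S\<^sup>d\<^sup>-\<^sup>1\<close> is \<open>sphere 0 1\<close>.
  The maps \<open>F\<close> and \<open>G\<close> are total functions, but nothing below depends on the values of \<open>F\<close> off the
  unit sphere or of \<open>G\<close> off the closed unit ball.
\<close>

section \<open>Continuous differentiability\<close>

text \<open>Intended for open \<open>U\<close> only.\<close>

definition C1_on :: "'a::real_normed_vector set \<Rightarrow> ('a \<Rightarrow> 'b::real_normed_vector) \<Rightarrow> bool" where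
  "C1_on U f \<longleftrightarrow>
     (\<exists>f' :: 'a \<Rightarrow> 'a \<Rightarrow>\<^sub>L 'b.
        (\<forall>x\<in>U. (f has_derivative blinfun_apply (f' x)) (at x)) \<and> continuous_on U f')"

text \<open>As usual for maps on a submanifold: there is a \<open>C\<^sup>1\<close> extension to an open neighbourhood.\<close>

definition C1_on_sphere :: "('a::euclidean_space \<Rightarrow> 'a) \<Rightarrow> bool" where
  "C1_on_sphere F \<longleftrightarrow>
     (\<exists>U g. open U \<and> sphere 0 1 \<subseteq> U \<and> C1_on U g \<and> (\<forall>y\<in>sphere 0 1. g y = F y))"

section \<open>The singular, regularized and rescaled systems\<close>

definition global_solution :: "('a::real_normed_vector \<Rightarrow> 'a) \<Rightarrow> (real \<Rightarrow> 'a) \<Rightarrow> bool" where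
  "global_solution f x \<longleftrightarrow> (\<forall>t. (x has_vector_derivative f (x t)) (at t))"

definition sing_field :: "real \<Rightarrow> ('a::euclidean_space \<Rightarrow> 'a) \<Rightarrow> 'a \<Rightarrow> 'a" where
  "sing_field \<alpha> F x = norm x powr \<alpha> *\<^sub>R F (x /\<^sub>R norm x)"

definition reg_field ::
    "real \<Rightarrow> ('a::euclidean_space \<Rightarrow> 'a) \<Rightarrow> ('a \<Rightarrow> 'a) \<Rightarrow> real \<Rightarrow> 'a \<Rightarrow> 'a" where
  "reg_field \<alpha> F G \<nu> x =
     (if norm x > \<nu> then norm x powr \<alpha> *\<^sub>R F (x /\<^sub>R norm x) else \<nu> powr \<alpha> *\<^sub>R G (x /\<^sub>R \<nu>))"

definition regularization ::
    "real \<Rightarrow> ('a::euclidean_space \<Rightarrow> 'a) \<Rightarrow> ('a \<Rightarrow> 'a) \<Rightarrow> bool" where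
  "regularization \<alpha> F G \<longleftrightarrow> (\<forall>\<nu>>0. C1_on UNIV (reg_field \<alpha> F G \<nu>))"

definition rescaled_field ::
    "real \<Rightarrow> ('a::euclidean_space \<Rightarrow> 'a) \<Rightarrow> ('a \<Rightarrow> 'a) \<Rightarrow> 'a \<Rightarrow> 'a" where
  "rescaled_field \<alpha> F G X =
     (if norm X > 1 then norm X powr \<alpha> *\<^sub>R F (X /\<^sub>R norm X) else G X)"

definition nonzero_solution ::
    "real \<Rightarrow> ('a::euclidean_space \<Rightarrow> 'a) \<Rightarrow> real \<Rightarrow> 'a \<Rightarrow> real \<Rightarrow> (real \<Rightarrow> 'a) \<Rightarrow> bool" where
  "nonzero_solution \<alpha> F t0 x0 t1 x \<longleftrightarrow>
     x t0 = x0 \<and>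
     (\<forall>t\<in>{t0..<t1}. x t \<noteq> 0 \<and>
        (x has_vector_derivative sing_field \<alpha> F (x t)) (at t within {t0..<t1}))"

definition is_blowup_time ::
    "real \<Rightarrow> ('a::euclidean_space \<Rightarrow> 'a) \<Rightarrow> real \<Rightarrow> 'a \<Rightarrow> real \<Rightarrow> bool" where
  "is_blowup_time \<alpha> F t0 x0 tb \<longleftrightarrow>
     t0 < tb \<and> (\<exists>x. nonzero_solution \<alpha> F t0 x0 tb x) \<and>
     (\<forall>t1>tb. \<nexists>x. nonzero_solution \<alpha> F t0 x0 t1 x)"

section \<open>Dynamics on the sphere\<close>

definition Fr :: "('a::euclidean_space \<Rightarrow> 'a) \<Rightarrow> 'a \<Rightarrow> real" where
  "Fr F y = F y \<bullet> y"

definition Fs :: "('a::euclidean_space \<Rightarrow> 'a) \<Rightarrow> 'a \<Rightarrow> 'a" where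
  "Fs F y = F y - Fr F y *\<^sub>R y"

definition sphere_solution :: "('a::euclidean_space \<Rightarrow> 'a) \<Rightarrow> (real \<Rightarrow> 'a) \<Rightarrow> bool" where
  "sphere_solution F y \<longleftrightarrow> range y \<subseteq> sphere 0 1 \<and> global_solution (Fs F) y"

definition flow_image :: "('a::euclidean_space \<Rightarrow> 'a) \<Rightarrow> real \<Rightarrow> 'a set \<Rightarrow> 'a set" where
  "flow_image F s U = {y s |y. sphere_solution F y \<and> y 0 \<in> U}"

definition attractor :: "('a::euclidean_space \<Rightarrow> 'a) \<Rightarrow> 'a set \<Rightarrow> bool" where
  "attractor F A \<longleftrightarrow>
     A \<noteq> {} \<and> compact A \<and> A \<subseteq> sphere 0 1 \<and> (\<forall>s. flow_image F s A = A) \<and>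
     (\<exists>U\<^sub>0 W. openin (top_of_set (sphere 0 1)) W \<and> A \<subseteq> W \<and> W \<subseteq> U\<^sub>0 \<and> U\<^sub>0 \<subseteq> sphere 0 1 \<and>
        (\<Inter>s\<in>{0..}. flow_image F s U\<^sub>0) = A)"

definition basin :: "('a::euclidean_space \<Rightarrow> 'a) \<Rightarrow> 'a set \<Rightarrow> 'a set" where
  "basin F A =
     {y 0 |y. sphere_solution F y \<and> ((\<lambda>s. infdist (y s) A) \<longlongrightarrow> 0) at_top}"

section \<open>The rescaled problem\<close>

definition tau_ent :: "real \<Rightarrow> ('a::euclidean_space \<Rightarrow> 'a) \<Rightarrow> 'a \<Rightarrow> real" where
  "tau_ent \<alpha> F ystar = - 1 / (Fr F ystar * (\<alpha> - 1))"

definition is_escape_time :: "real \<Rightarrow> (real \<Rightarrow> 'a::euclidean_space) \<Rightarrow> real \<Rightarrow> bool" where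
  "is_escape_time \<tau>ent X \<tau>esc \<longleftrightarrow>
     \<tau>ent < \<tau>esc \<and> norm (X \<tau>esc) = 1 \<and> (\<forall>\<tau>>\<tau>esc. norm (X \<tau>) > 1)"

section \<open>Limit cycles and Floquet exponents\<close>

text \<open>\<open>T\<close> need not be the minimal period, but equilibria are excluded.\<close>

definition periodic_solution :: "('a::euclidean_space \<Rightarrow> 'a) \<Rightarrow> (real \<Rightarrow> 'a) \<Rightarrow> real \<Rightarrow> bool" where
  "periodic_solution F Y T \<longleftrightarrow>
     sphere_solution F Y \<and> T > 0 \<and> (\<forall>S. Y (S + T) = Y S) \<and> (\<exists>S. Y S \<noteq> Y 0)"

text \<open>
  On vectors tangent to the sphere at \<open>y\<close>, the derivative of the extension of \<open>Fs F\<close> that is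
  constant along rays is the intrinsic differential of \<open>Fs F\<close>. The tangent space at \<open>y\<close> is
  \<open>{v. v \<bullet> y = 0}\<close>.
\<close>

definition sphere_deriv :: "('a::euclidean_space \<Rightarrow> 'a) \<Rightarrow> 'a \<Rightarrow> 'a \<Rightarrow> 'a" where
  "sphere_deriv F y = frechet_derivative (\<lambda>x. Fs F (x /\<^sub>R norm x)) (at y)"

definition linearized_solution ::
    "('a::euclidean_space \<Rightarrow> 'a) \<Rightarrow> (real \<Rightarrow> 'a) \<Rightarrow> (real \<Rightarrow> 'a) \<Rightarrow> bool" where
  "linearized_solution F Y v \<longleftrightarrow>
     (\<forall>S. v S \<bullet> Y S = 0 \<and> (v has_vector_derivative sphere_deriv F (Y S) (v S)) (at S))"

text \<open>Meaningful for \<open>\<xi>\<close> in the tangent space at \<open>Y 0\<close>.\<close>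

definition monodromy ::
    "('a::euclidean_space \<Rightarrow> 'a) \<Rightarrow> (real \<Rightarrow> 'a) \<Rightarrow> real \<Rightarrow> 'a \<Rightarrow> 'a" where
  "monodromy F Y T \<xi> = (THE \<eta>. \<exists>v. linearized_solution F Y v \<and> v 0 = \<xi> \<and> v T = \<eta>)"

text \<open>
  \<open>l\<close> is a characteristic exponent iff \<open>\<mu> = exp (l T)\<close> is an eigenvalue of the complexified monodromy
  map on the tangent space; the eigenvector is \<open>u + \<i> w\<close> with \<open>u\<close>, \<open>w\<close> real tangent vectors.
\<close>

definition char_exponent ::
    "('a::euclidean_space \<Rightarrow> 'a) \<Rightarrow> (real \<Rightarrow> 'a) \<Rightarrow> real \<Rightarrow> complex \<Rightarrow> bool" where
  "char_exponent F Y T l \<longleftrightarrow>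
     (let \<mu> = exp (l * of_real T) in
      \<exists>u w. u \<bullet> Y 0 = 0 \<and> w \<bullet> Y 0 = 0 \<and> (u \<noteq> 0 \<or> w \<noteq> 0) \<and>
        monodromy F Y T u = Re \<mu> *\<^sub>R u - Im \<mu> *\<^sub>R w \<and>
        monodromy F Y T w = Im \<mu> *\<^sub>R u + Re \<mu> *\<^sub>R w)"

text \<open>
  Algebraic multiplicity of the multiplier 1, that is, of the vanishing exponent; the multiplier is
  real, so it can be read off from the real generalized eigenspace.
\<close>

definition zero_exponent_multiplicity ::
    "('a::euclidean_space \<Rightarrow> 'a) \<Rightarrow> (real \<Rightarrow> 'a) \<Rightarrow> real \<Rightarrow> nat" where
  "zero_exponent_multiplicity F Y T =
     dim {\<xi>. \<xi> \<bullet> Y 0 = 0 \<and> (\<exists>k. ((\<lambda>v. monodromy F Y T v - v) ^^ k) \<xi> = 0)}"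

text \<open>Exponents are determined modulo \<open>2 \<pi> \<i> / T\<close>, so \<open>exp (l T) = 1\<close> says that \<open>l\<close> vanishes.\<close>

definition exponentially_stable_cycle ::
    "('a::euclidean_space \<Rightarrow> 'a) \<Rightarrow> (real \<Rightarrow> 'a) \<Rightarrow> real \<Rightarrow> bool" where
  "exponentially_stable_cycle F Y T \<longleftrightarrow>
     periodic_solution F Y T \<and>
     zero_exponent_multiplicity F Y T = 1 \<and>
     (\<forall>l. char_exponent F Y T l \<longrightarrow> exp (l * of_real T) = 1 \<or> Re l < 0)"

definition mean_Fr :: "('a::euclidean_space \<Rightarrow> 'a) \<Rightarrow> (real \<Rightarrow> 'a) \<Rightarrow> real \<Rightarrow> real" where
  "mean_Fr F Y T = (1 / T) * (LBINT S=0..T. Fr F (Y S))"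

section \<open>The limiting profile\<close>

text \<open>The interval integral changes sign when its bounds are exchanged.\<close>

definition I_fun :: "('a::euclidean_space \<Rightarrow> 'a) \<Rightarrow> (real \<Rightarrow> 'a) \<Rightarrow> real \<Rightarrow> real \<Rightarrow> real" where
  "I_fun F Y S1 S2 = (LBINT S=S1..S2. Fr F (Y S))"

definition phi_fun ::
    "real \<Rightarrow> ('a::euclidean_space \<Rightarrow> 'a) \<Rightarrow> (real \<Rightarrow> 'a) \<Rightarrow> real \<Rightarrow> real \<Rightarrow> real" where
  "phi_fun \<alpha> F Y s1 s2 =
     1 / (1 - \<alpha>) * ln (LBINT s'=-\<infinity>..0. exp (- (1 - \<alpha>) * I_fun F Y (s1 + s') s2))"

definition psi_fun ::
    "real \<Rightarrow> ('a::euclidean_space \<Rightarrow> 'a) \<Rightarrow> (real \<Rightarrow> 'a) \<Rightarrow> real \<Rightarrow> real" where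
  "psi_fun \<alpha> F Y s = phi_fun \<alpha> F Y s 0"

definition xp_fun ::
    "real \<Rightarrow> ('a::euclidean_space \<Rightarrow> 'a) \<Rightarrow> (real \<Rightarrow> 'a) \<Rightarrow> real \<Rightarrow> 'a" where
  "xp_fun \<alpha> F Y s = exp (- phi_fun \<alpha> F Y s s) *\<^sub>R Y s"

definition Xp_fun ::
    "real \<Rightarrow> ('a::euclidean_space \<Rightarrow> 'a) \<Rightarrow> (real \<Rightarrow> 'a) \<Rightarrow> real \<Rightarrow> 'a" where
  "Xp_fun \<alpha> F Y = xp_fun \<alpha> F Y \<circ> inv (psi_fun \<alpha> F Y)"

end

theory Submission
  imports Defs "HOL-Computational_Algebra.Fundamental_Theorem_Algebra" "HOL-Real_Asymp.Real_Asymp"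
begin

text \<open>
  Write \<open>x = r y\<close> and pass to the time \<open>s\<close> with \<open>dt = r\<^sup>1\<^sup>-\<^sup>\<alpha> ds\<close>. Then \<open>y\<close> follows the flow of
  \<open>F\<^sub>s\<close> on the sphere and \<open>r = r\<^sub>0 exp (\<integral> F\<^sub>r(y) ds)\<close>. While \<open>y \<longlonglongrightarrow> y\<^sub>*\<close>, the radius collapses
  exponentially, so that \<open>t\<^sub>b\<close> is finite, and \<open>X\<^sup>\<nu>(\<tau>) = x\<^sup>\<nu>(t\<^sub>b + \<nu>\<^sup>1\<^sup>-\<^sup>\<alpha> \<tau>) / \<nu>\<close> solves the rescaled problem with
  entrance data tending to \<open>(\<tau>\<^sub>e\<^sub>n\<^sub>t, y\<^sub>*)\<close>. Hence \<open>X\<^sup>\<nu>\<close> tends to \<open>X\<close> at every fixed \<open>\<tau>\<close>, also after the escape.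

  Fixed \<open>t > t\<^sub>b\<close> means \<open>\<tau> \<longlonglongrightarrow> \<infinity>\<close>, where this is not enough. An exponentially stable cycle attracts nearby
  solutions exponentially with an asymptotic phase; therefore a small change of the initial direction
  changes both \<open>y(s)\<close> and \<open>\<integral>\<^sub>0\<^sup>s F\<^sub>r(y)\<close> little, uniformly in \<open>s \<ge> 0\<close>, and \<open>X\<^sup>\<nu>\<close> may be replaced by \<open>X\<close> up to a
  factor \<open>1 + o(1)\<close>. For \<open>X\<close> the radius is asymptotic to \<open>\<kappa> exp (I(0, s + \<theta>))\<close> and the elapsed time
  \<open>\<tau>\<close> to \<open>(\<kappa> exp (\<psi>(s + \<theta>)))\<^sup>1\<^sup>-\<^sup>\<alpha>\<close>, which gives the limit with \<open>c = - ln \<kappa>\<close>; the sequence \<open>\<nu>\<^sub>n\<close> is the one for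
  which \<open>s\<close> converges modulo \<open>T\<close>.
\<close>

section \<open>Ordinary differential equations with Lipschitz right-hand side\<close>

text \<open>The obstacle is uniformity. Gronwall compares trajectories on bounded time intervals,
  and the radius is the exponential of an integral, so convergence of directions alone would not
  control it: the distance to the cycle must be integrable in time, with a bound proportional to the
  initial distance. The Floquet hypothesis only speaks of eigenvalues. It is converted into a
  contraction: a high power of the monodromy map is small on the kernel of its left eigenvector
  \<open>l\<close>. That kernel is also taken as return surface, because the first-order correction
  of the return time vanishes on it; the corrections that remain shrink geometrically, and their sum
  gives the phase. Radii and elapsed times are compared through logarithms, where errors stay
  bounded although both quantities grow exponentially. Since elapsed time is treated as a function
  of \<open>s\<close>, convergence at a fixed time after blowup turns into convergence of the phase
  modulo the period. The additive constant is computed from \<open>X\<close> and the cycle only and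
  hence is common to all initial data.\<close>

lemma gronwall:
  fixes z :: "real \<Rightarrow> 'a::real_inner"
  assumes ab: "a \<le> b"
    and der: "\<And>t. t \<in> {a..b} \<Longrightarrow> (z has_vector_derivative z' t) (at t within {a..b})"
    and bound: "\<And>t. t \<in> {a..b} \<Longrightarrow> norm (z' t) \<le> K * norm (z t) + e"
    and K: "K \<ge> 0" and e: "e \<ge> 0"
  shows "norm (z b) \<le> (norm (z a) + e * (b - a)) * exp (K * (b - a))"
proof -
  have main: "norm (z b) \<le> (norm (z a) + \<eta> + e * (b - a)) * exp (K * (b - a))" if \<eta>: "\<eta> > 0" for \<eta>
  proof -
    \<comment> \<open>a smooth substitute for the norm, which fails to be differentiable at zeros of z\<close>
    define N where "N t = sqrt (z t \<bullet> z t + \<eta>\<^sup>2)" for t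
    have pos: "z t \<bullet> z t + \<eta>\<^sup>2 > 0" for t
      using \<eta> by (simp add: add_nonneg_pos)
    have Npos: "N t > 0" for t using pos by (simp add: N_def)
    have zN: "norm (z t) \<le> N t" for t
      unfolding N_def norm_eq_sqrt_inner by (intro real_sqrt_le_mono) simp
    \<comment> \<open>The differential inequality makes \<open>h\<close> nonincreasing, so comparing
      its end values gives the bound with \<eta> added to the initial norm; \<eta> tends to 0 at the
      end.\<close>
    define h where "h t = N t * exp (- K * (t - a)) - e * (t - a)" for t
    define h' where "h' t = (inverse (N t) * (z t \<bullet> z' t)) * exp (- K * (t - a)) - K * N t * exp (- K * (t - a)) - e" for t
    have dN: "(N has_real_derivative (inverse (N t) * (z t \<bullet> z' t))) (at t within {a..b})"
      if t: "t \<in> {a..b}" for t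
    proof -
      have "((\<lambda>t. z t \<bullet> z t + \<eta>\<^sup>2) has_vector_derivative (z t \<bullet> z' t + z' t \<bullet> z t + 0)) (at t within {a..b})"
        unfolding has_vector_derivative_def
        by (rule has_derivative_eq_rhs[OF has_derivative_add[OF has_derivative_inner[OF der[OF t, unfolded has_vector_derivative_def] der[OF t, unfolded has_vector_derivative_def]] has_derivative_const]])
           (auto simp: algebra_simps)
      then have "((\<lambda>t. z t \<bullet> z t + \<eta>\<^sup>2) has_real_derivative (2 * (z t \<bullet> z' t))) (at t within {a..b})"
        unfolding has_real_derivative_iff_has_vector_derivative by (simp add: inner_commute)
      from DERIV_chain2[OF DERIV_real_sqrt[OF pos] this]
      show ?thesis
        by (simp add: N_def [abs_def] field_simps)
    qed
    have dh: "(h has_real_derivative h' t) (at t within {a..b})" if t: "t \<in> {a..b}" for t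
      unfolding h_def h'_def
      by (rule derivative_eq_intros dN[OF t] refl)+ (simp add: algebra_simps)
    have neg: "h' t \<le> 0" if t: "t \<in> {a..b}" for t
    proof -
      have "inverse (N t) * (z t \<bullet> z' t) \<le> inverse (N t) * (norm (z t) * norm (z' t))"
        using Npos[of t] by (intro mult_left_mono norm_cauchy_schwarz) (auto simp: less_imp_le)
      also have "\<dots> \<le> inverse (N t) * (N t * norm (z' t))"
        using Npos[of t] zN[of t] by (intro mult_left_mono mult_right_mono) (auto simp: less_imp_le)
      also have "\<dots> = norm (z' t)" using Npos[of t] by simp
      also have "\<dots> \<le> K * norm (z t) + e" by (rule bound[OF t])
      also have "\<dots> \<le> K * N t + e" using zN[of t] K by (simp add: mult_left_mono)
      finally have 1: "inverse (N t) * (z t \<bullet> z' t) - K * N t \<le> e" by simp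
      have "h' t = (inverse (N t) * (z t \<bullet> z' t) - K * N t) * exp (- K * (t - a)) - e"
        by (simp add: h'_def algebra_simps)
      also have "\<dots> \<le> e * exp (- K * (t - a)) - e"
        using 1 by (simp add: mult_right_mono)
      also have "\<dots> \<le> e * 1 - e"
        using t K e by (intro diff_right_mono mult_left_mono) (auto simp: mult_nonneg_nonneg)
      finally show ?thesis by simp
    qed
    have "h b \<le> h a"
    proof (cases "a = b")
      case False
      have "\<exists>x\<in>{a..b}. h b - h a = (\<lambda>y. y * h' x) (b - a)"
        by (rule mvt_very_simple[OF ab])
           (use dh in \<open>auto simp: has_field_derivative_def mult_commute_abs\<close>)
      then obtain x where x: "x \<in> {a..b}" "h b - h a = (b - a) * h' x" by blast
      moreover have "(b - a) * h' x \<le> 0" using neg[OF x(1)] ab by (simp add: mult_nonneg_nonpos)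
      ultimately show ?thesis by simp
    qed simp
    then have "N b * exp (- K * (b - a)) \<le> N a + e * (b - a)"
      by (simp add: h_def)
    moreover have "N a \<le> norm (z a) + \<eta>"
      unfolding N_def using \<eta> by (intro real_le_lsqrt) (auto simp: power2_sum dot_square_norm)
    ultimately have "N b * exp (- K * (b - a)) \<le> norm (z a) + \<eta> + e * (b - a)" by simp
    from mult_right_mono[OF this, of "exp (K * (b - a))"]
    have "N b \<le> (norm (z a) + \<eta> + e * (b - a)) * exp (K * (b - a))"
      by (simp add: mult.assoc mult_exp_exp)
    then show ?thesis using zN[of b] by simp
  qed
  have "norm (z b) \<le> (norm (z a) + e * (b - a)) * exp (K * (b - a)) + \<epsilon>" if "\<epsilon> > 0" for \<epsilon>
    using main[of "\<epsilon> / exp (K * (b - a))"] that by (simp add: distrib_right)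
  then show ?thesis by (rule field_le_epsilon)
qed

text \<open>The Lipschitz bound is asked for only along the two curves: \<open>Fs\<close> is
  controlled only on the unit sphere. The dependence of \<open>f\<close> on time serves
  \<open>tracking\<close> and the variational equation.\<close>

lemma ode_lipschitz_diff:
  fixes x y :: "real \<Rightarrow> 'a::real_inner"
  assumes "a \<le> b"
    and "\<And>t. t \<in> {a..b} \<Longrightarrow> (x has_vector_derivative f t (x t)) (at t within {a..b})"
    and "\<And>t. t \<in> {a..b} \<Longrightarrow> (y has_vector_derivative f t (y t)) (at t within {a..b})"
    and "\<And>t. t \<in> {a..b} \<Longrightarrow> norm (f t (x t) - f t (y t)) \<le> K * norm (x t - y t)"
    and "K \<ge> 0"
  shows "norm (x b - y b) \<le> norm (x a - y a) * exp (K * (b - a))"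
  using gronwall[of a b "\<lambda>t. x t - y t" "\<lambda>t. f t (x t) - f t (y t)" K 0] assms
  by (auto intro!: has_vector_derivative_diff)

lemma has_vector_derivative_norm_le:
  fixes g :: "real \<Rightarrow> 'a::real_normed_vector"
  assumes "a \<le> b"
    and "\<And>t. t \<in> {a..b} \<Longrightarrow> (g has_vector_derivative g' t) (at t)"
    and "\<And>t. t \<in> {a..b} \<Longrightarrow> (\<phi> has_real_derivative \<phi>' t) (at t)"
    and "\<And>t. t \<in> {a..b} \<Longrightarrow> norm (g' t) \<le> \<phi>' t"
  shows "norm (g b - g a) \<le> \<phi> b - \<phi> a"
proof (cases "a = b")
  case False
  show ?thesis
  proof (rule differentiable_bound_general[where f' = g' and \<phi>' = \<phi>'])
    show "continuous_on {a..b} g"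
      using assms(2) by (intro continuous_at_imp_continuous_on ballI has_vector_derivative_continuous[OF assms(2)])
    show "continuous_on {a..b} \<phi>"
      using assms(3) by (intro continuous_at_imp_continuous_on ballI DERIV_isCont[OF assms(3)])
  qed (use assms False in \<open>auto simp: has_real_derivative_iff_has_vector_derivative\<close>)
qed simp

lemma antiderivative_real_line:
  fixes g :: "real \<Rightarrow> 'a::euclidean_space"
  assumes "continuous_on UNIV g"
  shows "((\<lambda>u. LBINT s=0..u. g s) has_vector_derivative g x) (at x)"
proof -
  define c where "c = \<bar>x\<bar> + 1"
  have "((\<lambda>u. LBINT s=0..u. g s) has_vector_derivative g x) (at x within {-c..c})"
    unfolding zero_ereal_def
    by (rule interval_integral_FTC2[OF _ _ continuous_on_subset[OF assms]]) (auto simp: c_def)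
  moreover have "at x within {-c..c} = at x"
    by (rule at_within_interior) (auto simp: c_def)
  ultimately show ?thesis by simp
qed

text \<open>Integration from 0 gains the factor 1/K on either half-line; for large K this beats any
  Lipschitz constant and makes the weighted Picard operator contract.\<close>

lemma exponential_bound_antiderivative:
  fixes D :: "real \<Rightarrow> 'a::real_normed_vector"
  assumes D: "\<And>t. (D has_vector_derivative d t) (at t)" and D0: "D 0 = 0"
    and d: "\<And>t. norm (d t) \<le> M * exp (K * \<bar>t\<bar>)" and K: "K > 0"
  shows "norm (D t) \<le> M / K * exp (K * \<bar>t\<bar>)"
proof -
  have M: "M \<ge> 0" using order_trans[OF norm_ge_zero d[of 0]] by simp
  have *: "norm (D t) \<le> M / K * exp (K * t)" if "t \<ge> 0"
    and D: "\<And>t. (D has_vector_derivative d t) (at t)" and D0: "D 0 = 0"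
    and d: "\<And>t. norm (d t) \<le> M * exp (K * \<bar>t\<bar>)" for D d and t :: real
  proof -
    have "norm (D t - D 0) \<le> M / K * exp (K * t) - M / K * exp (K * 0)"
      by (rule has_vector_derivative_norm_le[OF \<open>t \<ge> 0\<close> D, where \<phi>' = "\<lambda>t. M * exp (K * t)"])
         (use K in \<open>auto intro!: derivative_eq_intros order_trans[OF d]\<close>)
    moreover have "M / K \<ge> 0" using M K by simp
    ultimately show ?thesis using D0 by simp
  qed
  show ?thesis
  proof (cases "t \<ge> 0")
    case True
    then show ?thesis using *[OF True D D0 d] by simp
  next
    case False
    have D': "((\<lambda>t. D (- t)) has_vector_derivative - d (- t)) (at t)" for t
      using vector_diff_chain_at[of uminus "-1" t D "d (- t)"] D[of "- t"]
        has_vector_derivative_minus[OF has_vector_derivative_id[of "at t"]]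
      by (simp add: o_def)
    have "norm (D (- (- t))) \<le> M / K * exp (K * - t)"
      by (rule *[OF _ D']) (use False D0 d[of "- s" for s] in auto)
    then show ?thesis using False by simp
  qed
qed

text \<open>Banach's fixed point theorem, with the unknown weighted by \<open>exp (- K * \<bar>t\<bar>)\<close> to make the integral
  operator a contraction on the whole line.\<close>

lemma picard_global:
  fixes f :: "real \<Rightarrow> 'a::euclidean_space \<Rightarrow> 'a"
  assumes cont: "\<And>u. continuous_on UNIV u \<Longrightarrow> continuous_on UNIV (\<lambda>t. f t (u t))"
    and lip: "\<And>t x y. norm (f t x - f t y) \<le> L * norm (x - y)"
    and bnd: "\<And>t. norm (f t x0) \<le> B"
  obtains x where "x 0 = x0" "\<And>t. (x has_vector_derivative f t (x t)) (at t)"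
proof -
  \<comment> \<open>Chosen so that |L| / K is at most 1/2, and positive even when L = 0.\<close>
  define K where "K = 2 * \<bar>L\<bar> + 1"
  have K: "K > 0" by (simp add: K_def add_nonneg_pos)
  \<comment> \<open>A bounded continuous \<open>u\<close> encodes the candidate solution
    \<open>lift u\<close>; a fixed point of \<open>\<Phi>\<close> says that \<open>lift u\<close>
    equals \<open>x0\<close> plus its own integral.\<close>
  define lift where "lift u t = x0 + exp (K * \<bar>t\<bar>) *\<^sub>R u t" for u :: "real \<Rightarrow> 'a" and t
  define P where "P u t = (LBINT s=0..t. f s (lift u s))" for u :: "real \<Rightarrow> 'a" and t :: real
  define \<Phi> where "\<Phi> u t = exp (- K * \<bar>t\<bar>) *\<^sub>R P u t" for u t
  have contl: "continuous_on UNIV (\<lambda>t. f t (lift u t))" if "continuous_on UNIV u" for u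
    unfolding lift_def by (intro cont continuous_intros that)
  have dP: "(P u has_vector_derivative f t (lift u t)) (at t)" if "continuous_on UNIV u" for u t
    using antiderivative_real_line[OF contl[OF that]] unfolding P_def .
  have P0: "P u 0 = 0" for u unfolding P_def zero_ereal_def by (rule interval_integral_endpoints_same)
  have lip': "norm (f t x - f t y) \<le> \<bar>L\<bar> * norm (x - y)" for t x y
    by (rule order_trans[OF lip mult_right_mono]) auto
  have cancel: "exp (- K * \<bar>t\<bar>) * (a * exp (K * \<bar>t\<bar>)) = a" for t a :: real
    by (simp add: exp_minus)
  have diff: "norm (\<Phi> u t - \<Phi> v t) \<le> 1/2 * m"
    if u: "continuous_on UNIV u" and v: "continuous_on UNIV v" and m: "\<And>t. norm (u t - v t) \<le> m" for u v t m
  proof -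
    have m0: "m \<ge> 0" using m[of 0] norm_ge_zero order_trans by blast
    have "norm ((\<lambda>t. P u t - P v t) t) \<le> (\<bar>L\<bar> * m) / K * exp (K * \<bar>t\<bar>)"
    proof (rule exponential_bound_antiderivative)
      fix t
      show "((\<lambda>t. P u t - P v t) has_vector_derivative (f t (lift u t) - f t (lift v t))) (at t)"
        by (intro has_vector_derivative_diff dP u v)
      have "norm (f t (lift u t) - f t (lift v t)) \<le> \<bar>L\<bar> * norm (lift u t - lift v t)" by (rule lip')
      also have "lift u t - lift v t = exp (K * \<bar>t\<bar>) *\<^sub>R (u t - v t)"
        by (simp add: lift_def scaleR_diff_right)
      also have "\<bar>L\<bar> * norm \<dots> \<le> \<bar>L\<bar> * (exp (K * \<bar>t\<bar>) * m)"
        by (simp add: m mult_left_mono)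
      finally show "norm (f t (lift u t) - f t (lift v t)) \<le> (\<bar>L\<bar> * m) * exp (K * \<bar>t\<bar>)"
        by (simp add: mult_ac)
    qed (use K P0 in auto)
    then have "exp (- K * \<bar>t\<bar>) * norm (P u t - P v t) \<le> exp (- K * \<bar>t\<bar>) * ((\<bar>L\<bar> * m) / K * exp (K * \<bar>t\<bar>))"
      by (intro mult_left_mono) auto
    also have "\<dots> = \<bar>L\<bar> / K * m" unfolding cancel by simp
    also have "\<dots> \<le> 1/2 * m" using K m0 by (intro mult_right_mono) (auto simp: K_def field_simps)
    finally show ?thesis by (simp add: \<Phi>_def flip: scaleR_diff_right)
  qed
  have zero: "norm (\<Phi> (\<lambda>_. 0) t) \<le> B / K" for t
  proof -
    have B: "B \<ge> 0" using bnd[of 0] norm_ge_zero order_trans by blast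
    have "norm (P (\<lambda>_. 0) t) \<le> B / K * exp (K * \<bar>t\<bar>)"
    proof (rule exponential_bound_antiderivative[OF dP P0 _ K])
      show "norm (f t (lift (\<lambda>_. 0) t)) \<le> B * exp (K * \<bar>t\<bar>)" for t
        using order_trans[OF bnd[of t], of "B * exp (K * \<bar>t\<bar>)"] B K
          mult_left_mono[of 1 "exp (K * \<bar>t\<bar>)" B] by (simp add: lift_def)
    qed simp
    then have "exp (- K * \<bar>t\<bar>) * norm (P (\<lambda>_. 0) t) \<le> exp (- K * \<bar>t\<bar>) * (B / K * exp (K * \<bar>t\<bar>))"
      by (intro mult_left_mono) auto
    then show ?thesis unfolding cancel by (simp add: \<Phi>_def)
  qed
  have bc: "\<Phi> (apply_bcontfun u) \<in> bcontfun" for u :: "real \<Rightarrow>\<^sub>C 'a"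
  proof -
    obtain m where m: "\<And>t. norm (apply_bcontfun u t) \<le> m"
      using bounded_apply_bcontfun[of u] unfolding bounded_iff by auto
    have "norm (\<Phi> (apply_bcontfun u) t) \<le> 1/2 * m + B / K" for t
      using diff[of "apply_bcontfun u" "\<lambda>_. 0" m t] m zero[of t] norm_triangle_sub[of "\<Phi> (apply_bcontfun u) t" "\<Phi> (\<lambda>_. 0) t"] by simp
    then have "bounded (range (\<Phi> (apply_bcontfun u)))" unfolding bounded_iff by blast
    moreover have "continuous_on UNIV (P (apply_bcontfun u))"
      using dP[of "apply_bcontfun u"] by (intro continuous_at_imp_continuous_on ballI has_vector_derivative_continuous) auto
    then have "continuous_on UNIV (\<Phi> (apply_bcontfun u))" unfolding \<Phi>_def by (intro continuous_intros)
    ultimately show ?thesis by (simp add: bcontfun_def)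
  qed
  have app: "apply_bcontfun (Bcontfun (\<Phi> (apply_bcontfun u))) = \<Phi> (apply_bcontfun u)" for u :: "real \<Rightarrow>\<^sub>C 'a"
    by (rule Bcontfun_inverse[OF bc])
  have "\<exists>!u :: real \<Rightarrow>\<^sub>C 'a. Bcontfun (\<Phi> (apply_bcontfun u)) = u"
  proof (rule banach_fix_type[of "1/2"])
    show "\<forall>u v :: real \<Rightarrow>\<^sub>C 'a. dist (Bcontfun (\<Phi> (apply_bcontfun u))) (Bcontfun (\<Phi> (apply_bcontfun v))) \<le> 1/2 * dist u v"
    proof (intro allI dist_bound)
      fix u v :: "real \<Rightarrow>\<^sub>C 'a" and t
      show "dist (apply_bcontfun (Bcontfun (\<Phi> (apply_bcontfun u))) t) (apply_bcontfun (Bcontfun (\<Phi> (apply_bcontfun v))) t) \<le> 1/2 * dist u v"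
        unfolding app dist_norm[of "\<Phi> (apply_bcontfun u) t"]
        by (rule diff) (auto simp: dist_bounded simp flip: dist_norm)
    qed
  qed auto
  then obtain u :: "real \<Rightarrow>\<^sub>C 'a" where "Bcontfun (\<Phi> (apply_bcontfun u)) = u" by blast
  then have fixp: "\<Phi> (apply_bcontfun u) = apply_bcontfun u" using app by metis
  have "lift (apply_bcontfun u) t = x0 + P (apply_bcontfun u) t" for t
  proof -
    have "lift (apply_bcontfun u) t = x0 + exp (K * \<bar>t\<bar>) *\<^sub>R \<Phi> (apply_bcontfun u) t" by (simp add: lift_def fixp)
    then show ?thesis by (simp add: \<Phi>_def exp_minus)
  qed
  then have "lift (apply_bcontfun u) = (\<lambda>t. x0 + P (apply_bcontfun u) t)" by auto
  moreover have "((\<lambda>t. x0 + P (apply_bcontfun u) t) has_vector_derivative f t (lift (apply_bcontfun u) t)) (at t)" for t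
    using dP[of "apply_bcontfun u" t] by (auto intro!: derivative_eq_intros)
  ultimately show ?thesis using that[of "lift (apply_bcontfun u)"] P0 by auto
qed

section \<open>The regularized fields and the flow on the sphere\<close>

text \<open>The derivative is bounded on a ball by compactness and outside it by homogeneity, so a
  single constant serves the whole space and Gronwall applies to trajectories of any size.\<close>

lemma reg_field_lipschitz:
  fixes F G :: "'a::euclidean_space \<Rightarrow> 'a"
  assumes \<alpha>: "\<alpha> < 1" and reg: "regularization \<alpha> F G" and \<nu>: "\<nu> > 0"
  obtains L where "L \<ge> 0" "\<And>x y. norm (reg_field \<alpha> F G \<nu> x - reg_field \<alpha> F G \<nu> y) \<le> L * norm (x - y)"
proof -
  define f where "f = reg_field \<alpha> F G \<nu>"
  obtain f' where f': "\<And>x. (f has_derivative blinfun_apply (f' x)) (at x)" and cf': "continuous_on UNIV f'"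
    using reg \<nu> unfolding regularization_def C1_on_def f_def by blast
  have "compact (f' ` cball 0 (2 * \<nu>))"
    by (intro compact_continuous_image continuous_on_subset[OF cf']) auto
  then obtain B where B: "\<And>x. norm x \<le> 2 * \<nu> \<Longrightarrow> norm (f' x) \<le> B"
    using compact_imp_bounded bounded_iff by (metis image_eqI mem_cball_0)
  have B0: "B \<ge> 0" using order_trans[OF norm_ge_zero B[of 0]] \<nu> by simp
  \<comment> \<open>outside the ball the derivative is homogeneous of degree \<open>\<alpha> - 1 < 0\<close>\<close>
  have bound: "norm (f' z) \<le> B" for z
  proof (cases "norm z \<le> 2 * \<nu>")
    case False
    \<comment> \<open>Division by \<open>l\<close> brings \<open>z\<close> to norm 2\<nu>, strictly
      off the interface, so that the homogeneity identity holds on a neighbourhood of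
      \<open>z\<close> and can be differentiated there.\<close>
    define l where "l = norm z / (2 * \<nu>)"
    have l: "l > 1" using False \<nu> by (simp add: l_def field_simps)
    have hom: "l powr \<alpha> *\<^sub>R f (w /\<^sub>R l) = f w" if w: "w \<in> {w. norm w > \<nu> * l}" for w
    proof -
      have w1: "norm w > \<nu>" using w l \<nu> by (smt (verit) mem_Collect_eq mult_le_cancel_left1)
      have e1: "norm (w /\<^sub>R l) = norm w / l" using l by (simp add: divide_inverse_commute)
      have w2: "norm (w /\<^sub>R l) > \<nu>" unfolding e1 using w l by (simp add: field_simps)
      have e2: "(w /\<^sub>R l) /\<^sub>R norm (w /\<^sub>R l) = w /\<^sub>R norm w" using l by simp
      have e3: "l powr \<alpha> * norm (w /\<^sub>R l) powr \<alpha> = norm w powr \<alpha>"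
        unfolding e1 using l by (simp flip: powr_mult)
      show ?thesis unfolding f_def reg_field_def e2 using w1 w2 by (simp add: e3 del: norm_scaleR)
    qed
    have "norm z > 0" using False \<nu> by linarith
    then have zl: "z \<in> {w. norm w > \<nu> * l}" using False \<nu> by (simp add: l_def)
    have op: "open {w::'a. norm w > \<nu> * l}" by (intro open_Collect_less continuous_intros)
    have "((\<lambda>w. l powr \<alpha> *\<^sub>R f (w /\<^sub>R l)) has_derivative (\<lambda>v. l powr \<alpha> *\<^sub>R f' (z /\<^sub>R l) (v /\<^sub>R l))) (at z)"
      by (intro has_derivative_scaleR_right has_derivative_compose[OF _ f'] derivative_intros)
    then have "(f has_derivative (\<lambda>v. l powr \<alpha> *\<^sub>R f' (z /\<^sub>R l) (v /\<^sub>R l))) (at z)"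
      by (rule has_derivative_transform_within_open[OF _ op zl hom])
    then have eq: "f' z v = l powr \<alpha> *\<^sub>R f' (z /\<^sub>R l) (v /\<^sub>R l)" for v
      using has_derivative_unique[OF f'] by metis
    have "norm (z /\<^sub>R l) \<le> 2 * \<nu>" using l False \<nu> by (auto simp: l_def)
    then have Bz: "norm (f' (z /\<^sub>R l)) \<le> B" by (rule B)
    show ?thesis
    proof (rule norm_blinfun_bound[OF B0])
      fix v
      have "norm (f' z v) = l powr \<alpha> * (norm (f' (z /\<^sub>R l) v) / l)"
        using l by (simp add: eq blinfun.scaleR_right divide_inverse_commute)
      also have "\<dots> = l powr (\<alpha> - 1) * norm (f' (z /\<^sub>R l) v)" using l by (simp add: powr_diff)
      also have "\<dots> \<le> 1 * (B * norm v)"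
        using l \<alpha> order_trans[OF norm_blinfun mult_right_mono[OF Bz]]
          powr_mono2'[of "\<alpha> - 1" 1 l]
        by (intro mult_mono) auto
      finally show "norm (f' z v) \<le> B * norm v" by simp
    qed
  qed (use B in auto)
  have "norm (f x - f y) \<le> B * norm (x - y)" for x y
    by (rule differentiable_bound[of UNIV f "\<lambda>x. blinfun_apply (f' x)"])
       (use f' bound in \<open>auto simp flip: norm_blinfun.rep_eq\<close>)
  with B0 that show ?thesis unfolding f_def by blast
qed

locale sphere_flow =
  fixes F :: "'a::euclidean_space \<Rightarrow> 'a" and L B :: real
  assumes L: "L > 0" and B: "B > 0"
    and Fs_lip: "\<And>x y. norm x = 1 \<Longrightarrow> norm y = 1 \<Longrightarrow> norm (Fs F x - Fs F y) \<le> L * norm (x - y)"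
    and Fr_lip: "\<And>x y. norm x = 1 \<Longrightarrow> norm y = 1 \<Longrightarrow> \<bar>Fr F x - Fr F y\<bar> \<le> L * norm (x - y)"
    and Fs_bd: "\<And>x. norm x = 1 \<Longrightarrow> norm (Fs F x) \<le> B"
    and Fr_bd: "\<And>x. norm x = 1 \<Longrightarrow> \<bar>Fr F x\<bar> \<le> B"

text \<open>\<open>deriv_tangent\<close> is the derivative of the identity
  \<open>Fs F y \<bullet> y = 0\<close>. \<open>deriv_unif\<close> is stated for the chord
  \<open>w - y\<close>, which is not tangent but has a radial part of second order only. Continuity
  is recorded along curves, the form in which the variational equation uses it.\<close>

locale sphere_C1_flow = sphere_flow F L B
  for F :: "'a::euclidean_space \<Rightarrow> 'a" and L B :: real +
  assumes deriv_linear: "\<And>y. norm y = 1 \<Longrightarrow> linear (sphere_deriv F y)"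
    and deriv_bd: "\<And>y v. norm y = 1 \<Longrightarrow> norm (sphere_deriv F y v) \<le> L * norm v"
    and deriv_cont: "\<And>(u :: real \<Rightarrow> 'a) v. continuous_on UNIV u \<Longrightarrow> (\<And>t. norm (u t) = 1) \<Longrightarrow>
      continuous_on UNIV v \<Longrightarrow> continuous_on UNIV (\<lambda>t. sphere_deriv F (u t) (v t))"
    and deriv_tangent: "\<And>y v. norm y = 1 \<Longrightarrow> sphere_deriv F y v \<bullet> y + Fs F y \<bullet> v = 0"
    and deriv_chain: "\<And>y s. sphere_solution F y \<Longrightarrow>
      ((\<lambda>s. Fs F (y s)) has_vector_derivative sphere_deriv F (y s) (Fs F (y s))) (at s)"
    and deriv_unif: "\<And>\<epsilon>. \<epsilon> > 0 \<Longrightarrow> \<exists>\<delta>>0. \<forall>y w. norm y = 1 \<longrightarrow> norm w = 1 \<longrightarrow> norm (w - y) < \<delta> \<longrightarrow>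
      norm (Fs F w - Fs F y - sphere_deriv F y (w - y)) \<le> \<epsilon> * norm (w - y)"

lemma Fs_inner_self: "norm y = 1 \<Longrightarrow> Fs F y \<bullet> y = 0"
  by (simp add: Fs_def Fr_def inner_diff_left dot_square_norm)

text \<open>Chords of the sphere are tangent up to second order, which is why \<open>y 0 - p\<close>
  can stand for a tangent vector in the linearization.\<close>

lemma sphere_inner_diff:
  fixes y w :: "'a::real_inner"
  assumes "norm y = 1" "norm w = 1"
  shows "y \<bullet> (w - y) = - (norm (w - y))\<^sup>2 / 2"
  using assms by (simp add: power2_norm_eq_inner inner_diff_left inner_diff_right inner_commute norm_eq_1)

lemma regularization_sphere_C1_flow:
  fixes F G :: "'a::euclidean_space \<Rightarrow> 'a"
  assumes \<alpha>: "\<alpha> < 1" and reg: "regularization \<alpha> F G"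
  obtains L B where "sphere_C1_flow F L B"
proof -
  \<comment> \<open>a \<open>C\<^sup>1\<close> extension of \<open>F\<close> to the whole space\<close>
  define f where "f = reg_field \<alpha> F G (1/2)"
  have fF: "f y = F y" if "norm y = 1" for y
    using that by (simp add: f_def reg_field_def)
  obtain f' where f': "\<And>x. (f has_derivative blinfun_apply (f' x)) (at x)" and cf': "continuous_on UNIV f'"
    using reg half_gt_zero[OF zero_less_one] unfolding regularization_def C1_on_def f_def by blast
  have cf: "continuous_on UNIV f"
    using f' by (intro continuous_at_imp_continuous_on) (auto intro: has_derivative_continuous)
  define k where "k y = f y - (f y \<bullet> y) *\<^sub>R y" for y
  define k' where "k' y = f' y - (blinfun_scaleR_left y o\<^sub>L ((blinfun_inner_left y o\<^sub>L f' y) + blinfun_inner_left (f y)))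
    - (f y \<bullet> y) *\<^sub>R id_blinfun" for y
  have k'_apply: "k' y v = f' y v - (f' y v \<bullet> y + f y \<bullet> v) *\<^sub>R y - (f y \<bullet> y) *\<^sub>R v" for y v
    by (simp add: k'_def blinfun.bilinear_simps inner_commute)
  have dk: "(k has_derivative blinfun_apply (k' y)) (at y)" for y
  proof -
    have "(k has_derivative (\<lambda>v. f' y v - ((f y \<bullet> y) *\<^sub>R v + (f y \<bullet> v + f' y v \<bullet> y) *\<^sub>R y))) (at y)"
      unfolding k_def by (rule derivative_intros f' | rule has_derivative_ident)+
    then show ?thesis
      by (rule has_derivative_eq_rhs) (auto simp: k'_apply algebra_simps)
  qed
  have ck': "continuous_on UNIV k'"
    unfolding k'_def
    by (intro continuous_intros cf cf' bounded_linear.continuous_on[OF bounded_linear_blinfun_scaleR_left]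
        bounded_linear.continuous_on[OF bounded_linear_blinfun_inner_left]
        bounded_bilinear.continuous_on[OF bounded_bilinear_blinfun_compose])
  have kFs: "k y = Fs F y" if "norm y = 1" for y
    using that by (simp add: k_def Fs_def Fr_def fF)
  have cpt: "compact (k' ` cball 0 1)"
    by (intro compact_continuous_image continuous_on_subset[OF ck']) auto
  then obtain B1 where B1: "\<And>x. norm x \<le> 1 \<Longrightarrow> norm (k' x) \<le> B1"
    using compact_imp_bounded bounded_iff by (metis image_eqI mem_cball_0)
  have B1_nonneg: "B1 \<ge> 0" using order_trans[OF norm_ge_zero B1[of 0]] by simp
  have "compact (f ` sphere 0 1)"
    by (intro compact_continuous_image continuous_on_subset[OF cf]) auto
  then obtain B2 where B2: "\<And>x. norm x = 1 \<Longrightarrow> norm (f x) \<le> B2"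
    using compact_imp_bounded bounded_iff by (metis image_eqI mem_sphere_0)
  obtain L1 where L1: "L1 \<ge> 0" "\<And>x y. norm (f x - f y) \<le> L1 * norm (x - y)"
    using reg_field_lipschitz[OF \<alpha> reg, of "1/2"] unfolding f_def by auto
  define B where "B = 2 * \<bar>B2\<bar> + 1"
  define L where "L = B1 + L1 + \<bar>B2\<bar> + 1"
  have L: "L > 0" and LB1: "B1 \<le> L" and LL1: "L1 + \<bar>B2\<bar> \<le> L" using B1_nonneg L1(1) by (auto simp: L_def)
  define n where "n x = x /\<^sub>R norm x" for x :: 'a
  have dn: "(n has_derivative (\<lambda>v. v - (y \<bullet> v) *\<^sub>R y)) (at y)" if "norm y = 1" for y
  proof -
    have y0: "y \<noteq> 0" using that by auto
    have "((\<lambda>x. inverse (norm x) *\<^sub>R x) has_derivative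
        (\<lambda>v. inverse (norm y) *\<^sub>R v + (- (inverse (norm y) * (v \<bullet> sgn y) * inverse (norm y))) *\<^sub>R y)) (at y)"
      by (rule has_derivative_scaleR[OF Deriv.has_derivative_inverse[OF _ has_derivative_norm[OF y0]] has_derivative_ident])
         (use y0 in auto)
    then show ?thesis unfolding n_def
      by (rule has_derivative_eq_rhs) (use that in \<open>auto simp: sgn_div_norm inner_commute\<close>)
  qed
  have n_id: "n y = y" if "norm y = 1" for y using that by (simp add: n_def)
  \<comment> \<open>At a unit vector the derivative of \<open>n\<close> is the tangential
    projection, so the chain rule yields \<open>k'\<close> applied after that projection.\<close>
  have sd: "sphere_deriv F y = (\<lambda>v. k' y (v - (y \<bullet> v) *\<^sub>R y))" if y: "norm y = 1" for y
  proof -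
    have "((\<lambda>x. k (n x)) has_derivative (\<lambda>v. k' y (v - (y \<bullet> v) *\<^sub>R y))) (at y)"
      by (rule has_derivative_compose[OF dn[OF y]]) (simp add: n_id[OF y] dk)
    then have "((\<lambda>x. Fs F (x /\<^sub>R norm x)) has_derivative (\<lambda>v. k' y (v - (y \<bullet> v) *\<^sub>R y))) (at y)"
      by (rule has_derivative_transform_within_open[where s = "- {0}"]) (use y in \<open>auto simp: n_def kFs\<close>)
    then show ?thesis unfolding sphere_deriv_def by (rule frechet_derivative_at[symmetric])
  qed
  have sd_tan: "sphere_deriv F y v = k' y v" if "norm y = 1" "v \<bullet> y = 0" for y v
    using that by (simp add: sd inner_commute)
  have proj_le: "norm (v - (y \<bullet> v) *\<^sub>R y) \<le> norm v" if "norm y = 1" for y v :: 'a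
  proof -
    have eq: "(norm (v - (y \<bullet> v) *\<^sub>R y))\<^sup>2 = (norm v)\<^sup>2 - (y \<bullet> v)\<^sup>2"
      unfolding power2_norm_eq_inner using that
      by (simp add: inner_diff_left inner_diff_right inner_commute norm_eq_1 power2_eq_square)
    have "(norm (v - (y \<bullet> v) *\<^sub>R y))\<^sup>2 \<le> (norm v)\<^sup>2" unfolding eq by simp
    then show ?thesis by (rule power2_le_imp_le) simp
  qed
  have kB1: "norm (k' x v) \<le> B1 * norm v" if "norm x \<le> 1" for x v
    by (rule order_trans[OF norm_blinfun mult_right_mono[OF B1[OF that]]]) simp
  have "sphere_C1_flow F L B"
  proof (intro sphere_C1_flow.intro sphere_flow.intro sphere_C1_flow_axioms.intro)
    show "L > 0" by fact
    show "B > 0" by (simp add: B_def add_nonneg_pos)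
    show "norm (Fs F x - Fs F y) \<le> L * norm (x - y)" if "norm x = 1" "norm y = 1" for x y
    proof -
      have "norm (k x - k y) \<le> B1 * norm (x - y)"
        by (rule differentiable_bound[of "cball 0 1" k "\<lambda>x. blinfun_apply (k' x)"])
           (use that dk B1 in \<open>auto intro: has_derivative_at_withinI simp flip: norm_blinfun.rep_eq\<close>)
      also have "\<dots> \<le> L * norm (x - y)" by (intro mult_right_mono LB1) simp
      finally show ?thesis using that by (simp add: kFs)
    qed
    show "\<bar>Fr F x - Fr F y\<bar> \<le> L * norm (x - y)" if "norm x = 1" "norm y = 1" for x y
    proof -
      have "Fr F x - Fr F y = (f x - f y) \<bullet> x + f y \<bullet> (x - y)"
        using that by (simp add: Fr_def fF algebra_simps)
      also have "\<bar>\<dots>\<bar> \<le> norm (f x - f y) * norm x + norm (f y) * norm (x - y)"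
        by (rule order_trans[OF abs_triangle_ineq add_mono[OF Cauchy_Schwarz_ineq2 Cauchy_Schwarz_ineq2]])
      also have "\<dots> \<le> L1 * norm (x - y) + \<bar>B2\<bar> * norm (x - y)"
        using L1(2)[of x y] B2[OF that(2)] that by (intro add_mono mult_right_mono) auto
      also have "\<dots> \<le> L * norm (x - y)"
        using mult_right_mono[OF LL1, of "norm (x - y)"] by (simp add: distrib_right)
      finally show ?thesis .
    qed
    show Frb: "\<bar>Fr F x\<bar> \<le> B" if "norm x = 1" for x
      using Cauchy_Schwarz_ineq2[of "f x" x] B2[OF that] that by (simp add: Fr_def fF B_def)
    show "norm (Fs F x) \<le> B" if "norm x = 1" for x
    proof -
      have "norm (Fs F x) \<le> norm (F x) + \<bar>F x \<bullet> x\<bar>"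
        unfolding Fs_def Fr_def using norm_triangle_ineq4[of "F x" "(F x \<bullet> x) *\<^sub>R x"] that by simp
      then show ?thesis
        using Cauchy_Schwarz_ineq2[of "F x" x] B2[OF that] that by (simp add: fF B_def)
    qed
    show "linear (sphere_deriv F y)" if "norm y = 1" for y
      unfolding sd[OF that]
      by (rule bounded_linear.linear[OF bounded_linear_compose[OF blinfun.bounded_linear_right
              has_derivative_bounded_linear[OF dn[OF that]]]])
    show "norm (sphere_deriv F y v) \<le> L * norm v" if "norm y = 1" for y v
    proof -
      have "norm (sphere_deriv F y v) \<le> B1 * norm (v - (y \<bullet> v) *\<^sub>R y)"
        unfolding sd[OF that] using that by (intro kB1) simp
      also have "\<dots> \<le> L * norm v"
        using LB1 L by (intro mult_mono proj_le that) auto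
      finally show ?thesis .
    qed
    show "continuous_on UNIV (\<lambda>t. sphere_deriv F (u t) (v t))"
      if "continuous_on UNIV u" "\<And>t. norm (u t) = 1" "continuous_on UNIV v" for u v :: "real \<Rightarrow> 'a"
      unfolding sd[OF that(2)]
      by (intro continuous_intros that continuous_on_compose2[OF ck'] ) auto
    show "sphere_deriv F y v \<bullet> y + Fs F y \<bullet> v = 0" if y: "norm y = 1" for y v
    proof -
      define w where "w = v - (y \<bullet> v) *\<^sub>R y"
      have "w \<bullet> y = 0" using y by (simp add: w_def algebra_simps norm_eq_1 inner_commute[of y v])
      then have "k' y w \<bullet> y + Fs F y \<bullet> w = 0"
        using y by (simp add: k'_apply Fs_def Fr_def fF algebra_simps norm_eq_1 inner_commute[of w y])
      then show ?thesis
        using Fs_inner_self[OF y, of F] by (simp add: sd[OF y] w_def inner_diff_right)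
    qed
    show "((\<lambda>s. Fs F (y s)) has_vector_derivative sphere_deriv F (y s) (Fs F (y s))) (at s)"
      if "sphere_solution F y" for y s
    proof -
      have y1: "norm (y s) = 1" for s using that by (auto simp: sphere_solution_def image_subset_iff)
      have dy: "(y has_derivative (\<lambda>t. t *\<^sub>R Fs F (y s))) (at s)"
        using that by (simp add: sphere_solution_def global_solution_def has_vector_derivative_def)
      have "((\<lambda>s. k (y s)) has_derivative (\<lambda>t. k' (y s) (t *\<^sub>R Fs F (y s)))) (at s)"
        by (rule has_derivative_compose[OF dy dk])
      then show ?thesis
        unfolding has_vector_derivative_def
        by (simp add: kFs[OF y1] blinfun.scaleR_right sd_tan[OF y1 Fs_inner_self[OF y1]])
    qed
    show "\<exists>\<delta>>0. \<forall>y w. norm y = 1 \<longrightarrow> norm w = 1 \<longrightarrow> norm (w - y) < \<delta> \<longrightarrow>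
        norm (Fs F w - Fs F y - sphere_deriv F y (w - y)) \<le> \<epsilon> * norm (w - y)" if \<epsilon>: "\<epsilon> > 0" for \<epsilon>
    proof -
      have "uniformly_continuous_on (cball 0 1) k'"
        by (intro compact_uniformly_continuous continuous_on_subset[OF ck']) auto
      then obtain d where d: "d > 0"
        "\<And>x y. norm x \<le> 1 \<Longrightarrow> norm y \<le> 1 \<Longrightarrow> norm (x - y) < d \<Longrightarrow> norm (k' x - k' y) < \<epsilon> / 2"
        unfolding uniformly_continuous_on_def dist_norm using half_gt_zero[OF \<epsilon>] by (metis mem_cball_0)
      \<comment> \<open>The first bound makes \<open>k'\<close> nearly constant close to
        \<open>y\<close>, the second absorbs the radial part of the chord, which is quadratic in
        \<open>norm (w - y)\<close>; each contributes \<epsilon>/2.\<close>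
      define \<delta> where "\<delta> = min d (\<epsilon> / (B1 + 1))"
      have \<delta>: "\<delta> > 0" using d \<epsilon> B1_nonneg by (simp add: \<delta>_def)
      have "norm (Fs F w - Fs F y - sphere_deriv F y (w - y)) \<le> \<epsilon> * norm (w - y)"
        if y: "norm y = 1" and w: "norm w = 1" and wy: "norm (w - y) < \<delta>" for y w
      proof -
        let ?S = "cball 0 1 \<inter> ball y d"
        let ?g = "\<lambda>x. k x - k' y x"
        have yw: "y \<in> ?S" "w \<in> ?S" using y w d(1) wy by (auto simp: \<delta>_def dist_norm norm_minus_commute)
        have "norm (?g w - ?g y) \<le> \<epsilon> / 2 * norm (w - y)"
        proof (rule differentiable_bound[of ?S ?g "\<lambda>x. blinfun_apply (k' x - k' y)"])
          show "(?g has_derivative blinfun_apply (k' x - k' y)) (at x within ?S)" for x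
            by (rule has_derivative_at_withinI, rule has_derivative_eq_rhs[OF has_derivative_diff[OF dk blinfun.bounded_linear_right[THEN bounded_linear_imp_has_derivative]]])
               (auto simp: blinfun.bilinear_simps)
          show "onorm (blinfun_apply (k' x - k' y)) \<le> \<epsilon> / 2" if "x \<in> ?S" for x
            using d(2)[of x y] that y by (simp flip: norm_blinfun.rep_eq add: dist_norm norm_minus_commute less_imp_le)
        qed (use yw in \<open>auto intro: convex_Int\<close>)
        then have 1: "norm (k w - k y - k' y (w - y)) \<le> \<epsilon> / 2 * norm (w - y)"
          by (simp add: blinfun.diff_right algebra_simps)
        have "norm (k' y ((y \<bullet> (w - y)) *\<^sub>R y)) \<le> B1 * \<bar>y \<bullet> (w - y)\<bar>"
          using kB1[of y "(y \<bullet> (w - y)) *\<^sub>R y"] y by simp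
        also have "\<bar>y \<bullet> (w - y)\<bar> = norm (w - y) * norm (w - y) / 2"
          by (simp add: sphere_inner_diff[OF y w] power2_eq_square)
        also have "B1 * \<dots> \<le> (B1 + 1) * (\<epsilon> / (B1 + 1) * norm (w - y) / 2)"
          using wy B1_nonneg \<epsilon> by (intro mult_mono divide_right_mono mult_right_mono) (auto simp: \<delta>_def)
        also have "\<dots> = \<epsilon> / 2 * norm (w - y)"
          using B1_nonneg by (simp add: divide_simps)
        finally have 2: "norm (k' y ((y \<bullet> (w - y)) *\<^sub>R y)) \<le> \<epsilon> / 2 * norm (w - y)" .
        have "Fs F w - Fs F y - sphere_deriv F y (w - y) = (k w - k y - k' y (w - y)) + k' y ((y \<bullet> (w - y)) *\<^sub>R y)"
          by (simp add: kFs y w sd[OF y] blinfun.diff_right)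
        then show ?thesis using norm_triangle_le[OF order_trans[OF add_mono[OF 1 2]]] by simp
      qed
      with \<delta> show ?thesis by blast
    qed
  qed
  then show ?thesis by (rule that)
qed

context sphere_flow
begin

lemma solution_norm: "sphere_solution F y \<Longrightarrow> norm (y s) = 1"
  by (auto simp: sphere_solution_def image_subset_iff)

lemma solution_deriv: "sphere_solution F y \<Longrightarrow> (y has_vector_derivative Fs F (y s)) (at s)"
  by (simp add: sphere_solution_def global_solution_def)

lemma solution_shift:
  assumes "sphere_solution F y" shows "sphere_solution F (\<lambda>s. y (c + s))"
proof -
  have "((\<lambda>s. y (c + s)) has_vector_derivative Fs F (y (c + s))) (at s)" for s
    using vector_diff_chain_at[of "\<lambda>s. c + s" 1 s y "Fs F (y (c + s))"] solution_deriv[OF assms, of "c + s"]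
      has_vector_derivative_add[OF has_vector_derivative_const has_vector_derivative_id, of c "at s"]
    by (simp add: o_def)
  then show ?thesis using solution_norm[OF assms] by (auto simp: sphere_solution_def global_solution_def)
qed

lemma solution_diff:
  assumes "sphere_solution F y" "sphere_solution F w" "a \<le> b"
  shows "norm (y b - w b) \<le> norm (y a - w a) * exp (L * (b - a))"
  using assms L solution_norm
  by (intro ode_lipschitz_diff[where f = "\<lambda>_. Fs F"])
     (auto intro!: has_vector_derivative_at_within solution_deriv Fs_lip)

lemma solution_continuous: "sphere_solution F y \<Longrightarrow> continuous_on S y"
  by (intro continuous_at_imp_continuous_on ballI has_vector_derivative_continuous[OF solution_deriv])

lemma solution_lipschitz:
  assumes "sphere_solution F y"
  shows "norm (y b - y a) \<le> B * \<bar>b - a\<bar>"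
proof -
  have *: "norm (y b - y a) \<le> B * (b - a)" if "a \<le> b" for a b
  proof -
    have "norm (y b - y a) \<le> B * b - B * a"
      by (rule has_vector_derivative_norm_le[OF that solution_deriv[OF assms], where \<phi>' = "\<lambda>_. B"])
         (auto intro!: derivative_eq_intros Fs_bd solution_norm assms)
    then show ?thesis by (simp add: algebra_simps)
  qed
  show ?thesis using *[of a b] *[of b a] by (cases "a \<le> b") (auto simp: norm_minus_commute)
qed

lemma sphere_solution_exists:
  assumes y0: "norm y0 = 1"
  obtains y where "sphere_solution F y" "y 0 = y0"
proof -
  define H where "H x = norm x *\<^sub>R Fs F (x /\<^sub>R norm x)" for x
  \<comment> \<open>\<open>H\<close> is a globally Lipschitz extension of the field that is tangent to all spheres\<close>
  have H1: "norm (H x - H y) \<le> (B + 2 * L) * norm (x - y)" if "y \<noteq> 0" "x \<noteq> 0" for x y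
  proof -
    have n: "norm (x /\<^sub>R norm x) = 1" "norm (y /\<^sub>R norm y) = 1" using that by auto
    have "norm y *\<^sub>R (x /\<^sub>R norm x - y /\<^sub>R norm y) = (x - y) + (norm y - norm x) *\<^sub>R (x /\<^sub>R norm x)"
      using that by (simp add: algebra_simps)
    also have "norm \<dots> \<le> norm (x - y) + \<bar>norm y - norm x\<bar> * 1"
      by (rule norm_triangle_le, rule add_mono) (auto simp only: order_refl norm_scaleR[of "norm y - norm x"] n)
    also have "\<dots> \<le> 2 * norm (x - y)" using norm_triangle_ineq3[of x y] by simp
    finally have 1: "norm y * norm (x /\<^sub>R norm x - y /\<^sub>R norm y) \<le> 2 * norm (x - y)" by simp
    have "H x - H y = (norm x - norm y) *\<^sub>R Fs F (x /\<^sub>R norm x) + norm y *\<^sub>R (Fs F (x /\<^sub>R norm x) - Fs F (y /\<^sub>R norm y))"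
      by (simp add: H_def algebra_simps)
    also have "norm \<dots> \<le> norm (x - y) * B + norm y * (L * norm (x /\<^sub>R norm x - y /\<^sub>R norm y))"
      using Fs_bd[OF n(1)] Fs_lip[OF n] norm_triangle_ineq3[of x y]
      by (intro norm_triangle_le add_mono) (auto intro!: mult_mono)
    also have "\<dots> \<le> norm (x - y) * B + L * (2 * norm (x - y))"
      using mult_left_mono[OF 1, of L] L by (simp add: mult_ac)
    finally show ?thesis by (simp add: algebra_simps)
  qed
  have H2: "norm (H x) \<le> (B + 2 * L) * norm x" for x
  proof (cases "x = 0")
    case False
    then have "norm (H x) \<le> norm x * B" unfolding H_def using Fs_bd[of "x /\<^sub>R norm x"] by (simp add: mult_left_mono)
    also have "\<dots> \<le> (B + 2 * L) * norm x" using L by (simp add: algebra_simps)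
    finally show ?thesis .
  qed (simp add: H_def)
  have H0: "H 0 = 0" by (simp add: H_def)
  have lip: "norm (H x - H y) \<le> (B + 2 * L) * norm (x - y)" for x y
    using H1[of y x] H2[of x] H2[of y] H0 by (cases "x = 0"; cases "y = 0") auto
  have "(B + 2 * L)-lipschitz_on UNIV H"
    using lip L B by (intro lipschitz_onI) (auto simp: dist_norm)
  then have cH: "continuous_on UNIV H" by (rule lipschitz_on_continuous_on)
  obtain y where y: "y 0 = y0" "\<And>t. (y has_vector_derivative H (y t)) (at t)"
  proof (rule picard_global[of "\<lambda>_. H"])
    show "continuous_on UNIV (\<lambda>t. H (u t))" if "continuous_on UNIV u" for u :: "real \<Rightarrow> 'a"
      by (rule continuous_on_compose2[OF cH that]) auto
  qed (use lip in auto)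
  have "y t \<bullet> H (y t) = 0" for t
    using Fs_inner_self[of "y t /\<^sub>R norm (y t)" F] by (cases "y t = 0") (auto simp: H_def inner_commute)
  then have "((\<lambda>t. y t \<bullet> y t) has_real_derivative 0) (at t)" for t
    using has_derivative_inner[OF y(2)[of t, unfolded has_vector_derivative_def] y(2)[of t, unfolded has_vector_derivative_def]]
    by (simp add: has_field_derivative_def inner_commute flip: lambda_zero)
  then have "y t \<bullet> y t = y 0 \<bullet> y 0" for t by (rule DERIV_isconst_all[rule_format])
  then have n: "norm (y t) = 1" for t using y(1) y0 by (simp add: norm_eq_sqrt_inner)
  then have "H (y t) = Fs F (y t)" for t by (simp add: H_def)
  then have "sphere_solution F y"
    using y(2) n by (auto simp: sphere_solution_def global_solution_def)
  then show ?thesis using y(1) that by blast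
qed

end

section \<open>Powers of linear maps\<close>

definition geom_decay :: "(nat \<Rightarrow> 'a::real_normed_vector) \<Rightarrow> bool" where
  "geom_decay a \<longleftrightarrow> (\<exists>C q. 0 \<le> q \<and> q < 1 \<and> (\<forall>n. norm (a n) \<le> C * q ^ n))"

text \<open>The ratio is raised to some \<open>s\<close> strictly between \<open>r\<close> and 1,
  which absorbs the forcing even in the resonant case \<open>q = r\<close> without a polynomial
  factor; \<open>D\<close> is chosen so that the induction closes.\<close>

lemma geom_decay_recurrence:
  assumes b: "geom_decay b" and r: "0 \<le> r" "r < 1"
    and step: "\<And>n. norm (a (Suc n)) \<le> r * norm (a n) + norm (b n)"
  shows "geom_decay a"
proof -
  obtain C q where q: "0 \<le> q" "q < 1" and C: "\<And>n. norm (b n) \<le> C * q ^ n"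
    using b unfolding geom_decay_def by blast
  define s where "s = max q ((r + 1) / 2)"
  have s: "0 \<le> s" "s < 1" "r < s" "q \<le> s" using q r by (auto simp: s_def less_max_iff_disj)
  have C0: "C \<ge> 0" using order_trans[OF norm_ge_zero C[of 0]] by simp
  define D where "D = max (norm (a 0)) (C / (s - r))"
  have D: "C \<le> D * (s - r)"
    using s(3) by (simp add: D_def flip: pos_divide_le_eq)
  have "norm (a n) \<le> D * s ^ n" for n
  proof (induction n)
    case (Suc n)
    have "norm (a (Suc n)) \<le> r * (D * s ^ n) + C * s ^ n"
      using step[of n] mult_left_mono[OF Suc r(1)] C[of n] mult_left_mono[OF power_mono[OF s(4) q(1), of n] C0] by linarith
    also have "\<dots> \<le> r * (D * s ^ n) + D * (s - r) * s ^ n"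
      using D s(1) by (intro add_left_mono mult_right_mono) auto
    also have "\<dots> = D * s ^ Suc n" by (simp add: algebra_simps)
    finally show ?case .
  qed (simp add: D_def)
  then show ?thesis using s unfolding geom_decay_def by blast
qed

lemma geom_decay_summable:
  fixes a :: "nat \<Rightarrow> 'a::banach"
  assumes "geom_decay a" shows "summable a"
proof -
  obtain C q where q: "0 \<le> q" "q < 1" and C: "\<And>n. norm (a n) \<le> C * q ^ n"
    using assms unfolding geom_decay_def by blast
  have "summable (\<lambda>n. C * q ^ n)" using q by (intro summable_mult summable_geometric) auto
  then show ?thesis by (rule summable_comparison_test') (use C in auto)
qed

text \<open>Applied to the orbit of a vector under a linear map, this yields an annihilating
  polynomial. Repeated terms are treated separately, because dependence is a notion for
  sets.\<close>

lemma linear_relation_exists: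
  fixes f :: "nat \<Rightarrow> 'a::euclidean_space"
  obtains c :: "nat \<Rightarrow> real" and n i where "i \<le> n" "c i \<noteq> 0" "(\<Sum>i\<le>n. c i *\<^sub>R f i) = 0"
proof (cases "inj_on f {..DIM('a)}")
  case True
  have "dependent (f ` {..DIM('a)})"
    by (rule dependent_biggerset) (auto simp: card_image[OF True])
  then obtain u v where u: "v \<in> f ` {..DIM('a)}" "u v \<noteq> 0" "(\<Sum>v\<in>f ` {..DIM('a)}. u v *\<^sub>R v) = 0"
    using dependent_finite[of "f ` {..DIM('a)}"] by auto
  then have "(\<Sum>i\<le>DIM('a). u (f i) *\<^sub>R f i) = 0"
    by (simp add: sum.reindex[OF True] o_def)
  with u(1,2) show ?thesis using that[of _ _ "\<lambda>i. u (f i)"] by auto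
next
  case False
  then obtain i j where ij: "i \<le> DIM('a)" "j \<le> DIM('a)" "i \<noteq> j" "f i = f j"
    by (auto simp: inj_on_def)
  let ?c = "\<lambda>k. (if k = i then 1 else 0) - (if k = j then 1 else (0::real))"
  have "(\<Sum>k\<le>DIM('a). ?c k *\<^sub>R f k) = (\<Sum>k\<le>DIM('a). (if k = i then f k else 0) - (if k = j then f k else 0))"
    by (intro sum.cong) (auto simp: algebra_simps)
  also have "\<dots> = 0" using ij by (simp add: sum_subtractf)
  finally show ?thesis using that[of i "DIM('a)" ?c] ij by simp
qed

text \<open>The complexification of \<open>'a\<close> is \<open>'a \<times> 'a\<close>, the pair \<open>(u, w)\<close> standing for \<open>u + \<i> w\<close>.\<close>

definition cscale :: "complex \<Rightarrow> 'a \<times> 'a \<Rightarrow> 'a \<times> 'a::real_vector" where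
  "cscale c x = (Re c *\<^sub>R fst x - Im c *\<^sub>R snd x, Im c *\<^sub>R fst x + Re c *\<^sub>R snd x)"

lemma norm_cscale: "norm (cscale c x) = norm c * norm (x :: 'a \<times> 'a::real_inner)"
proof -
  have "(norm (cscale c x))\<^sup>2 = (norm c * norm x)\<^sup>2"
    unfolding power_mult_distrib cmod_power2 power2_norm_eq_inner inner_prod_def cscale_def fst_conv snd_conv
    by (simp add: inner_diff_left inner_diff_right inner_add_left inner_add_right inner_commute
        algebra_simps power2_eq_square)
  then show ?thesis by simp
qed

lemma cscale_simps:
  "cscale c (x + y) = cscale c x + cscale c y"
  "cscale c (x - y) = cscale c x - cscale c y"
  "cscale (c + d) x = cscale c x + cscale d x"
  "cscale (- c) x = - cscale c x"
  "cscale c (cscale d x) = cscale (c * d) x"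
  "cscale 0 x = 0" "cscale c 0 = 0" "cscale 1 x = x"
  "cscale (of_real r) x = r *\<^sub>R x"
  by (auto simp: cscale_def prod_eq_iff algebra_simps)

lemma cscale_sum: "cscale c (\<Sum>i\<in>I. f i) = (\<Sum>i\<in>I. cscale c (f i))"
  by (induction I rule: infinite_finite_induct) (auto simp: cscale_simps)

locale linear_complexified =
  fixes M :: "'a::euclidean_space \<Rightarrow> 'a"
  assumes lin: "linear M"
begin

definition Mc :: "'a \<times> 'a \<Rightarrow> 'a \<times> 'a" where "Mc x = (M (fst x), M (snd x))"

lemma Mc_linear: "Mc (x + y) = Mc x + Mc y" "Mc (x - y) = Mc x - Mc y" "Mc (cscale c x) = cscale c (Mc x)" "Mc 0 = 0"
  by (simp_all add: Mc_def cscale_def linear_add[OF lin] linear_diff[OF lin] linear_cmul[OF lin] linear_0[OF lin] prod_eq_iff)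

lemma Mc_pow_linear: "(Mc ^^ n) (x + y) = (Mc ^^ n) x + (Mc ^^ n) y" "(Mc ^^ n) (x - y) = (Mc ^^ n) x - (Mc ^^ n) y"
  "(Mc ^^ n) (cscale c x) = cscale c ((Mc ^^ n) x)" "(Mc ^^ n) 0 = 0"
  by (induction n) (simp_all add: Mc_linear)

lemma Mc_pow_swap: "(Mc ^^ n) (Mc x) = Mc ((Mc ^^ n) x)"
  by (simp add: funpow_swap1)

lemma fst_Mc_pow: "fst ((Mc ^^ n) x) = (M ^^ n) (fst x)"
  by (induction n) (simp_all add: Mc_def)

text \<open>This is the polynomial \<open>p\<close> evaluated at the operator \<open>Mc\<close>,
  with complex coefficients acting through \<open>cscale\<close>.\<close>

definition pact :: "complex poly \<Rightarrow> 'a \<times> 'a \<Rightarrow> 'a \<times> 'a" where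
  "pact p x = (\<Sum>i\<le>degree p. cscale (coeff p i) ((Mc ^^ i) x))"

lemma pact_pad:
  assumes "degree p \<le> n" shows "pact p x = (\<Sum>i\<le>n. cscale (coeff p i) ((Mc ^^ i) x))"
  unfolding pact_def using assms
  by (intro sum.mono_neutral_left) (auto simp: coeff_eq_0 cscale_simps)

lemma pact_linear_arg: "pact p (x - y) = pact p x - pact p y" "pact p (cscale c x) = cscale c (pact p x)"
  "pact p (Mc x) = Mc (pact p x)"
proof -
  show "pact p (x - y) = pact p x - pact p y"
    by (simp add: pact_def Mc_pow_linear cscale_simps sum_subtractf)
  show "pact p (cscale c x) = cscale c (pact p x)"
    by (simp add: pact_def Mc_pow_linear cscale_simps cscale_sum mult.commute)
  have "Mc (\<Sum>i\<in>I. f i) = (\<Sum>i\<in>I. Mc (f i))" for f :: "nat \<Rightarrow> _" and I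
    by (induction I rule: infinite_finite_induct) (auto simp: Mc_linear)
  then show "pact p (Mc x) = Mc (pact p x)"
    by (simp add: pact_def Mc_pow_swap Mc_linear)
qed

lemma pact_root_factor: "pact ([:- \<mu>, 1:] * q) x = pact q (Mc x - cscale \<mu> x)"
proof (cases "q = 0")
  case False
  have d: "degree ([:- \<mu>, 1:] * q) = Suc (degree q)" using False by (subst degree_mult_eq) auto
  have "[:- \<mu>, 1:] * q = pCons 0 q + smult (- \<mu>) q" by simp
  then have "coeff ([:- \<mu>, 1:] * q) i = coeff (pCons 0 q) i + (- \<mu>) * coeff q i" for i by simp
  then have "pact ([:- \<mu>, 1:] * q) x =
      (\<Sum>i\<le>Suc (degree q). cscale (coeff (pCons 0 q) i) ((Mc ^^ i) x)) +
      (\<Sum>i\<le>Suc (degree q). cscale (- \<mu>) (cscale (coeff q i) ((Mc ^^ i) x)))"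
    unfolding pact_def d by (simp only: cscale_simps(3,5) sum.distrib)
  also have "(\<Sum>i\<le>Suc (degree q). cscale (coeff (pCons 0 q) i) ((Mc ^^ i) x)) = pact q (Mc x)"
    by (subst sum.atMost_Suc_shift) (simp add: cscale_simps pact_def funpow_swap1)
  also have "(\<Sum>i\<le>Suc (degree q). cscale (- \<mu>) (cscale (coeff q i) ((Mc ^^ i) x))) = cscale (- \<mu>) (pact q x)"
    by (simp only: pact_pad[of q "Suc (degree q)", OF le_SucI[OF order_refl]] cscale_sum)
  finally show ?thesis by (simp add: pact_linear_arg cscale_simps)
qed (simp add: pact_def cscale_simps)

lemma pact_in_subspace:
  assumes W: "subspace W" "\<And>w. w \<in> W \<Longrightarrow> M w \<in> W" and x: "x \<in> W \<times> W"
  shows "pact p x \<in> W \<times> W"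
proof -
  have M: "(Mc ^^ i) x \<in> W \<times> W" for i
    by (induction i) (use x W(2) in \<open>auto simp: Mc_def mem_Times_iff\<close>)
  have "cscale c y \<in> W \<times> W" if "y \<in> W \<times> W" for c y
    using that W(1) by (auto simp: cscale_def mem_Times_iff intro!: subspace_add subspace_diff subspace_scale)
  then have "cscale (coeff p i) ((Mc ^^ i) x) \<in> W \<times> W" for i using M by blast
  then show ?thesis unfolding pact_def
    by (intro subspace_sum subspace_Times W(1)) auto
qed

text \<open>Linear factors of the annihilating polynomial are split off one by one: one whose root is not an
  eigenvalue on \<open>W\<close> can be cancelled, the others lead to a recurrence of ratio less than 1.\<close>

lemma geom_decay_of_annihilated:
  assumes W: "subspace W" "\<And>w. w \<in> W \<Longrightarrow> M w \<in> W"
    and eig: "\<And>\<mu> x. x \<in> W \<times> W \<Longrightarrow> x \<noteq> 0 \<Longrightarrow> Mc x = cscale \<mu> x \<Longrightarrow> norm \<mu> < 1"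
  shows "p \<noteq> 0 \<Longrightarrow> x \<in> W \<times> W \<Longrightarrow> pact p x = 0 \<Longrightarrow> geom_decay (\<lambda>n. (Mc ^^ n) x)"
proof (induction "degree p" arbitrary: p x)
  case 0
  then obtain c where c: "p = [:c:]" "c \<noteq> 0" by (metis degree_eq_zeroE pCons_0_0)
  then have "cscale c x = 0" using 0 by (simp add: pact_def)
  then have "x = 0" using c norm_cscale[of c x] by simp
  then show ?case unfolding geom_decay_def by (intro exI[of _ 0]) (simp add: Mc_pow_linear)
next
  case (Suc d)
  have "\<not> constant (poly p)" using Suc.hyps(2) by (simp add: constant_degree)
  then obtain \<mu> where "poly p \<mu> = 0" using fundamental_theorem_of_algebra by blast
  then obtain q where q: "p = [:- \<mu>, 1:] * q" by (auto simp: poly_eq_0_iff_dvd elim: dvdE)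
  then have q0: "q \<noteq> 0" using Suc.prems by auto
  have dq: "d = degree q" using Suc.hyps(2) q0 unfolding q by (subst (asm) degree_mult_eq) auto
  define x' where "x' = Mc x - cscale \<mu> x"
  have x': "x' \<in> W \<times> W"
    using Suc.prems(2) W by (auto simp: x'_def Mc_def cscale_def mem_Times_iff intro!: subspace_add subspace_diff subspace_scale)
  have px': "pact q x' = 0" using Suc.prems(3) unfolding q pact_root_factor x'_def .
  then have IH': "geom_decay (\<lambda>n. (Mc ^^ n) x')" using Suc.hyps(1)[OF dq q0 x'] by simp
  show ?case
  proof (cases "norm \<mu> < 1")
    case True
    show ?thesis
    proof (rule geom_decay_recurrence[OF IH' norm_ge_zero True])
      fix n
      have eq: "(Mc ^^ Suc n) x = cscale \<mu> ((Mc ^^ n) x) + (Mc ^^ n) x'"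
        unfolding x'_def Mc_pow_linear Mc_pow_swap by simp
      show "norm ((Mc ^^ Suc n) x) \<le> norm \<mu> * norm ((Mc ^^ n) x) + norm ((Mc ^^ n) x')"
        unfolding eq norm_cscale[symmetric] by (rule norm_triangle_ineq)
    qed
  next
    case False
    have "Mc (pact q x) = cscale \<mu> (pact q x)"
      using px' by (simp add: x'_def pact_linear_arg)
    then have "pact q x = 0"
      using eig[OF pact_in_subspace[OF W Suc.prems(2)]] False by blast
    then show ?thesis using Suc.hyps(1)[OF dq q0 Suc.prems(2)] by simp
  qed
qed

text \<open>A polynomial that kills the single vector \<open>x\<close> suffices for the induction on
  the degree; the real relation is read over the complex numbers so that the polynomial has
  roots.\<close>

lemma annihilator_exists: obtains p where "p \<noteq> 0" "pact p x = 0"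
proof -
  obtain c :: "nat \<Rightarrow> real" and n i where c: "i \<le> n" "c i \<noteq> 0" "(\<Sum>i\<le>n. c i *\<^sub>R (Mc ^^ i) x) = 0"
    by (rule linear_relation_exists[of "\<lambda>i. (Mc ^^ i) x"])
  define p where "p = (\<Sum>i\<le>n. monom (complex_of_real (c i)) i)"
  have co: "coeff p k = (if k \<le> n then of_real (c k) else 0)" for k
    by (simp add: p_def coeff_sum)
  then have "coeff p i \<noteq> 0" using c by simp
  then have "p \<noteq> 0" by auto
  moreover have "degree p \<le> n" by (intro degree_le) (simp add: co)
  then have "pact p x = 0" using c(3) by (simp add: pact_pad co cscale_simps)
  ultimately show ?thesis by (rule that)
qed

end

text \<open>No complement of \<open>span {e}\<close> is needed: on the range of \<open>M - 1\<close> the powers decay, so \<open>M\<^sup>n v\<close> converges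
  for every \<open>v\<close>, and its limit is \<open>l v *\<^sub>R e\<close>.\<close>

lemma power_contraction:
  fixes M :: "'a::euclidean_space \<Rightarrow> 'a"
  assumes lin: "linear M" and e: "M e = e" "e \<noteq> 0"
    and mult: "\<And>\<xi> k. ((\<lambda>v. M v - v) ^^ k) \<xi> = 0 \<Longrightarrow> \<xi> \<in> span {e}"
    and eig: "\<And>\<mu> u w. u \<noteq> 0 \<or> w \<noteq> 0 \<Longrightarrow> M u = Re \<mu> *\<^sub>R u - Im \<mu> *\<^sub>R w \<Longrightarrow> M w = Im \<mu> *\<^sub>R u + Re \<mu> *\<^sub>R w
      \<Longrightarrow> \<mu> = 1 \<or> norm \<mu> < 1"
  obtains l :: "'a \<Rightarrow> real" where "linear l" "l e = 1" "\<And>v. l (M v) = l v"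
    "\<And>\<epsilon>. \<epsilon> > 0 \<Longrightarrow> \<forall>\<^sub>F n in sequentially. \<forall>v. l v = 0 \<longrightarrow> norm ((M ^^ n) v) \<le> \<epsilon> * norm v"
proof -
  interpret linear_complexified M by (rule linear_complexified.intro) (rule lin)
  define W where "W = range (\<lambda>v. M v - v)"
  have linW: "linear (\<lambda>v. M v - v)" by (intro linear_compose_sub lin linear_ident)
  have W: "subspace W" unfolding W_def by (intro linear_subspace_image linW subspace_UNIV)
  have MW: "M w \<in> W" if "w \<in> W" for w
  proof -
    obtain v where "w = M v - v" using \<open>w \<in> W\<close> unfolding W_def by blast
    then have "M w = M (M v) - M v" by (simp add: linear_diff[OF lin])
    then show ?thesis unfolding W_def by blast
  qed
  have fixed: "v \<in> span {e}" if "M v = v" for v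
    using mult[of 1 v] that by simp
  have span_fixed: "M v = v" if "v \<in> span {e}" for v
    using that e(1) by (auto simp: span_singleton linear_cmul[OF lin])
  \<comment> \<open>This excludes Jordan blocks for the multiplier 1: a fixed vector in the range of
    \<open>M - 1\<close> comes from a generalized eigenvector, which lies in \<open>span {e}\<close>
    and is therefore itself fixed.\<close>
  have W0: "w = 0" if w: "w \<in> W" "M w = w" for w
  proof -
    obtain v where v: "w = M v - v" using w(1) unfolding W_def by blast
    then have "((\<lambda>v. M v - v) ^^ 2) v = 0" using w(2) by (simp add: numeral_2_eq_2)
    from mult[OF this] show ?thesis using v span_fixed by auto
  qed
  have "geom_decay (\<lambda>n. (Mc ^^ n) x)" if x: "x \<in> W \<times> W" for x
  proof -
    obtain p where p: "p \<noteq> 0" "pact p x = 0" by (rule annihilator_exists)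
    show ?thesis
    proof (rule geom_decay_of_annihilated[OF W MW _ p(1) x p(2)])
      fix \<mu> y assume y: "y \<in> W \<times> W" "y \<noteq> 0" "Mc y = cscale \<mu> y"
      have "\<mu> = 1 \<or> norm \<mu> < 1"
        using y by (intro eig[of "fst y" "snd y"]) (auto simp: Mc_def cscale_def prod_eq_iff)
      moreover have "\<mu> \<noteq> 1"
      proof
        assume "\<mu> = 1"
        then have "M (fst y) = fst y" "M (snd y) = snd y" using y(3) by (auto simp: cscale_simps Mc_def prod_eq_iff)
        then show False using W0 y by (auto simp: mem_Times_iff prod_eq_iff)
      qed
      ultimately show "norm \<mu> < 1" by blast
    qed
  qed
  then have dec: "geom_decay (\<lambda>n. (M ^^ n) w)" if "w \<in> W" for w
  proof -
    have "geom_decay (\<lambda>n. (Mc ^^ n) (w, 0))"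
      using that W by (intro \<open>\<And>x. x \<in> W \<times> W \<Longrightarrow> geom_decay (\<lambda>n. (Mc ^^ n) x)\<close>) (auto simp: subspace_0)
    moreover have "norm ((M ^^ n) w) \<le> norm ((Mc ^^ n) (w, 0))" for n
    proof -
      have "norm (fst ((Mc ^^ n) (w, 0))) \<le> norm ((Mc ^^ n) (w, 0))"
        using norm_fst_le[of "fst ((Mc ^^ n) (w, 0))" "snd ((Mc ^^ n) (w, 0))"] by (simp only: prod.collapse)
      then show ?thesis by (simp add: fst_Mc_pow)
    qed
    ultimately show ?thesis unfolding geom_decay_def by (meson order_trans)
  qed
  have linp: "linear (M ^^ n)" for n
  proof (induction n)
    case (Suc n)
    then show ?case unfolding funpow.simps by (rule linear_compose[OF _ lin])
  qed (simp add: linear_id[unfolded id_def] linear_ident)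
  have "convergent (\<lambda>n. (M ^^ n) v)" for v
  proof -
    have "summable (\<lambda>n. (M ^^ n) (M v - v))" by (intro geom_decay_summable dec) (auto simp: W_def)
    moreover have "(\<lambda>n. (M ^^ n) (M v - v)) = (\<lambda>n. (M ^^ Suc n) v - (M ^^ n) v)"
      by (simp add: linear_diff[OF linp] funpow_swap1)
    ultimately have "convergent (\<lambda>n. (M ^^ n) v - (M ^^ 0) v)"
      unfolding summable_iff_convergent by (simp only: sum_lessThan_telescope[of "\<lambda>n. (M ^^ n) v"])
    then show ?thesis by (simp only: convergent_diff_const_right_iff)
  qed
  then obtain Q where Q: "\<And>v. (\<lambda>n. (M ^^ n) v) \<longlonglongrightarrow> Q v" unfolding convergent_def by metis
  have QM: "Q (M v) = Q v" for v
    using LIMSEQ_unique[OF Q[of "M v"]] LIMSEQ_Suc[OF Q[of v]] by (simp add: funpow_swap1)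
  have MQ: "M (Q v) = Q v" for v
  proof -
    have "(\<lambda>n. M ((M ^^ n) v)) \<longlonglongrightarrow> M (Q v)"
      by (rule bounded_linear.tendsto[OF _ Q]) (use lin in \<open>simp add: linear_conv_bounded_linear\<close>)
    then show ?thesis using LIMSEQ_unique LIMSEQ_Suc[OF Q[of v]] by auto
  qed
  have Qadd: "Q (v + w) = Q v + Q w" for v w
    using LIMSEQ_unique[OF Q[of "v + w", unfolded linear_add[OF linp]] tendsto_add[OF Q Q]] .
  have Qscale: "Q (r *\<^sub>R v) = r *\<^sub>R Q v" for r v
    using LIMSEQ_unique[OF Q[of "r *\<^sub>R v", unfolded linear_cmul[OF linp]] tendsto_scaleR[OF tendsto_const Q]] .
  have "(M ^^ n) e = e" for n by (induction n) (auto simp: e)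
  then have Qe: "Q e = e" using Q[of e] by (simp add: LIMSEQ_const_iff)
  define l where "l v = (Q v \<bullet> e) / (e \<bullet> e)" for v
  have Ql: "Q v = l v *\<^sub>R e" for v
    using fixed[OF MQ[of v]] e(2) by (auto simp: span_singleton l_def)
  have ll: "linear l" by (intro linearI) (simp_all add: l_def Qadd Qscale add_divide_distrib inner_add_left)
  show ?thesis
  proof (rule that[OF ll])
    show "l e = 1" using e(2) by (simp add: l_def Qe)
    show "l (M v) = l v" for v by (simp add: l_def QM)
    fix \<epsilon> :: real assume \<epsilon>: "\<epsilon> > 0"
    \<comment> \<open>Convergence on the finitely many basis vectors gives a bound uniform in
      \<open>v\<close>; the division shares \<epsilon> among the coordinates.\<close>
    define \<delta> where "\<delta> = \<epsilon> / DIM('a)"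
    have \<delta>: "\<delta> > 0" using \<epsilon> by (simp add: \<delta>_def)
    have "\<forall>\<^sub>F n in sequentially. norm ((M ^^ n) b - Q b) < \<delta>" for b
      using tendstoD[OF Q \<delta>] by (simp add: dist_norm)
    then have "\<forall>\<^sub>F n in sequentially. \<forall>b\<in>Basis. norm ((M ^^ n) b - Q b) < \<delta>"
      by (intro eventually_ball_finite) auto
    then show "\<forall>\<^sub>F n in sequentially. \<forall>v. l v = 0 \<longrightarrow> norm ((M ^^ n) v) \<le> \<epsilon> * norm v"
    proof (eventually_elim, intro allI impI)
      fix n v assume n: "\<forall>b\<in>Basis. norm ((M ^^ n) b - Q b) < \<delta>" and "l v = 0"
      then have "(M ^^ n) v = (M ^^ n) v - Q v" by (simp add: Ql)
      also have "\<dots> = (\<Sum>b\<in>Basis. (v \<bullet> b) *\<^sub>R ((M ^^ n) b - Q b))"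
      proof -
        have "linear (\<lambda>v. (M ^^ n) v - Q v)"
          by (intro linear_compose_sub linp linearI) (auto simp: Qadd Qscale)
        then show ?thesis
          using linear_sum[of "\<lambda>v. (M ^^ n) v - Q v" "\<lambda>b. (v \<bullet> b) *\<^sub>R b" Basis]
          by (simp add: euclidean_representation linear_cmul[of "\<lambda>v. (M ^^ n) v - Q v"])
      qed
      also have "norm \<dots> \<le> (\<Sum>b\<in>(Basis::'a set). norm v * \<delta>)"
        using n by (intro sum_norm_le) (auto intro!: mult_mono Basis_le_norm simp: less_imp_le)
      also have "\<dots> = \<epsilon> * norm v" by (simp add: \<delta>_def)
      finally show "norm ((M ^^ n) v) \<le> \<epsilon> * norm v" .
    qed
  qed
qed

section \<open>Asymptotic phase near a stable cycle\<close>

locale stable_cycle = sphere_C1_flow F L B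
  for F :: "'a::euclidean_space \<Rightarrow> 'a" and L B :: real +
  fixes Y :: "real \<Rightarrow> 'a" and T :: real
  assumes stable: "exponentially_stable_cycle F Y T"
begin

section \<open>The variational equation along the cycle and its monodromy map\<close>

definition p where "p = Y 0"
definition e where "e = Fs F p"
definition pr where "pr x = x - (x \<bullet> p) *\<^sub>R p"

lemma Y_sol: "sphere_solution F Y" and T_pos: "T > 0" and Y_per: "Y (S + T) = Y S"
  and Y_nonconst: "\<exists>S. Y S \<noteq> Y 0"
  using stable by (auto simp: exponentially_stable_cycle_def periodic_solution_def)

lemma Y_norm: "norm (Y s) = 1" and p_norm: "norm p = 1"
  using solution_norm[OF Y_sol] by (auto simp: p_def)

lemma Y_per_nat: "Y (S + real n * T) = Y S"
proof (induction n)
  case (Suc n)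
  have "Y (S + real (Suc n) * T) = Y ((S + real n * T) + T)" by (simp add: algebra_simps)
  then show ?case using Suc Y_per by simp
qed simp

lemma Y_per_nat_0: "Y (real n * T) = p"
  using Y_per_nat[of 0 n] by (simp add: p_def)

text \<open>A zero velocity would make \<open>p\<close> an equilibrium; forward uniqueness then
  freezes \<open>Y\<close> at positive times and periodicity at all times, which the exclusion of
  equilibria forbids.\<close>

lemma e_nonzero: "e \<noteq> 0"
proof
  assume e0: "e = 0"
  have c: "sphere_solution F (\<lambda>_. p)"
    using e0 p_norm by (auto simp: sphere_solution_def global_solution_def e_def)
  have fwd: "Y s = p" if "s \<ge> 0" for s
    using solution_diff[OF Y_sol c that] by (simp add: p_def)
  have "Y s = p" for s
  proof -
    obtain n :: nat where "real n > - s / T" using reals_Archimedean2 by blast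
    then have "s + real n * T \<ge> 0" using T_pos by (simp add: field_simps)
    then show ?thesis using fwd Y_per_nat[of s n] by metis
  qed
  then show False using Y_nonconst by (auto simp: p_def)
qed

text \<open>\<open>sphere_deriv\<close> accepts arbitrary vectors, so the variational equation is
  solved in the ambient space; tangency is a conserved property rather than a constraint.\<close>

definition linear_flow :: "'a \<Rightarrow> real \<Rightarrow> 'a" where
  "linear_flow v0 = (SOME v. v 0 = v0 \<and> (\<forall>t. (v has_vector_derivative sphere_deriv F (Y t) (v t)) (at t)))"

lemma linear_flow: "linear_flow v0 0 = v0"
    "(linear_flow v0 has_vector_derivative sphere_deriv F (Y t) (linear_flow v0 t)) (at t)"
proof -
  obtain v where "v 0 = v0" "\<And>t. (v has_vector_derivative sphere_deriv F (Y t) (v t)) (at t)"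
  proof (rule picard_global[of "\<lambda>t. sphere_deriv F (Y t)"])
    show "continuous_on UNIV (\<lambda>t. sphere_deriv F (Y t) (u t))" if "continuous_on UNIV u" for u
      by (rule deriv_cont[OF solution_continuous[OF Y_sol] Y_norm that])
    show "norm (sphere_deriv F (Y t) x - sphere_deriv F (Y t) y) \<le> L * norm (x - y)" for t x y
      using deriv_bd[OF Y_norm, of t "x - y"] by (simp add: linear_diff[OF deriv_linear[OF Y_norm]])
    show "norm (sphere_deriv F (Y t) v0) \<le> L * norm v0" for t by (rule deriv_bd[OF Y_norm])
  qed blast
  then have "\<exists>v. v 0 = v0 \<and> (\<forall>t. (v has_vector_derivative sphere_deriv F (Y t) (v t)) (at t))" by blast
  from someI_ex[OF this] show "linear_flow v0 0 = v0"
    "(linear_flow v0 has_vector_derivative sphere_deriv F (Y t) (linear_flow v0 t)) (at t)"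
    unfolding linear_flow_def by blast+
qed

lemma linear_flow_unique:
  assumes v: "\<And>t. (v has_vector_derivative sphere_deriv F (Y t) (v t)) (at t)" and t: "t \<ge> 0"
  shows "v t = linear_flow (v 0) t"
proof -
  have "norm (v t - linear_flow (v 0) t) \<le> norm (v 0 - linear_flow (v 0) 0) * exp (L * (t - 0))"
  proof (rule ode_lipschitz_diff[OF t, where f = "\<lambda>t. sphere_deriv F (Y t)"])
    show "norm (sphere_deriv F (Y t) (v t) - sphere_deriv F (Y t) (linear_flow (v 0) t)) \<le> L * norm (v t - linear_flow (v 0) t)" for t
      using deriv_bd[OF Y_norm, of t "v t - linear_flow (v 0) t"] by (simp add: linear_diff[OF deriv_linear[OF Y_norm]])
  qed (use v linear_flow(2) L in \<open>auto intro: has_vector_derivative_at_within\<close>)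
  then show ?thesis by (simp add: linear_flow(1))
qed

lemma linear_linear_flow: assumes "t \<ge> 0" shows "linear (\<lambda>v. linear_flow v t)"
proof (rule linearI)
  show "linear_flow (v + w) t = linear_flow v t + linear_flow w t" for v w
  proof -
    have "((\<lambda>t. linear_flow v t + linear_flow w t) has_vector_derivative
        sphere_deriv F (Y t) (linear_flow v t + linear_flow w t)) (at t)" for t
      unfolding linear_add[OF deriv_linear[OF Y_norm]] by (intro has_vector_derivative_add linear_flow(2))
    from linear_flow_unique[OF this assms] show ?thesis by (simp add: linear_flow(1))
  qed
  show "linear_flow (r *\<^sub>R v) t = r *\<^sub>R linear_flow v t" for r v
  proof -
    have "((\<lambda>t. r *\<^sub>R linear_flow v t) has_vector_derivative sphere_deriv F (Y t) (r *\<^sub>R linear_flow v t)) (at t)" for t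
      unfolding linear_cmul[OF deriv_linear[OF Y_norm]]
      by (intro bounded_linear.has_vector_derivative[OF bounded_linear_scaleR_right] linear_flow(2))
    from linear_flow_unique[OF this assms] show ?thesis by (simp add: linear_flow(1))
  qed
qed

text \<open>The two terms of the product rule cancel by \<open>deriv_tangent\<close>.\<close>

lemma linear_flow_tangent: "linear_flow v t \<bullet> Y t = v \<bullet> p"
proof -
  have "((\<lambda>t. linear_flow v t \<bullet> Y t) has_real_derivative 0) (at t)" for t
    unfolding has_field_derivative_def
  proof (rule has_derivative_eq_rhs[OF has_derivative_inner[OF linear_flow(2)[of v t, unfolded has_vector_derivative_def]
        solution_deriv[OF Y_sol, of t, unfolded has_vector_derivative_def]]], rule ext)
    fix h
    have "linear_flow v t \<bullet> h *\<^sub>R Fs F (Y t) + h *\<^sub>R sphere_deriv F (Y t) (linear_flow v t) \<bullet> Y t =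
        h * (sphere_deriv F (Y t) (linear_flow v t) \<bullet> Y t + Fs F (Y t) \<bullet> linear_flow v t)"
      by (simp add: inner_commute algebra_simps)
    then show "linear_flow v t \<bullet> h *\<^sub>R Fs F (Y t) + h *\<^sub>R sphere_deriv F (Y t) (linear_flow v t) \<bullet> Y t = 0 * h"
      by (simp add: deriv_tangent[OF Y_norm])
  qed
  then have "linear_flow v t \<bullet> Y t = linear_flow v 0 \<bullet> Y 0" by (rule DERIV_isconst_all[rule_format])
  then show ?thesis by (simp add: linear_flow(1) p_def)
qed

lemma linear_flow_shift:
  assumes "t \<ge> 0" shows "linear_flow v (real n * T + t) = linear_flow (linear_flow v (real n * T)) t"
proof -
  have "((\<lambda>t. linear_flow v (real n * T + t)) has_vector_derivative
      sphere_deriv F (Y t) (linear_flow v (real n * T + t))) (at t)" for t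
    using vector_diff_chain_at[of "\<lambda>s. real n * T + s" 1 t "linear_flow v"
        "sphere_deriv F (Y (real n * T + t)) (linear_flow v (real n * T + t))"]
      linear_flow(2)[of v "real n * T + t"] Y_per_nat[of t n]
      has_vector_derivative_add[OF has_vector_derivative_const has_vector_derivative_id, of "real n * T" "at t"]
    by (simp add: o_def add.commute)
  from linear_flow_unique[OF this assms] show ?thesis by simp
qed

lemma linear_pr: "linear pr"
  unfolding pr_def by (intro linearI) (auto simp: algebra_simps)

lemma pr_tangent: "pr x \<bullet> p = 0"
  using p_norm by (simp add: pr_def inner_diff_left norm_eq_1)

lemma pr_id: "x \<bullet> p = 0 \<Longrightarrow> pr x = x" by (simp add: pr_def)

lemma norm_pr: "norm (pr x) \<le> norm x"
proof -
  have eq: "(norm x)\<^sup>2 = (norm (pr x))\<^sup>2 + (x \<bullet> p)\<^sup>2"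
    using p_norm unfolding power2_norm_eq_inner
    by (simp add: pr_def inner_diff_left inner_diff_right inner_commute norm_eq_1 power2_eq_square)
  have "(norm (pr x))\<^sup>2 \<le> (norm x)\<^sup>2" unfolding eq by simp
  then show ?thesis by (rule power2_le_imp_le) simp
qed

text \<open>The projection turns the monodromy map of the tangent space into a linear map of the
  whole space, to which \<open>power_contraction\<close> applies; the added normal direction is sent
  to 0.\<close>

definition M where "M x = linear_flow (pr x) T"

lemma linear_M: "linear M"
  using linear_compose[OF linear_pr linear_linear_flow[of T]] T_pos by (simp add: M_def [abs_def] o_def)

lemma M_tangent: "M x \<bullet> p = 0"
  using linear_flow_tangent[of "pr x" T] Y_per_nat_0[of 1] by (simp add: M_def pr_tangent)

lemma M_pow: "v \<bullet> p = 0 \<Longrightarrow> (M ^^ n) v = linear_flow v (real n * T)"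
proof (induction n)
  case (Suc n)
  have t: "linear_flow v (real n * T) \<bullet> p = 0"
    using linear_flow_tangent[of v "real n * T"] Suc.prems by (simp add: Y_per_nat_0)
  have "(M ^^ Suc n) v = M (linear_flow v (real n * T))" using Suc by simp
  also have "\<dots> = linear_flow (linear_flow v (real n * T)) T" unfolding M_def pr_id[OF t] ..
  also have "\<dots> = linear_flow v (real n * T + T)" using T_pos by (simp add: linear_flow_shift)
  finally show ?case by (simp add: algebra_simps)
qed (simp add: linear_flow(1))

lemma monodromy_eq: assumes "v \<bullet> p = 0" shows "monodromy F Y T v = M v"
  unfolding monodromy_def
proof (rule the_equality)
  have "linearized_solution F Y (linear_flow v)"
    using assms linear_flow(2) by (simp add: linearized_solution_def linear_flow_tangent)
  then show "\<exists>w. linearized_solution F Y w \<and> w 0 = v \<and> w T = M v"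
    using assms by (auto simp: M_def pr_id linear_flow(1))
next
  fix \<eta> assume "\<exists>w. linearized_solution F Y w \<and> w 0 = v \<and> w T = \<eta>"
  then obtain w where w: "linearized_solution F Y w" "w 0 = v" "w T = \<eta>" by blast
  then have "w T = linear_flow (w 0) T"
    using T_pos by (intro linear_flow_unique) (auto simp: linearized_solution_def)
  then show "\<eta> = M v" using w assms by (simp add: M_def pr_id)
qed

lemma e_tangent: "e \<bullet> p = 0" unfolding e_def by (rule Fs_inner_self[OF p_norm])

text \<open>The velocity along the cycle solves the variational equation by
  \<open>deriv_chain\<close> and is periodic: this is the eigenvector of time translation.\<close>

lemma M_e: "M e = e"
proof -
  have "Fs F (Y T) = linear_flow (Fs F (Y 0)) T"
    using T_pos by (intro linear_flow_unique deriv_chain Y_sol) simp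
  moreover have "Y T = p" using Y_per_nat_0[of 1] by simp
  ultimately show ?thesis using pr_id[OF e_tangent] by (simp add: M_def e_def p_def)
qed

text \<open>Since \<open>M\<close> has tangent values, \<open>M - 1\<close> only flips the sign of
  the normal component. A generalized eigenvector is thus tangent and falls into the space whose
  dimension is 1 and which already contains \<open>e\<close>.\<close>

lemma generalized_eigenspace:
  assumes "((\<lambda>v. M v - v) ^^ k) \<xi> = 0" shows "\<xi> \<in> span {e}"
proof (rule ccontr)
  assume not: "\<xi> \<notin> span {e}"
  let ?D = "\<lambda>v. M v - v" and ?S = "{\<xi>. \<xi> \<bullet> Y 0 = 0 \<and> (\<exists>k. ((\<lambda>v. monodromy F Y T v - v) ^^ k) \<xi> = 0)}"
  have "((?D ^^ k) v) \<bullet> p = (- 1) ^ k * (v \<bullet> p)" for v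
    by (induction k) (auto simp: inner_diff_left M_tangent)
  from this[of \<xi>] have xi: "\<xi> \<bullet> p = 0" using assms by simp
  have eq: "((\<lambda>v. monodromy F Y T v - v) ^^ k) v = (?D ^^ k) v \<and> (?D ^^ k) v \<bullet> p = 0" if "v \<bullet> p = 0" for k v
    using that by (induction k) (auto simp: monodromy_eq inner_diff_left M_tangent)
  have "\<xi> \<in> ?S" using xi eq[OF xi] assms by (auto simp flip: p_def)
  moreover have "((\<lambda>v. monodromy F Y T v - v) ^^ 1) e = 0" by (simp add: monodromy_eq e_tangent M_e)
  then have "e \<in> ?S" using e_tangent unfolding p_def by blast
  moreover have "independent {\<xi>, e}" using not e_nonzero by (intro independent_insertI) (auto simp: independent_empty)
  ultimately have "card {\<xi>, e} \<le> dim ?S" by (intro independent_card_le_dim) auto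
  moreover have "\<xi> \<noteq> e" using not span_base by blast
  ultimately show False
    using stable by (simp add: exponentially_stable_cycle_def zero_exponent_multiplicity_def)
qed

text \<open>The stability hypothesis concerns tangent eigenvectors. A nonzero eigenvalue of
  \<open>M\<close> forces tangency, as \<open>M\<close> has tangent values, and its logarithm
  divided by \<open>T\<close> is then a characteristic exponent; the eigenvalue 0 introduced by
  \<open>pr\<close> satisfies the bound anyway.\<close>

lemma multiplier:
  assumes nz: "u \<noteq> 0 \<or> w \<noteq> 0"
    and Mu: "M u = Re \<mu> *\<^sub>R u - Im \<mu> *\<^sub>R w" and Mw: "M w = Im \<mu> *\<^sub>R u + Re \<mu> *\<^sub>R w"
  shows "\<mu> = 1 \<or> norm \<mu> < 1"
proof (cases "\<mu> = 0")
  case False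
  have a: "Re \<mu> * (u \<bullet> p) - Im \<mu> * (w \<bullet> p) = 0" "Im \<mu> * (u \<bullet> p) + Re \<mu> * (w \<bullet> p) = 0"
    using arg_cong[OF Mu, of "\<lambda>x. x \<bullet> p"] arg_cong[OF Mw, of "\<lambda>x. x \<bullet> p"]
    by (simp_all add: M_tangent inner_diff_left inner_add_left)
  have "\<mu> * Complex (u \<bullet> p) (w \<bullet> p) = 0" using a by (simp add: complex_eq_iff)
  then have "Complex (u \<bullet> p) (w \<bullet> p) = 0" using False by simp
  then have tan: "u \<bullet> p = 0" "w \<bullet> p = 0" by (simp_all add: complex_eq_iff)
  define l where "l = Ln \<mu> / of_real T"
  have el: "exp (l * of_real T) = \<mu>" using False T_pos by (simp add: l_def exp_Ln)
  have "char_exponent F Y T l"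
    unfolding char_exponent_def Let_def el
    by (rule exI[of _ u], rule exI[of _ w]) (use tan nz Mu Mw in \<open>simp add: monodromy_eq flip: p_def\<close>)
  then have "\<mu> = 1 \<or> Re l < 0" using stable el unfolding exponentially_stable_cycle_def by metis
  moreover have "norm \<mu> < 1" if "Re l < 0"
  proof -
    have "norm \<mu> = exp (Re l * T)" unfolding el[symmetric] norm_exp_eq_Re by simp
    then show ?thesis using that T_pos by (simp add: mult_neg_pos)
  qed
  ultimately show ?thesis by blast
qed simp

lemma linearization:
  assumes \<tau>: "\<tau> \<ge> 0" and \<epsilon>: "\<epsilon> > 0"
  obtains \<delta> where "\<delta> > 0" "\<And>y s. sphere_solution F y \<Longrightarrow> norm (y 0 - p) < \<delta> \<Longrightarrow> 0 \<le> s \<Longrightarrow> s \<le> \<tau> \<Longrightarrow>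
      norm (y s - Y s - linear_flow (pr (y 0 - p)) s) \<le> \<epsilon> * norm (y 0 - p)"
proof -
  define E where "E = exp (L * \<tau>)"
  have E: "E \<ge> 1" using L \<tau> by (simp add: E_def)
  \<comment> \<open>Two errors of \<epsilon>/2 each (relative to the initial distance): the
    remainder of the field, accumulated over a time at most \<tau> and amplified by \<open>E\<close>
    twice, and the radial part of \<open>y 0 - p\<close>, half the squared distance, amplified once
    and controlled by the bound \<epsilon>/E in \<open>\<delta>\<close>.\<close>
  define \<epsilon>' where "\<epsilon>' = \<epsilon> / (2 * E * E * (\<tau> + 1))"
  have \<epsilon>': "\<epsilon>' > 0" using E \<epsilon> \<tau> by (simp add: \<epsilon>'_def)
  obtain \<delta>0 where \<delta>0: "\<delta>0 > 0" "\<And>y w. norm y = 1 \<Longrightarrow> norm w = 1 \<Longrightarrow> norm (w - y) < \<delta>0 \<Longrightarrow>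
      norm (Fs F w - Fs F y - sphere_deriv F y (w - y)) \<le> \<epsilon>' * norm (w - y)"
    using deriv_unif[OF \<epsilon>'] by blast
  define \<delta> where "\<delta> = min (\<epsilon> / E) (\<delta>0 / E)"
  have \<delta>: "\<delta> > 0" using \<epsilon> E \<delta>0 by (simp add: \<delta>_def)
  have "norm (y s - Y s - linear_flow (pr (y 0 - p)) s) \<le> \<epsilon> * norm (y 0 - p)"
    if y: "sphere_solution F y" and d\<delta>: "norm (y 0 - p) < \<delta>" and s: "0 \<le> s" "s \<le> \<tau>" for y s
  proof -
    define d where "d = norm (y 0 - p)"
    have d0: "d \<ge> 0" by (simp add: d_def)
    define v where "v = linear_flow (pr (y 0 - p))"
    have D: "norm (y t - Y t) \<le> E * d" if "t \<in> {0..s}" for t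
    proof -
      have "norm (y t - Y t) \<le> d * exp (L * (t - 0))"
        using solution_diff[OF y Y_sol, of 0 t] that by (simp add: d_def p_def)
      also have "\<dots> \<le> d * E" using that s L d0 by (intro mult_left_mono) (auto simp: E_def)
      finally show ?thesis by (simp add: mult.commute)
    qed
    have small: "E * d < \<delta>0" using d\<delta> E by (simp add: \<delta>_def d_def field_simps)
    have "norm (y s - Y s - v s) \<le> (norm (y 0 - Y 0 - v 0) + (\<epsilon>' * (E * d)) * (s - 0)) * exp (L * (s - 0))"
    proof (rule gronwall[where z = "\<lambda>t. y t - Y t - v t" and z' = "\<lambda>t. Fs F (y t) - Fs F (Y t) - sphere_deriv F (Y t) (v t)"])
      fix t assume t: "t \<in> {0..s}"
      show "((\<lambda>t. y t - Y t - v t) has_vector_derivative Fs F (y t) - Fs F (Y t) - sphere_deriv F (Y t) (v t)) (at t within {0..s})"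
        unfolding v_def
        by (intro has_vector_derivative_diff has_vector_derivative_at_within[OF solution_deriv] y Y_sol
            has_vector_derivative_at_within[OF linear_flow(2)])
      have "Fs F (y t) - Fs F (Y t) - sphere_deriv F (Y t) (v t) =
          sphere_deriv F (Y t) (y t - Y t - v t) + (Fs F (y t) - Fs F (Y t) - sphere_deriv F (Y t) (y t - Y t))"
        by (simp add: linear_diff[OF deriv_linear[OF Y_norm]])
      also have "norm \<dots> \<le> L * norm (y t - Y t - v t) + \<epsilon>' * (E * d)"
      proof (intro norm_triangle_le add_mono deriv_bd Y_norm)
        have "norm (Fs F (y t) - Fs F (Y t) - sphere_deriv F (Y t) (y t - Y t)) \<le> \<epsilon>' * norm (y t - Y t)"
          using D[OF t] small by (intro \<delta>0(2) Y_norm solution_norm y) simp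
        also have "\<dots> \<le> \<epsilon>' * (E * d)" using D[OF t] \<epsilon>' by (intro mult_left_mono) auto
        finally show "norm (Fs F (y t) - Fs F (Y t) - sphere_deriv F (Y t) (y t - Y t)) \<le> \<epsilon>' * (E * d)" .
      qed
      finally show "norm (Fs F (y t) - Fs F (Y t) - sphere_deriv F (Y t) (v t)) \<le> L * norm (y t - Y t - v t) + \<epsilon>' * (E * d)" .
    qed (use s L \<epsilon>' E d0 in auto)
    also have "y 0 - Y 0 - v 0 = (p \<bullet> (y 0 - p)) *\<^sub>R p"
      by (simp add: v_def linear_flow(1) pr_def p_def inner_commute)
    also have "norm \<dots> = d * d / 2"
      using sphere_inner_diff[OF p_norm solution_norm[OF y]] by (simp add: p_norm d_def power2_eq_square)
    also have "(d * d / 2 + \<epsilon>' * (E * d) * (s - 0)) * exp (L * (s - 0)) \<le> (d * (\<epsilon> / E) / 2 + \<epsilon>' * (E * d) * (\<tau> + 1)) * E"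
    proof (intro mult_mono add_mono divide_right_mono)
      show "d \<le> \<epsilon> / E" using d\<delta> by (simp add: d_def \<delta>_def)
    qed (use s L \<epsilon>' E d0 \<epsilon> \<tau> in \<open>auto simp: E_def\<close>)
    also have "\<dots> = (\<epsilon> / E * E) * d / 2 + (\<epsilon>' * (2 * E * E * (\<tau> + 1))) * d / 2" by (simp add: algebra_simps)
    also have "\<dots> = \<epsilon> * d" using E \<tau> by (simp add: \<epsilon>'_def)
    finally show ?thesis by (simp add: d_def v_def)
  qed
  with \<delta> show ?thesis by (rule that)
qed

text \<open>One return to the hypersurface \<open>l (y - p) = 0\<close>, where \<open>l\<close> is the left eigenvector of the
  monodromy map. The flow time is close to a multiple \<open>N * T\<close> of the period so large that the
  linearized map is a strong contraction on the kernel of \<open>l\<close>.\<close>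

lemma return_step:
  obtains l :: "'a \<Rightarrow> real" and N :: nat and C \<delta> :: real
  where "real N * T \<ge> 2" "C \<ge> 1" "0 < \<delta>" "\<delta> \<le> 1"
    "\<And>y. sphere_solution F y \<Longrightarrow> norm (y 0 - p) < \<delta> \<Longrightarrow>
      \<exists>\<sigma>. \<bar>\<sigma>\<bar> \<le> 1 \<and> \<bar>\<sigma>\<bar> \<le> C * norm (y 0 - p) \<and> norm (y (real N * T + \<sigma>) - p) \<le> C * norm (y 0 - p) \<and>
        l (y (real N * T + \<sigma>) - p) = 0 \<and>
        (l (y 0 - p) = 0 \<longrightarrow> \<bar>\<sigma>\<bar> \<le> norm (y 0 - p) \<and> norm (y (real N * T + \<sigma>) - p) \<le> norm (y 0 - p) / 2)"
proof -
  have "\<exists>l::'a \<Rightarrow> real. linear l \<and> l e = 1 \<and> (\<forall>v. l (M v) = l v) \<and>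
      (\<forall>\<epsilon>>0. \<forall>\<^sub>F n in sequentially. \<forall>v. l v = 0 \<longrightarrow> norm ((M ^^ n) v) \<le> \<epsilon> * norm v)"
    by (rule power_contraction[OF linear_M M_e e_nonzero generalized_eigenspace multiplier]) blast+
  then obtain l :: "'a \<Rightarrow> real" where l: "linear l" "l e = 1" "\<And>v. l (M v) = l v"
    "\<And>\<epsilon>. \<epsilon> > 0 \<Longrightarrow> \<forall>\<^sub>F n in sequentially. \<forall>v. l v = 0 \<longrightarrow> norm ((M ^^ n) v) \<le> \<epsilon> * norm v"
    by blast
  have l_pr: "l (pr x) = l x" for x
  proof -
    have "M (pr x) = M x" by (simp add: M_def pr_id[OF pr_tangent])
    then show ?thesis using l(3)[of x] l(3)[of "pr x"] by simp
  qed
  have l_pow: "l ((M ^^ n) v) = l v" for n v by (induction n) (simp_all add: l(3))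
  obtain \<Lambda> where \<Lambda>: "\<Lambda> > 0" "\<And>x. \<bar>l x\<bar> \<le> \<Lambda> * norm x"
    using linear_bounded_pos[OF l(1)] by (metis real_norm_def)
  have "\<forall>\<^sub>F n in sequentially. (\<forall>v. l v = 0 \<longrightarrow> norm ((M ^^ n) v) \<le> 1/4 * norm v) \<and> real n \<ge> 2 / T"
  proof (intro eventually_conj l(4))
    obtain m :: nat where "2 / T \<le> real m" using real_arch_simple by blast
    then show "\<forall>\<^sub>F n in sequentially. 2 / T \<le> real n"
      by (intro eventually_sequentiallyI[of m]) auto
  qed simp
  then obtain N where N: "\<And>v. l v = 0 \<Longrightarrow> norm ((M ^^ N) v) \<le> 1/4 * norm v" "real N \<ge> 2 / T"
    using eventually_happens'[OF sequentially_bot] by blast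
  \<comment> \<open>\<open>N\<close> makes the linearized return contract by 1/4; R \<ge> 2 ensures
    that a return time corrected by at most 1 still advances by at least 1.\<close>
  define R where "R = real N * T"
  have R: "R \<ge> 2" using N(2) T_pos by (simp add: R_def field_simps)
  define E where "E = exp (L * (R + 1))"
  have E: "E \<ge> 1" using L R by (simp add: E_def)
  \<comment> \<open>The budget for halving on the hypersurface is 1/4 from the linear part, 1/8 from
    the linearization error and 1/8 from the time correction, which is at most
    \<open>2 * \<Lambda> * \<epsilon> * d\<close> and moves the point at speed at most
    \<open>B\<close>.\<close>
  define \<epsilon> where "\<epsilon> = min (1/8) (1 / (2 * \<Lambda> * (1 + 8 * B)))"
  have \<epsilon>: "\<epsilon> > 0" "\<epsilon> \<le> 1/8" using \<Lambda> B by (auto simp: \<epsilon>_def)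
  have \<epsilon>2: "2 * \<Lambda> * \<epsilon> \<le> 1 / (1 + 8 * B)"
  proof -
    have "2 * \<Lambda> * \<epsilon> \<le> 2 * \<Lambda> * (1 / (2 * \<Lambda> * (1 + 8 * B)))"
      using \<Lambda>(1) by (intro mult_left_mono) (auto simp: \<epsilon>_def)
    then show ?thesis using \<Lambda>(1) by simp
  qed
  have \<epsilon>3: "2 * \<Lambda> * \<epsilon> \<le> 1" by (rule order_trans[OF \<epsilon>2]) (use B in simp)
  have \<epsilon>4: "B * (2 * \<Lambda> * \<epsilon>) \<le> 1/8"
  proof -
    have "B * (2 * \<Lambda> * \<epsilon>) \<le> B * (1 / (1 + 8 * B))" using \<epsilon>2 B by (intro mult_left_mono) auto
    also have "\<dots> \<le> 1/8" using B by (simp add: field_simps)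
    finally show ?thesis .
  qed
  have "R \<ge> 0" using R by simp
  then obtain \<delta>1 where \<delta>1: "\<delta>1 > 0" "\<And>y s. sphere_solution F y \<Longrightarrow> norm (y 0 - p) < \<delta>1 \<Longrightarrow> 0 \<le> s \<Longrightarrow> s \<le> R \<Longrightarrow>
      norm (y s - Y s - linear_flow (pr (y 0 - p)) s) \<le> \<epsilon> * norm (y 0 - p)"
    using linearization[OF _ \<epsilon>(1)] by metis
  \<comment> \<open>On this window the slope of \<open>g\<close> below stays within 1/2 of
    \<open>l e = 1\<close>; the window and the initial distance each use up 1/4.\<close>
  define \<sigma>0 where "\<sigma>0 = min (1/2) (1 / (4 * \<Lambda> * L * B))"
  have \<sigma>0: "\<sigma>0 > 0" "\<sigma>0 \<le> 1/2" "\<Lambda> * L * B * \<sigma>0 \<le> 1/4"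
  proof -
    show "\<sigma>0 > 0" "\<sigma>0 \<le> 1/2" using \<Lambda>(1) L B by (auto simp: \<sigma>0_def)
    have "\<Lambda> * L * B * \<sigma>0 \<le> \<Lambda> * L * B * (1 / (4 * \<Lambda> * L * B))"
      using \<Lambda>(1) L B by (intro mult_left_mono) (auto simp: \<sigma>0_def)
    also have "\<dots> = 1/4" using \<Lambda>(1) L B by simp
    finally show "\<Lambda> * L * B * \<sigma>0 \<le> 1/4" .
  qed
  define \<delta> where "\<delta> = min (min 1 \<delta>1) (min (1 / (4 * \<Lambda> * L * E)) (\<sigma>0 / (4 * \<Lambda>)))"
  have \<delta>: "\<delta> > 0" "\<delta> \<le> 1" using \<delta>1 \<Lambda>(1) L E \<sigma>0 by (auto simp: \<delta>_def)
  define C where "C = 4 * \<Lambda> + E + 4 * B * \<Lambda> + 1"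
  have C: "C \<ge> 1" using \<Lambda>(1) E B by (simp add: C_def add_nonneg_nonneg)
  show ?thesis
  proof (rule that[of N C \<delta> l])
    show "real N * T \<ge> 2" using R by (simp add: R_def)
    fix y assume y: "sphere_solution F y" and yd: "norm (y 0 - p) < \<delta>"
    define d where "d = norm (y 0 - p)"
    have d: "d \<ge> 0" "d < \<delta>" using yd by (auto simp: d_def)
    have dE: "\<Lambda> * L * (E * d) \<le> 1/4"
    proof -
      have "\<Lambda> * L * (E * d) \<le> \<Lambda> * L * (E * (1 / (4 * \<Lambda> * L * E)))"
        using d \<Lambda>(1) L E by (intro mult_left_mono) (auto simp: \<delta>_def)
      also have "\<dots> = 1/4" using \<Lambda>(1) L E by simp
      finally show ?thesis .
    qed
    have d\<sigma>: "4 * \<Lambda> * d \<le> \<sigma>0"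
    proof -
      have "4 * \<Lambda> * d \<le> 4 * \<Lambda> * (\<sigma>0 / (4 * \<Lambda>))" using d \<Lambda>(1) by (intro mult_left_mono) (auto simp: \<delta>_def)
      then show ?thesis using \<Lambda>(1) by simp
    qed
    have YR: "Y R = p" using Y_per_nat_0 by (simp add: R_def)
    define v where "v = pr (y 0 - p)"
    have v: "norm v \<le> d" "v \<bullet> p = 0" "l v = l (y 0 - p)"
      using norm_pr pr_tangent l_pr by (auto simp: v_def d_def)
    define err where "err = y R - p - (M ^^ N) v"
    have "norm (y R - Y R - linear_flow v R) \<le> \<epsilon> * d"
      unfolding v_def d_def using d R by (intro \<delta>1(2) y) (auto simp: d_def \<delta>_def)
    then have err: "norm err \<le> \<epsilon> * d"
      unfolding err_def M_pow[OF v(2)] YR R_def[symmetric] by simp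
    have yR: "y R - p = (M ^^ N) v + err" by (simp add: err_def)
    \<comment> \<open>Zeros of \<open>g\<close> are crossings of the hypersurface. With slope at
      least 1/2, one of them lies within 2|g 0| of 0. As \<open>l\<close> is invariant under
      \<open>M\<close>, \<open>g 0\<close> is pure linearization error when the start already lies
      on the hypersurface.\<close>
    define g where "g \<sigma> = l (y (R + \<sigma>) - p)" for \<sigma>
    have g0: "g 0 = l (y 0 - p) + l err"
      by (simp add: g_def yR linear_add[OF l(1)] l_pow v)
    have lerr: "\<bar>l err\<bar> \<le> \<Lambda> * \<epsilon> * d"
      using order_trans[OF \<Lambda>(2) mult_left_mono[OF err]] \<Lambda>(1) by (simp add: mult.assoc)
    have near: "norm (y (R + \<sigma>) - p) \<le> norm (y R - p) + B * \<bar>\<sigma>\<bar>" for \<sigma>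
      using norm_triangle_ineq[of "y (R + \<sigma>) - y R" "y R - p"] solution_lipschitz[OF y, of "R + \<sigma>" R] by simp
    have yRE: "norm (y R - p) \<le> E * d"
    proof -
      have "norm (y R - Y R) \<le> d * exp (L * (R - 0))"
        using solution_diff[OF y Y_sol, of 0 R] R by (simp add: d_def p_def)
      also have "\<dots> \<le> d * E" using L d by (intro mult_left_mono) (auto simp: E_def)
      finally show ?thesis by (simp add: YR mult.commute)
    qed
    have dg: "(g has_real_derivative l (Fs F (y (R + \<sigma>)))) (at \<sigma>)" for \<sigma>
    proof -
      have "((\<lambda>\<sigma>. y (R + \<sigma>) - p) has_vector_derivative Fs F (y (R + \<sigma>))) (at \<sigma>)"
        using has_vector_derivative_diff[OF solution_deriv[OF solution_shift[OF y]] has_vector_derivative_const] by fastforce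
      from bounded_linear.has_vector_derivative[OF _ this, of l] show ?thesis
        using l(1) by (simp add: linear_conv_bounded_linear g_def [abs_def] has_real_derivative_iff_has_vector_derivative)
    qed
    have slope: "l (Fs F (y (R + \<sigma>))) \<ge> 1/2" if "\<bar>\<sigma>\<bar> \<le> \<sigma>0" for \<sigma>
    proof -
      have "l (Fs F (y (R + \<sigma>))) - 1 = l (Fs F (y (R + \<sigma>)) - e)" by (simp add: linear_diff[OF l(1)] l(2))
      also have "\<bar>\<dots>\<bar> \<le> \<Lambda> * (L * norm (y (R + \<sigma>) - p))"
        unfolding e_def using \<Lambda>(1)
        by (intro order_trans[OF \<Lambda>(2)] mult_left_mono Fs_lip solution_norm[OF y] p_norm) auto
      also have "\<dots> \<le> \<Lambda> * (L * (E * d + B * \<sigma>0))"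
      proof (intro mult_left_mono)
        have "B * \<bar>\<sigma>\<bar> \<le> B * \<sigma>0" using that B by simp
        then show "norm (y (R + \<sigma>) - p) \<le> E * d + B * \<sigma>0" using near[of \<sigma>] yRE by linarith
      qed (use \<Lambda>(1) L in auto)
      also have "\<dots> \<le> 1/2" using dE \<sigma>0(3) by (simp add: algebra_simps)
      finally show ?thesis by linarith
    qed
    have incr: "g a - a / 2 \<le> g b - b / 2" if "a \<le> b" "- \<sigma>0 \<le> a" "b \<le> \<sigma>0" for a b
    proof (rule DERIV_nonneg_imp_nondecreasing[OF that(1)])
      fix x assume "a \<le> x" "x \<le> b"
      then have "l (Fs F (y (R + x))) - 1/2 \<ge> 0" using slope[of x] that by auto
      moreover have "((\<lambda>x. g x - x / 2) has_real_derivative l (Fs F (y (R + x))) - 1/2) (at x)"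
        by (auto intro!: derivative_eq_intros dg)
      ultimately show "\<exists>y. ((\<lambda>x. g x - x / 2) has_real_derivative y) (at x) \<and> 0 \<le> y" by blast
    qed
    define a where "a = 2 * \<bar>g 0\<bar>"
    have g0b: "\<bar>g 0\<bar> \<le> 2 * \<Lambda> * d"
    proof -
      have "\<bar>g 0\<bar> \<le> \<Lambda> * d + \<Lambda> * \<epsilon> * d"
        using g0 lerr \<Lambda>(2)[of "y 0 - p"] by (simp add: d_def)
      also have "\<Lambda> * \<epsilon> * d \<le> \<Lambda> * d" using \<Lambda>(1) \<epsilon> d by (simp add: mult_right_mono mult_left_le)
      finally show ?thesis by simp
    qed
    have a: "0 \<le> a" "a \<le> \<sigma>0" using g0b d\<sigma> by (auto simp: a_def)
    have "continuous_on {-a..a} g"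
      by (intro continuous_at_imp_continuous_on ballI DERIV_isCont[OF dg])
    moreover have "g (- a) \<le> 0" "0 \<le> g a" using incr[of "- a" 0] incr[of 0 a] a by (auto simp: a_def)
    ultimately obtain \<sigma> where \<sigma>: "- a \<le> \<sigma>" "\<sigma> \<le> a" "g \<sigma> = 0"
      using IVT'[of g "- a" 0 a] a by auto
    have sa: "\<bar>\<sigma>\<bar> \<le> 2 * \<bar>g 0\<bar>" using \<sigma> by (auto simp: a_def)
    have s4: "\<bar>\<sigma>\<bar> \<le> 4 * \<Lambda> * d" using sa g0b by simp
    show "\<exists>\<sigma>. \<bar>\<sigma>\<bar> \<le> 1 \<and> \<bar>\<sigma>\<bar> \<le> C * norm (y 0 - p) \<and> norm (y (real N * T + \<sigma>) - p) \<le> C * norm (y 0 - p) \<and>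
        l (y (real N * T + \<sigma>) - p) = 0 \<and>
        (l (y 0 - p) = 0 \<longrightarrow> \<bar>\<sigma>\<bar> \<le> norm (y 0 - p) \<and> norm (y (real N * T + \<sigma>) - p) \<le> norm (y 0 - p) / 2)"
      unfolding d_def[symmetric] R_def[symmetric]
    proof (intro exI[of _ \<sigma>] conjI impI)
      show "\<bar>\<sigma>\<bar> \<le> 1" using \<sigma> a \<sigma>0 by auto
      have "4 * \<Lambda> * d \<le> C * d" using d \<Lambda>(1) E B by (intro mult_right_mono) (auto simp: C_def)
      then show "\<bar>\<sigma>\<bar> \<le> C * d" using s4 by simp
      have "B * \<bar>\<sigma>\<bar> \<le> B * (4 * \<Lambda> * d)" using s4 B by (intro mult_left_mono) auto
      then have "norm (y (R + \<sigma>) - p) \<le> E * d + B * (4 * \<Lambda> * d)"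
        using near[of \<sigma>] yRE by linarith
      also have "\<dots> \<le> C * d" using d \<Lambda>(1) by (simp add: C_def algebra_simps)
      finally show "norm (y (R + \<sigma>) - p) \<le> C * d" .
      show "l (y (R + \<sigma>) - p) = 0" using \<sigma>(3) by (simp add: g_def)
      assume l0: "l (y 0 - p) = 0"
      have s2: "\<bar>\<sigma>\<bar> \<le> 2 * \<Lambda> * \<epsilon> * d" using sa g0 lerr l0 by simp
      also have "\<dots> \<le> d" using mult_right_mono[OF \<epsilon>3 d(1)] by simp
      finally show "\<bar>\<sigma>\<bar> \<le> d" .
      have "norm ((M ^^ N) v) \<le> d / 4" using N(1)[of v] v l0 by simp
      then have "norm (y R - p) \<le> d / 4 + \<epsilon> * d" unfolding yR using err by (intro norm_triangle_le) simp
      moreover have "\<epsilon> * d \<le> d / 8" using mult_right_mono[OF \<epsilon>(2) d(1)] by simp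
      moreover have "B * \<bar>\<sigma>\<bar> \<le> d / 8"
      proof -
        have "B * \<bar>\<sigma>\<bar> \<le> B * (2 * \<Lambda> * \<epsilon> * d)" using s2 B by (intro mult_left_mono) auto
        also have "\<dots> \<le> 1/8 * d" using mult_right_mono[OF \<epsilon>4 d(1)] by (simp add: mult_ac)
        finally show ?thesis by simp
      qed
      ultimately show "norm (y (R + \<sigma>) - p) \<le> d / 2" using near[of \<sigma>] by simp
    qed
  qed (use C \<delta> in auto)
qed

section \<open>From repeated returns to an asymptotic phase\<close>

lemma Y_lipschitz: "norm (Y a - Y b) \<le> B * \<bar>a - b\<bar>"
  by (rule solution_lipschitz[OF Y_sol])

text \<open>Successive returns to the hypersurface halve the bound on the distance to
  \<open>p\<close>, so the corrections of the return times are dominated by a geometric series, and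
  their sum determines the phase. A general start reaches the hypersurface after one return at the
  price of a factor. Proportionality to the initial distance is what
  \<open>uniform_stability\<close> relies on.\<close>

lemma asymptotic_phase:
  obtains \<delta> C \<kappa> where "\<delta> > 0" "C > 0" "\<kappa> > 0"
    "\<And>y. sphere_solution F y \<Longrightarrow> norm (y 0 - p) < \<delta> \<Longrightarrow>
      \<exists>\<theta>. \<bar>\<theta>\<bar> \<le> C * norm (y 0 - p) \<and> (\<forall>s\<ge>0. norm (y s - Y (s + \<theta>)) \<le> C * exp (- \<kappa> * s) * norm (y 0 - p))"
proof -
  obtain l :: "'a \<Rightarrow> real" and N :: nat and C \<delta> :: real
    where N: "real N * T \<ge> 2" and C: "C \<ge> 1" and \<delta>: "0 < \<delta>" "\<delta> \<le> 1" and
    step: "\<And>y. sphere_solution F y \<Longrightarrow> norm (y 0 - p) < \<delta> \<Longrightarrow>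
      \<exists>\<sigma>. \<bar>\<sigma>\<bar> \<le> 1 \<and> \<bar>\<sigma>\<bar> \<le> C * norm (y 0 - p) \<and> norm (y (real N * T + \<sigma>) - p) \<le> C * norm (y 0 - p) \<and>
        l (y (real N * T + \<sigma>) - p) = 0 \<and>
        (l (y 0 - p) = 0 \<longrightarrow> \<bar>\<sigma>\<bar> \<le> norm (y 0 - p) \<and> norm (y (real N * T + \<sigma>) - p) \<le> norm (y 0 - p) / 2)"
    by (rule return_step) blast
  define R where "R = real N * T"
  have R: "R \<ge> 2" using N by (simp add: R_def)
  \<comment> \<open>A return takes a time at most \<open>R + 1\<close> and halves the
    distance.\<close>
  define \<kappa> where "\<kappa> = ln 2 / (R + 1)"
  have \<kappa>: "\<kappa> > 0" using R by (simp add: \<kappa>_def)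
  define K where "K = 2 * (1 + 2 * B) * exp (L * (R + 1))"
  have K: "K > 0" using B by (simp add: K_def)
  have on_section: "\<exists>\<theta>. \<bar>\<theta>\<bar> \<le> 2 * norm (y 0 - p) \<and> (\<forall>s\<ge>0. norm (y s - Y (s + \<theta>)) \<le> K * exp (- \<kappa> * s) * norm (y 0 - p))"
    if y: "sphere_solution F y" and yd: "norm (y 0 - p) < \<delta>" and l0: "l (y 0 - p) = 0" for y
  proof -
    define d where "d = norm (y 0 - p)"
    have d: "d \<ge> 0" "d < \<delta>" using yd by (auto simp: d_def)
    have "\<exists>t. \<forall>n. ((n = 0 \<longrightarrow> t n = 0) \<and> l (y (t n) - p) = 0 \<and> norm (y (t n) - p) \<le> d * (1/2) ^ n) \<and>
        \<bar>t (Suc n) - t n - R\<bar> \<le> d * (1/2) ^ n"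
    proof (rule dependent_nat_choice)
      show "\<exists>x. (0 = (0::nat) \<longrightarrow> x = 0) \<and> l (y x - p) = 0 \<and> norm (y x - p) \<le> d * (1/2) ^ 0"
        using l0 by (auto simp: d_def)
      fix x and n :: nat assume x: "(n = 0 \<longrightarrow> x = 0) \<and> l (y x - p) = 0 \<and> norm (y x - p) \<le> d * (1/2) ^ n"
      have "d * (1/2) ^ n \<le> d * 1" using d by (intro mult_left_mono power_le_one) auto
      then have "norm (y x - p) < \<delta>" using x d by simp
      then obtain \<sigma> where "\<bar>\<sigma>\<bar> \<le> norm (y x - p)" "norm (y (x + (R + \<sigma>)) - p) \<le> norm (y x - p) / 2"
          "l (y (x + (R + \<sigma>)) - p) = 0"
        using step[OF solution_shift[OF y, of x]] x by (auto simp: R_def)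
      with x show "\<exists>z. ((Suc n = 0 \<longrightarrow> z = 0) \<and> l (y z - p) = 0 \<and> norm (y z - p) \<le> d * (1/2) ^ Suc n) \<and>
          \<bar>z - x - R\<bar> \<le> d * (1/2) ^ n"
        by (intro exI[of _ "x + (R + \<sigma>)"]) auto
    qed
    then obtain t where t0: "t 0 = 0" and t: "\<And>n. norm (y (t n) - p) \<le> d * (1/2) ^ n"
      and ta: "\<And>n. \<bar>t (Suc n) - t n - R\<bar> \<le> d * (1/2) ^ n" by blast
    define a where "a n = t (Suc n) - t n - R" for n
    have geo: "(\<lambda>n. d * (1/2) ^ (n + k)) sums (2 * d * (1/2) ^ k)" for k
    proof -
      have "(\<lambda>n. (d * (1/2) ^ k) * (1/2) ^ n) sums ((d * (1/2) ^ k) * (1 / (1 - 1/2)))"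
        by (intro sums_mult geometric_sums) simp
      then show ?thesis by (simp add: power_add mult_ac)
    qed
    have suma: "summable a"
      by (rule summable_comparison_test'[of "\<lambda>n. d * (1/2) ^ (n + 0)" 0])
         (use ta geo[of 0] in \<open>auto simp: a_def sums_iff\<close>)
    have tsum: "t k = real k * R + (\<Sum>j<k. a j)" for k
      by (induction k) (auto simp: t0 a_def algebra_simps)
    \<comment> \<open>With this sign \<open>t k + \<theta>\<close> approaches
      \<open>real k * R\<close>, a multiple of the period, so \<open>Y (t k + \<theta>)\<close>
      approaches \<open>p\<close> together with \<open>y (t k)\<close>.\<close>
    define \<theta> where "\<theta> = - suminf a"
    have tail: "\<bar>t k + \<theta> - real k * R\<bar> \<le> 2 * d * (1/2) ^ k" for k
    proof -
      have "t k + \<theta> - real k * R = - (\<Sum>n. a (n + k))"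
        using suminf_minus_initial_segment[OF suma, of k] by (simp add: tsum \<theta>_def)
      also have "\<bar>\<dots>\<bar> \<le> (\<Sum>n. d * (1/2) ^ (n + k))"
        using norm_suminf_le[of "\<lambda>n. a (n + k)" "\<lambda>n. d * (1/2) ^ (n + k)"] ta geo[of k]
        by (auto simp: a_def sums_iff)
      finally show ?thesis using geo[of k] by (simp add: sums_iff)
    qed
    have decay: "norm (y (t k) - Y (t k + \<theta>)) \<le> (1 + 2 * B) * (d * (1/2) ^ k)" for k
    proof -
      have "Y (real (k * N) * T) = p" by (rule Y_per_nat_0)
      then have "Y (real k * R) = p" by (simp add: R_def mult.assoc)
      then have "norm (p - Y (t k + \<theta>)) \<le> B * \<bar>t k + \<theta> - real k * R\<bar>"
        using Y_lipschitz[of "real k * R" "t k + \<theta>"] by (simp add: abs_minus_commute)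
      also have "\<dots> \<le> B * (2 * d * (1/2) ^ k)" using tail B by (intro mult_left_mono) auto
      finally show ?thesis
        using norm_triangle_ineq[of "y (t k) - p" "p - Y (t k + \<theta>)"] t[of k] by (simp add: algebra_simps)
    qed
    \<comment> \<open>The bound \<delta> \<le> 1 enters here: corrections of the return time do not
      exceed 1, so the return times grow by at least 1 and exhaust the half-line.\<close>
    have dk1: "d * (1/2) ^ n \<le> 1" for n
    proof -
      have "d * (1/2) ^ n \<le> 1 * 1" using d \<delta> by (intro mult_mono power_le_one) auto
      then show ?thesis by simp
    qed
    have tmono: "t k + 1 \<le> t (Suc k)" "t (Suc k) \<le> t k + (R + 1)" for k
      using ta[of k] dk1[of k] R by linarith+
    have tlow: "real k \<le> t k" for k using tmono(1) t0 by (induction k) (auto, smt (verit) of_nat_Suc)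
    have tup: "t k \<le> real k * (R + 1)" for k
    proof (induction k)
      case (Suc k)
      have "real (Suc k) * (R + 1) = real k * (R + 1) + (R + 1)" by (simp add: algebra_simps)
      then show ?case using tmono(2)[of k] Suc by linarith
    qed (simp add: t0)
    have "norm (y s - Y (s + \<theta>)) \<le> K * exp (- \<kappa> * s) * d" if s: "s \<ge> 0" for s
    proof -
      obtain m :: nat where "s < real m" using reals_Archimedean2 by blast
      then have "s < t m" using tlow[of m] by simp
      \<comment> \<open>Index of the return interval containing \<open>s\<close>; on it the estimate
        at \<open>t k\<close> is carried forward over a time at most \<open>R + 1\<close>.\<close>
      define k where "k = (LEAST k. s < t (Suc k))"
      have ex: "s < t (Suc m)" using \<open>s < t m\<close> tmono(1)[of m] by simp
      have k1: "s < t (Suc k)" unfolding k_def by (rule LeastI[of "\<lambda>k. s < t (Suc k)", OF ex])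
      have k2: "t k \<le> s"
      proof (cases k)
        case 0
        then show ?thesis using s t0 by simp
      next
        case (Suc j)
        then have "\<not> s < t (Suc j)" using not_less_Least[of j "\<lambda>k. s < t (Suc k)"] by (simp add: k_def)
        then show ?thesis using Suc by simp
      qed
      have sol: "sphere_solution F (\<lambda>s. Y (\<theta> + s))" by (rule solution_shift[OF Y_sol])
      have pow: "(1/2) ^ k \<le> 2 * exp (- \<kappa> * s)"
      proof -
        have "\<kappa> * s \<le> \<kappa> * (real (Suc k) * (R + 1))"
          using k1 tup[of "Suc k"] \<kappa> by (intro mult_left_mono) auto
        also have "\<dots> = real (Suc k) * ln 2" using R by (simp add: \<kappa>_def)
        finally have "exp (- (real (Suc k) * ln 2)) \<le> exp (- \<kappa> * s)" by simp
        moreover have "exp (- (real (Suc k) * ln 2)) = (1/2) ^ Suc k"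
          by (simp only: exp_minus exp_of_nat_mult) (simp add: power_one_over inverse_eq_divide)
        ultimately have "(1/2) ^ Suc k \<le> exp (- \<kappa> * s)" by (simp only:)
        then show ?thesis by simp
      qed
      have "norm (y s - Y (\<theta> + s)) \<le> norm (y (t k) - Y (\<theta> + t k)) * exp (L * (s - t k))"
        by (rule solution_diff[OF y sol k2])
      also have "\<dots> \<le> (1 + 2 * B) * (d * (1/2) ^ k) * exp (L * (R + 1))"
        using decay[of k] k1 k2 tmono(2)[of k] L B d by (intro mult_mono) (auto simp: add.commute)
      also have "\<dots> \<le> (1 + 2 * B) * (d * (2 * exp (- \<kappa> * s))) * exp (L * (R + 1))"
        using pow B d by (intro mult_right_mono mult_left_mono) auto
      also have "\<dots> = K * exp (- \<kappa> * s) * d" by (simp add: K_def)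
      finally show ?thesis by (simp add: add.commute)
    qed
    moreover have "\<bar>\<theta>\<bar> \<le> 2 * d" using tail[of 0] t0 by simp
    ultimately show ?thesis unfolding d_def by blast
  qed
  \<comment> \<open>The first return may enlarge the distance by the factor \<open>C\<close>, and
    the result must still be below \<open>\<delta>\<close>.\<close>
  define \<delta>' where "\<delta>' = \<delta> / C"
  define D where "D = exp (\<kappa> * (R + 1))"
  define C' where "C' = 3 * C + K * C * D + (exp (L * (R + 1)) + 3 * B * C) * D"
  have D: "D \<ge> 1" using \<kappa> R by (simp add: D_def)
  have C': "C' > 0" using C K D B by (simp add: C'_def add_pos_nonneg)
  show ?thesis
  proof (rule that[of \<delta>' C' \<kappa>])
    show "\<delta>' > 0" using \<delta> C by (simp add: \<delta>'_def)
    fix y assume y: "sphere_solution F y" and yd: "norm (y 0 - p) < \<delta>'"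
    define d where "d = norm (y 0 - p)"
    have d: "d \<ge> 0" "C * d < \<delta>" using yd C by (auto simp: d_def \<delta>'_def field_simps)
    have "d \<le> C * d" using d C by (simp add: mult_le_cancel_right1)
    then have "norm (y 0 - p) < \<delta>" using d by (simp add: d_def)
    then obtain \<sigma> where \<sigma>: "\<bar>\<sigma>\<bar> \<le> 1" "\<bar>\<sigma>\<bar> \<le> C * d" "norm (y (R + \<sigma>) - p) \<le> C * d" "l (y (R + \<sigma>) - p) = 0"
      using step[OF y] by (auto simp: d_def R_def)
    define r where "r = R + \<sigma>"
    have r: "0 \<le> r" "r \<le> R + 1" using \<sigma> R by (auto simp: r_def)
    obtain \<theta>' where \<theta>': "\<bar>\<theta>'\<bar> \<le> 2 * norm (y r - p)"
      "\<And>s. s \<ge> 0 \<Longrightarrow> norm (y (r + s) - Y (s + \<theta>')) \<le> K * exp (- \<kappa> * s) * norm (y r - p)"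
      using on_section[OF solution_shift[OF y, of r]] \<sigma> d by (auto simp: r_def)
    \<comment> \<open>The first return lasts \<open>N\<close> periods plus \<open>\<sigma>\<close>;
      the periods drop out and only \<open>\<sigma>\<close> changes the phase.\<close>
    define \<theta> where "\<theta> = \<theta>' - \<sigma>"
    have \<theta>: "\<bar>\<theta>\<bar> \<le> 3 * C * d" using \<theta>'(1) \<sigma> by (simp add: \<theta>_def r_def)
    have "norm (y s - Y (s + \<theta>)) \<le> C' * exp (- \<kappa> * s) * d" if s: "s \<ge> 0" for s
    proof (cases "r \<le> s")
      case True
      have "Y (s - r + \<theta>') = Y (s + \<theta>)"
        using Y_per_nat[of "s - r + \<theta>'" N] by (simp add: \<theta>_def r_def R_def algebra_simps)
      then have "norm (y s - Y (s + \<theta>)) \<le> K * exp (- \<kappa> * (s - r)) * norm (y r - p)"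
        using \<theta>'(2)[of "s - r"] True by simp
      also have "\<dots> \<le> K * (D * exp (- \<kappa> * s)) * (C * d)"
      proof (intro mult_mono)
        have "exp (- \<kappa> * (s - r)) = exp (\<kappa> * r) * exp (- \<kappa> * s)" by (simp add: algebra_simps flip: exp_add)
        also have "\<dots> \<le> D * exp (- \<kappa> * s)" using r \<kappa> by (auto simp: D_def)
        finally show "exp (- \<kappa> * (s - r)) \<le> D * exp (- \<kappa> * s)" .
      qed (use K D \<sigma> in \<open>auto simp: r_def\<close>)
      also have "\<dots> = (K * C * D) * exp (- \<kappa> * s) * d" by (simp add: mult_ac)
      also have "\<dots> \<le> C' * exp (- \<kappa> * s) * d"
        using C D B d by (intro mult_right_mono) (auto simp: C'_def)
      finally show ?thesis .
    next
      case False
      have "norm (y s - Y s) \<le> d * exp (L * (s - 0))"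
        using solution_diff[OF y Y_sol s] by (simp add: d_def p_def)
      also have "\<dots> \<le> d * exp (L * (R + 1))" using False r L d by (intro mult_left_mono) auto
      finally have 1: "norm (y s - Y s) \<le> d * exp (L * (R + 1))" .
      have 2: "norm (Y s - Y (s + \<theta>)) \<le> B * (3 * C * d)"
      proof -
        have "B * \<bar>s - (s + \<theta>)\<bar> \<le> B * (3 * C * d)" using \<theta> B by (intro mult_left_mono) auto
        then show ?thesis using Y_lipschitz[of s "s + \<theta>"] by linarith
      qed
      have "norm (y s - Y (s + \<theta>)) \<le> (exp (L * (R + 1)) + 3 * B * C) * d"
        using norm_triangle_ineq[of "y s - Y s" "Y s - Y (s + \<theta>)"] 1 2 by (simp add: algebra_simps)
      also have "\<dots> \<le> (exp (L * (R + 1)) + 3 * B * C) * d * (D * exp (- \<kappa> * s))"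
      proof -
        have "1 \<le> exp (\<kappa> * (R + 1 - s))" using False r \<kappa> by simp
        also have "\<dots> = D * exp (- \<kappa> * s)" by (simp add: D_def algebra_simps flip: exp_add)
        finally have "1 \<le> D * exp (- \<kappa> * s)" .
        from mult_left_mono[OF this, of "(exp (L * (R + 1)) + 3 * B * C) * d"] show ?thesis using B C d by simp
      qed
      also have "\<dots> = ((exp (L * (R + 1)) + 3 * B * C) * D) * exp (- \<kappa> * s) * d" by (simp add: mult_ac)
      also have "\<dots> \<le> C' * exp (- \<kappa> * s) * d"
        using C K D B d by (intro mult_right_mono) (auto simp: C'_def)
      finally show ?thesis .
    qed
    moreover have "3 * C * d \<le> C' * d" using C K D B d by (intro mult_right_mono) (auto simp: C'_def)
    then have "\<bar>\<theta>\<bar> \<le> C' * d" using \<theta> by simp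
    ultimately show "\<exists>\<theta>. \<bar>\<theta>\<bar> \<le> C' * norm (y 0 - p) \<and>
        (\<forall>s\<ge>0. norm (y s - Y (s + \<theta>)) \<le> C' * exp (- \<kappa> * s) * norm (y 0 - p))"
      unfolding d_def by blast
  qed (use C' \<kappa> in auto)
qed

end

section \<open>The integral of the radial rate along a trajectory\<close>

context sphere_flow
begin

definition Rint :: "(real \<Rightarrow> 'a) \<Rightarrow> real \<Rightarrow> real" where
  "Rint y s = (LBINT u=0..s. Fr F (y u))"

lemma Fr_solution_continuous:
  assumes "sphere_solution F y" shows "continuous_on S (\<lambda>s. Fr F (y s))"
proof (rule lipschitz_on_continuous_on[of "L * B"], rule lipschitz_onI)
  fix a b
  have "\<bar>Fr F (y a) - Fr F (y b)\<bar> \<le> L * norm (y a - y b)"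
    by (intro Fr_lip solution_norm assms)
  also have "\<dots> \<le> L * (B * \<bar>a - b\<bar>)"
    using L solution_lipschitz[OF assms] by (intro mult_left_mono) auto
  finally show "dist (Fr F (y a)) (Fr F (y b)) \<le> L * B * dist a b"
    by (simp add: dist_real_def mult.assoc)
qed (use L B in simp)

lemma Rint_0: "Rint y 0 = 0"
  unfolding Rint_def zero_ereal_def by (rule interval_integral_endpoints_same)

lemma Rint_deriv: "sphere_solution F y \<Longrightarrow> (Rint y has_real_derivative Fr F (y s)) (at s)"
  using antiderivative_real_line[OF Fr_solution_continuous]
  by (simp add: Rint_def [abs_def] has_real_derivative_iff_has_vector_derivative)

lemma Rint_deriv_shift:
  assumes "sphere_solution F y" shows "((\<lambda>s. Rint y (c + s)) has_real_derivative Fr F (y (c + s))) (at s)"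
  using DERIV_chain2[OF Rint_deriv[OF assms] DERIV_add[OF DERIV_const DERIV_ident], of c s] by simp

lemma Rint_lipschitz:
  assumes "sphere_solution F y" shows "\<bar>Rint y b - Rint y a\<bar> \<le> B * \<bar>b - a\<bar>"
proof -
  have *: "\<bar>Rint y b - Rint y a\<bar> \<le> B * (b - a)" if "a \<le> b" for a b
  proof -
    have "norm (Rint y b - Rint y a) \<le> B * b - B * a"
      by (rule has_vector_derivative_norm_le[OF that, where g' = "\<lambda>s. Fr F (y s)" and \<phi>' = "\<lambda>_. B"])
         (auto intro!: derivative_eq_intros Fr_bd solution_norm assms Rint_deriv
            simp flip: has_real_derivative_iff_has_vector_derivative)
    then show ?thesis by (simp add: algebra_simps)
  qed
  show ?thesis using *[of a b] *[of b a] by (cases "a \<le> b") (auto simp: abs_minus_commute)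
qed

end

lemma exponential_tail_bound:
  fixes D :: "real \<Rightarrow> real"
  assumes D: "\<And>s. s \<ge> 0 \<Longrightarrow> (D has_real_derivative D' s) (at s)"
    and bound: "\<And>s. s \<ge> 0 \<Longrightarrow> \<bar>D' s\<bar> \<le> c * exp (- \<kappa> * s)" and \<kappa>: "\<kappa> > 0" and ab: "0 \<le> a" "a \<le> b"
  shows "\<bar>D b - D a\<bar> \<le> c / \<kappa> * exp (- \<kappa> * a)"
proof -
  have c: "c \<ge> 0" using order_trans[OF abs_ge_zero bound[of 0]] by simp
  have "norm (D b - D a) \<le> - (c / \<kappa>) * exp (- \<kappa> * b) - - (c / \<kappa>) * exp (- \<kappa> * a)"
    by (rule has_vector_derivative_norm_le[OF ab(2), where g' = D' and \<phi>' = "\<lambda>s. c * exp (- \<kappa> * s)"])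
       (use \<kappa> ab bound in \<open>auto intro!: derivative_eq_intros D simp flip: has_real_derivative_iff_has_vector_derivative\<close>)
  moreover have "c / \<kappa> * exp (- \<kappa> * b) \<ge> 0" using c \<kappa> by simp
  ultimately show ?thesis by simp
qed

lemma exponential_tail_limit:
  fixes D :: "real \<Rightarrow> real"
  assumes D: "\<And>s. s \<ge> 0 \<Longrightarrow> (D has_real_derivative D' s) (at s)"
    and bound: "\<And>s. s \<ge> 0 \<Longrightarrow> \<bar>D' s\<bar> \<le> c * exp (- \<kappa> * s)" and \<kappa>: "\<kappa> > 0"
  obtains K where "(D \<longlongrightarrow> K) at_top"
proof -
  note tail = exponential_tail_bound[OF D bound \<kappa>]
  have lim0: "((\<lambda>a. c / \<kappa> * exp (- \<kappa> * a)) \<longlongrightarrow> 0) at_top" using \<kappa> by real_asymp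
  have "Cauchy (\<lambda>n. D (real n))"
  proof (rule metric_CauchyI)
    fix e :: real assume e: "e > 0"
    from order_tendstoD(2)[OF filterlim_compose[OF lim0 filterlim_real_sequentially] e]
    obtain M where M: "\<And>n. n \<ge> M \<Longrightarrow> c / \<kappa> * exp (- \<kappa> * real n) < e"
      by (auto simp: eventually_sequentially)
    have "\<bar>D (real m) - D (real n)\<bar> < e" if "n \<ge> M" "m \<ge> n" for m n
      using tail[of "real n" "real m"] M[of n] that by simp
    then show "\<exists>M. \<forall>m\<ge>M. \<forall>n\<ge>M. dist (D (real m)) (D (real n)) < e"
      unfolding dist_real_def by (metis abs_minus_commute nle_le)
  qed
  then obtain K where K: "(\<lambda>n. D (real n)) \<longlonglongrightarrow> K" by (auto simp: Cauchy_convergent_iff convergent_def)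
  have "\<bar>D s - K\<bar> \<le> c / \<kappa> * exp (- \<kappa> * s)" if s: "s \<ge> 0" for s
  proof (rule tendsto_upperbound)
    show "(\<lambda>n. \<bar>D s - D (real n)\<bar>) \<longlonglongrightarrow> \<bar>D s - K\<bar>" by (intro tendsto_intros K)
    obtain m :: nat where m: "s \<le> real m" using real_arch_simple by blast
    show "\<forall>\<^sub>F n in sequentially. \<bar>D s - D (real n)\<bar> \<le> c / \<kappa> * exp (- \<kappa> * s)"
    proof (rule eventually_sequentiallyI[of m])
      fix n assume "m \<le> n"
      then have "s \<le> real n" using m by simp
      then show "\<bar>D s - D (real n)\<bar> \<le> c / \<kappa> * exp (- \<kappa> * s)"
        using tail[OF _ _ s, of "real n"] by (simp add: abs_minus_commute)
    qed
  qed simp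
  then have "\<forall>\<^sub>F s in at_top. norm (D s - K) \<le> c / \<kappa> * exp (- \<kappa> * s)"
    unfolding eventually_at_top_linorder by auto
  from Lim_null_comparison[OF this lim0] have "(D \<longlongrightarrow> K) at_top" by (rule LIM_zero_cancel)
  then show ?thesis by (rule that)
qed

section \<open>Comparison with the cycle for all positive times\<close>

context stable_cycle
begin

definition J where "J = Rint Y"
text \<open>The logarithmic gain in radius over one period; \<open>T_mean\<close> identifies it with
  the spacing of the logarithms of the regularization parameters.\<close>

definition m where "m = J T"

lemma J_deriv: "(J has_real_derivative Fr F (Y s)) (at s)"
  unfolding J_def by (rule Rint_deriv[OF Y_sol])

lemma J_shift: "J (s + T) = J s + m"
proof -
  have "((\<lambda>s. J (T + s) - J s) has_real_derivative 0) (at s)" for s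
    using DERIV_diff[OF Rint_deriv_shift[OF Y_sol, of T s] J_deriv[of s]] Y_per[of s]
    by (simp add: J_def add.commute)
  then have "J (T + s) - J s = J (T + 0) - J 0" by (rule DERIV_isconst_all[rule_format])
  then show ?thesis by (simp add: m_def J_def Rint_0 add.commute)
qed

lemma J_shift_nat: "J (s + real n * T) = J s + real n * m"
proof (induction n)
  case (Suc n)
  have "J (s + real (Suc n) * T) = J ((s + real n * T) + T)" by (simp add: algebra_simps)
  also have "\<dots> = J s + real (Suc n) * m" unfolding J_shift Suc by (simp add: algebra_simps)
  finally show ?case .
qed simp

lemma J_lipschitz: "\<bar>J b - J a\<bar> \<le> B * \<bar>b - a\<bar>"
  unfolding J_def by (rule Rint_lipschitz[OF Y_sol])

text \<open>Near the cycle the trajectory is close to some \<open>Y c\<close>. Waiting for the time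
  \<open>T - c\<close> brings it close to \<open>p\<close>, with distances growing at most by
  \<open>exp (L * T)\<close>, and there \<open>asymptotic_phase\<close> applies.\<close>

lemma basin_phase:
  assumes "x \<in> basin F (Y ` {0..<T})"
  obtains y \<theta> C \<kappa> where "sphere_solution F y" "y 0 = x" "\<kappa> > 0"
    "\<And>s. s \<ge> 0 \<Longrightarrow> norm (y s - Y (s + \<theta>)) \<le> C * exp (- \<kappa> * s)"
proof -
  obtain y where y: "sphere_solution F y" "y 0 = x" and lim: "((\<lambda>s. infdist (y s) (Y ` {0..<T})) \<longlongrightarrow> 0) at_top"
    using assms unfolding basin_def by blast
  obtain \<delta> C \<kappa> where \<delta>: "\<delta> > 0" "C > 0" "\<kappa> > 0" and ph:
    "\<And>y. sphere_solution F y \<Longrightarrow> norm (y 0 - p) < \<delta> \<Longrightarrow>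
      \<exists>\<theta>. \<bar>\<theta>\<bar> \<le> C * norm (y 0 - p) \<and> (\<forall>s\<ge>0. norm (y s - Y (s + \<theta>)) \<le> C * exp (- \<kappa> * s) * norm (y 0 - p))"
    by (rule asymptotic_phase) blast
  have "\<delta> / exp (L * T) > 0" using \<delta> by simp
  from order_tendstoD(2)[OF lim this]
  have "\<forall>\<^sub>F s in at_top. infdist (y s) (Y ` {0..<T}) < \<delta> / exp (L * T) \<and> s \<ge> 0"
    by (intro eventually_conj eventually_ge_at_top)
  then obtain s1 where s1: "infdist (y s1) (Y ` {0..<T}) < \<delta> / exp (L * T)" "s1 \<ge> 0"
    using eventually_happens'[OF trivial_limit_at_top_linorder] by blast
  have ne: "Y ` {0..<T} \<noteq> {}" using T_pos by auto
  then have "(INF a\<in>Y ` {0..<T}. dist (y s1) a) < \<delta> / exp (L * T)"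
    using s1(1) by (simp add: infdist_def)
  then obtain c where c: "0 \<le> c" "c < T" "dist (y s1) (Y c) < \<delta> / exp (L * T)"
    by (subst (asm) cINF_less_iff[OF ne]) auto
  define s2 where "s2 = s1 + (T - c)"
  have s2: "s2 \<ge> 0" using s1 c by (simp add: s2_def)
  have "norm (y (s1 + (T - c)) - Y (c + (T - c))) \<le> norm (y (s1 + 0) - Y (c + 0)) * exp (L * ((T - c) - 0))"
    by (rule solution_diff[OF solution_shift[OF y(1)] solution_shift[OF Y_sol]]) (use c in simp)
  also have "\<dots> \<le> norm (y s1 - Y c) * exp (L * T)" using c L by (simp add: mult_left_mono)
  also have "\<dots> < \<delta>" using c(3) by (simp add: dist_norm field_simps)
  finally have "norm (y (s2 + 0) - p) < \<delta>" using Y_per_nat_0[of 1] by (simp add: s2_def)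
  from ph[OF solution_shift[OF y(1)] this] obtain \<theta>' where
    \<theta>': "\<And>s. s \<ge> 0 \<Longrightarrow> norm (y (s2 + s) - Y (s + \<theta>')) \<le> C * exp (- \<kappa> * s) * norm (y (s2 + 0) - p)" by blast
  have two: "norm (u - w) \<le> 2" if "norm u = 1" "norm w = 1" for u w :: 'a
    using norm_triangle_ineq4[of u w] that by simp
  \<comment> \<open>Before \<open>s2\<close> only the trivial bound 2 on the distance of unit
    vectors is at hand; the factor \<open>exp (\<kappa> * s2)\<close> compensates for it.\<close>
  define C' where "C' = (2 * C + 2) * exp (\<kappa> * s2)"
  have "norm (y s - Y (s + (\<theta>' - s2))) \<le> C' * exp (- \<kappa> * s)" if s: "s \<ge> 0" for s
  proof (cases "s2 \<le> s")
    case True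
    have "norm (y s - Y (s + (\<theta>' - s2))) \<le> C * exp (- \<kappa> * (s - s2)) * norm (y (s2 + 0) - p)"
      using \<theta>'[of "s - s2"] True by (simp add: algebra_simps)
    also have "\<dots> \<le> C * exp (- \<kappa> * (s - s2)) * 2"
      using \<delta> solution_norm[OF y(1)] p_norm by (intro mult_left_mono two) auto
    also have "\<dots> = 2 * C * exp (\<kappa> * s2) * exp (- \<kappa> * s)" by (simp add: algebra_simps flip: exp_add)
    also have "\<dots> \<le> C' * exp (- \<kappa> * s)" by (simp add: C'_def)
    finally show ?thesis .
  next
    case False
    then have "1 \<le> exp (\<kappa> * (s2 - s))" using \<delta> by simp
    also have "\<dots> = exp (\<kappa> * s2) * exp (- \<kappa> * s)" by (simp add: algebra_simps flip: exp_add)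
    finally have 1: "1 \<le> exp (\<kappa> * s2) * exp (- \<kappa> * s)" .
    have "norm (y s - Y (s + (\<theta>' - s2))) \<le> 2 * 1" using two[OF solution_norm[OF y(1)] Y_norm] by simp
    also have "\<dots> \<le> (2 * C + 2) * (exp (\<kappa> * s2) * exp (- \<kappa> * s))" using 1 \<delta> by (intro mult_mono) auto
    finally show ?thesis by (simp add: C'_def mult.assoc)
  qed
  with y \<delta>(3) show ?thesis by (rule that)
qed

text \<open>The radial rates inherit the exponential convergence, so their difference is integrable.
  The limit \<open>K\<close> fixes the amplitude of the growing solution.\<close>

lemma phase_limit:
  assumes y: "sphere_solution F y" and \<kappa>: "\<kappa> > 0"
    and ph: "\<And>s. s \<ge> 0 \<Longrightarrow> norm (y s - Y (s + \<theta>)) \<le> C * exp (- \<kappa> * s)"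
  obtains K where "((\<lambda>s. Rint y s - J (s + \<theta>)) \<longlongrightarrow> K) at_top"
proof (rule exponential_tail_limit[of "\<lambda>s. Rint y s - J (s + \<theta>)" "\<lambda>s. Fr F (y s) - Fr F (Y (s + \<theta>))" "L * C" \<kappa>])
  show "((\<lambda>s. Rint y s - J (s + \<theta>)) has_real_derivative Fr F (y s) - Fr F (Y (s + \<theta>))) (at s)" for s
    using DERIV_diff[OF Rint_deriv[OF y] Rint_deriv_shift[OF Y_sol, of \<theta> s]] by (simp add: J_def add.commute)
  fix s :: real assume "s \<ge> 0"
  have "\<bar>Fr F (y s) - Fr F (Y (s + \<theta>))\<bar> \<le> L * norm (y s - Y (s + \<theta>))"
    by (intro Fr_lip solution_norm[OF y] Y_norm)
  also have "\<dots> \<le> L * (C * exp (- \<kappa> * s))" using ph[OF \<open>s \<ge> 0\<close>] L by (intro mult_left_mono) auto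
  finally show "\<bar>Fr F (y s) - Fr F (Y (s + \<theta>))\<bar> \<le> L * C * exp (- \<kappa> * s)" by (simp add: mult.assoc)
qed (use \<kappa> that in auto)

text \<open>The bounds follow from continuous dependence up to a late time \<open>S\<close> at which both solutions are
  near \<open>p\<close>; from there on both are compared with their asymptotic phases.\<close>

lemma uniform_stability:
  assumes y0: "sphere_solution F y0" and \<kappa>0: "\<kappa>0 > 0"
    and ph0: "\<And>s. s \<ge> 0 \<Longrightarrow> norm (y0 s - Y (s + \<theta>0)) \<le> C0 * exp (- \<kappa>0 * s)" and \<epsilon>: "\<epsilon> > 0"
  obtains \<eta> where "\<eta> > 0" "\<And>y s. sphere_solution F y \<Longrightarrow> norm (y 0 - y0 0) < \<eta> \<Longrightarrow> s \<ge> 0 \<Longrightarrow>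
      norm (y s - y0 s) \<le> \<epsilon> \<and> \<bar>Rint y s - Rint y0 s\<bar> \<le> \<epsilon>"
proof -
  obtain \<delta> C \<kappa> where \<delta>: "\<delta> > 0" and C: "C > 0" and \<kappa>: "\<kappa> > 0" and ph:
    "\<And>y. sphere_solution F y \<Longrightarrow> norm (y 0 - p) < \<delta> \<Longrightarrow>
      \<exists>\<theta>. \<bar>\<theta>\<bar> \<le> C * norm (y 0 - p) \<and> (\<forall>s\<ge>0. norm (y s - Y (s + \<theta>)) \<le> C * exp (- \<kappa> * s) * norm (y 0 - p))"
    by (rule asymptotic_phase) blast
  \<comment> \<open>Collects the factors of \<open>\<epsilon>1\<close> in the late-time bounds for
    the directions and for the radial integrals.\<close>
  define Q where "Q = 2 + 2 * C + 4 * B * C + L * (2 * C / \<kappa> + 1 / \<kappa>0)"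
  have Q: "Q \<ge> 2" using C B L \<kappa> \<kappa>0 by (simp add: Q_def add_nonneg_nonneg)
  define \<epsilon>1 where "\<epsilon>1 = min (\<delta> / 3) (\<epsilon> / Q)"
  have \<epsilon>1: "\<epsilon>1 > 0" "2 * \<epsilon>1 < \<delta>" "Q * \<epsilon>1 \<le> \<epsilon>"
  proof -
    show "\<epsilon>1 > 0" "2 * \<epsilon>1 < \<delta>" using \<delta> \<epsilon> Q by (auto simp: \<epsilon>1_def min_def)
    have "Q * \<epsilon>1 \<le> Q * (\<epsilon> / Q)" using Q by (intro mult_left_mono) (auto simp: \<epsilon>1_def)
    then show "Q * \<epsilon>1 \<le> \<epsilon>" using Q by simp
  qed
  have "((\<lambda>s. C0 * exp (- \<kappa>0 * s)) \<longlongrightarrow> 0) at_top" using \<kappa>0 by real_asymp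
  from order_tendstoD(2)[OF this \<epsilon>1(1)]
  have "\<forall>\<^sub>F s in at_top. C0 * exp (- \<kappa>0 * s) < \<epsilon>1 \<and> s \<ge> 0" by (intro eventually_conj eventually_ge_at_top)
  then obtain s0 where s0: "\<And>s. s \<ge> s0 \<Longrightarrow> C0 * exp (- \<kappa>0 * s) < \<epsilon>1 \<and> s \<ge> 0"
    by (auto simp: eventually_at_top_linorder)
  \<comment> \<open>Rounding up to whole periods makes \<open>S + \<theta>0\<close> a multiple of
    \<open>T\<close>, so the reference solution is near \<open>p\<close> at time \<open>S\<close>
    and follows \<open>Y\<close> with phase 0 from there on.\<close>
  obtain k :: nat where k: "(s0 + \<theta>0) / T \<le> real k" using real_arch_simple by blast
  define S where "S = real k * T - \<theta>0"
  have "s0 \<le> S" using k T_pos by (simp add: S_def field_simps)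
  from s0[OF this] have S: "C0 * exp (- \<kappa>0 * S) < \<epsilon>1" "S \<ge> 0" by auto
  have YS: "Y (S + s + \<theta>0) = Y s" for s using Y_per_nat[of s k] by (simp add: S_def add.commute)
  \<comment> \<open>Small enough both for the separation up to time \<open>S\<close> and for what it
    adds to the radial integral.\<close>
  define \<eta> where "\<eta> = \<epsilon>1 / (exp (L * S) * (L * S + 1))"
  have LS: "L * S + 1 > 0" using L S by (simp add: add_nonneg_pos)
  have \<eta>: "\<eta> > 0" using \<epsilon>1 LS by (simp add: \<eta>_def)
  have \<eta>E: "(\<eta> * exp (L * S)) * (L * S + 1) = \<epsilon>1" using LS by (simp add: \<eta>_def)
  have \<eta>E0: "\<eta> * exp (L * S) \<ge> 0" using \<eta> by simp
  have \<eta>1: "\<eta> * exp (L * S) \<le> \<epsilon>1" and \<eta>2: "L * (\<eta> * exp (L * S)) * S \<le> \<epsilon>1"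
    using \<eta>E \<eta>E0 L S mult_nonneg_nonneg[OF \<eta>E0, of "L * S"] by (auto simp: algebra_simps)
  show ?thesis
  proof (rule that[OF \<eta>])
    fix y s assume y: "sphere_solution F y" and yd: "norm (y 0 - y0 0) < \<eta>" and s: "s \<ge> (0::real)"
    have early: "norm (y s - y0 s) \<le> \<eta> * exp (L * S)" if "0 \<le> s" "s \<le> S" for s
    proof -
      have "norm (y s - y0 s) \<le> norm (y 0 - y0 0) * exp (L * (s - 0))"
        by (rule solution_diff[OF y y0 that(1)])
      also have "\<dots> \<le> \<eta> * exp (L * S)" using yd that L \<eta> by (intro mult_mono) auto
      finally show ?thesis .
    qed
    have early_int: "\<bar>Rint y s - Rint y0 s\<bar> \<le> \<epsilon>1" if "0 \<le> s" "s \<le> S" for s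
    proof -
      have "norm ((Rint y s - Rint y0 s) - (Rint y 0 - Rint y0 0)) \<le> (L * (\<eta> * exp (L * S))) * s - (L * (\<eta> * exp (L * S))) * 0"
      proof (rule has_vector_derivative_norm_le[OF that(1), where g' = "\<lambda>u. Fr F (y u) - Fr F (y0 u)" and \<phi>' = "\<lambda>_. L * (\<eta> * exp (L * S))"])
        fix u assume u: "u \<in> {0..s}"
        show "((\<lambda>s. Rint y s - Rint y0 s) has_vector_derivative Fr F (y u) - Fr F (y0 u)) (at u)"
          using DERIV_diff[OF Rint_deriv[OF y] Rint_deriv[OF y0]]
          by (simp add: has_real_derivative_iff_has_vector_derivative)
        show "((\<lambda>s. (L * (\<eta> * exp (L * S))) * s) has_real_derivative L * (\<eta> * exp (L * S))) (at u)"
          by (auto intro!: derivative_eq_intros)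
        have "\<bar>Fr F (y u) - Fr F (y0 u)\<bar> \<le> L * norm (y u - y0 u)"
          by (intro Fr_lip solution_norm[OF y] solution_norm[OF y0])
        also have "\<dots> \<le> L * (\<eta> * exp (L * S))" using early[of u] u that L by (intro mult_left_mono) auto
        finally show "norm (Fr F (y u) - Fr F (y0 u)) \<le> L * (\<eta> * exp (L * S))" by simp
      qed
      also have "\<dots> \<le> (L * (\<eta> * exp (L * S))) * S" using that L \<eta> by (auto intro!: mult_left_mono)
      finally show ?thesis using \<eta>2 by (simp add: Rint_0)
    qed
    have Q1: "\<epsilon>1 \<le> Q * \<epsilon>1" using Q \<epsilon>1 by (simp add: mult_le_cancel_right1)
    show "norm (y s - y0 s) \<le> \<epsilon> \<and> \<bar>Rint y s - Rint y0 s\<bar> \<le> \<epsilon>"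
    proof (cases "s \<le> S")
      case True
      then show ?thesis using early[OF s] early_int[OF s] \<eta>1 Q1 \<epsilon>1 by linarith
    next
      case False
      have y0p: "norm (y0 (S + u) - Y u) \<le> \<epsilon>1 * exp (- \<kappa>0 * u)" if "u \<ge> 0" for u
      proof -
        have "norm (y0 (S + u) - Y u) \<le> C0 * exp (- \<kappa>0 * (S + u))"
          using ph0[of "S + u"] YS[of u] that S by simp
        also have "\<dots> = (C0 * exp (- \<kappa>0 * S)) * exp (- \<kappa>0 * u)" by (simp add: algebra_simps flip: exp_add)
        also have "\<dots> \<le> \<epsilon>1 * exp (- \<kappa>0 * u)" using S by (intro mult_right_mono) auto
        finally show ?thesis .
      qed
      have "norm (y (S + 0) - p) \<le> norm (y S - y0 S) + norm (y0 (S + 0) - Y 0)"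
        using norm_triangle_ineq[of "y S - y0 S" "y0 (S + 0) - Y 0"] by (simp add: p_def)
      also have "\<dots> \<le> 2 * \<epsilon>1" using early[of S] \<eta>1 S y0p[of 0] by simp
      finally have yS: "norm (y (S + 0) - p) \<le> 2 * \<epsilon>1" .
      then have "norm (y (S + 0) - p) < \<delta>" using \<epsilon>1 by simp
      from ph[OF solution_shift[OF y] this] obtain \<theta> where
        \<theta>: "\<bar>\<theta>\<bar> \<le> C * norm (y (S + 0) - p)"
          "\<And>u. u \<ge> 0 \<Longrightarrow> norm (y (S + u) - Y (u + \<theta>)) \<le> C * exp (- \<kappa> * u) * norm (y (S + 0) - p)" by blast
      have \<theta>1: "\<bar>\<theta>\<bar> \<le> 2 * C * \<epsilon>1" using \<theta>(1) mult_left_mono[OF yS, of C] C by linarith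
      have \<theta>2: "norm (y (S + u) - Y (u + \<theta>)) \<le> 2 * C * \<epsilon>1 * exp (- \<kappa> * u)" if "u \<ge> 0" for u
        using order_trans[OF \<theta>(2)[OF that] mult_left_mono[OF yS, of "C * exp (- \<kappa> * u)"]] C by (simp add: mult_ac)
      have B\<theta>: "B * \<bar>\<theta>\<bar> \<le> 2 * B * C * \<epsilon>1" using mult_left_mono[OF \<theta>1, of B] B by (simp add: mult_ac)
      define u where "u = s - S"
      have u: "u \<ge> 0" "S + u = s" using False by (auto simp: u_def)
      have "norm (y s - y0 s) \<le> norm (y (S + u) - Y (u + \<theta>)) + norm (Y (u + \<theta>) - Y u) + norm (Y u - y0 (S + u))"
        using norm_triangle_ineq[of "y s - Y (u + \<theta>)" "Y (u + \<theta>) - y0 s"]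
          norm_triangle_ineq[of "Y (u + \<theta>) - Y u" "Y u - y0 s"] by (simp add: u)
      also have "\<dots> \<le> 2 * C * \<epsilon>1 * 1 + 2 * B * C * \<epsilon>1 + \<epsilon>1 * 1"
      proof (intro add_mono)
        show "norm (y (S + u) - Y (u + \<theta>)) \<le> 2 * C * \<epsilon>1 * 1"
          by (rule order_trans[OF \<theta>2[OF u(1)] mult_left_mono]) (use u \<kappa> C \<epsilon>1 in auto)
        show "norm (Y (u + \<theta>) - Y u) \<le> 2 * B * C * \<epsilon>1" using Y_lipschitz[of "u + \<theta>" u] B\<theta> by simp
        show "norm (Y u - y0 (S + u)) \<le> \<epsilon>1 * 1" unfolding norm_minus_commute[of "Y u"]
          by (rule order_trans[OF y0p[OF u(1)] mult_left_mono]) (use u \<kappa>0 \<epsilon>1 in auto)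
      qed
      also have "\<dots> = (1 + 2 * C + 2 * B * C) * \<epsilon>1" by (simp add: algebra_simps)
      also have "\<dots> \<le> Q * \<epsilon>1" using C B L \<kappa> \<kappa>0 \<epsilon>1 by (intro mult_right_mono) (auto simp: Q_def add_nonneg_nonneg)
      finally have 1: "norm (y s - y0 s) \<le> \<epsilon>" using \<epsilon>1 by simp
      \<comment> \<open>The phase shift changes the radial integral by
        \<open>J (\<theta> + u) - J u\<close>, which is small by the Lipschitz bound on
        \<open>J\<close> but does not decay. Once it is subtracted, the derivative decays
        exponentially.\<close>
      define D where "D u = Rint y (S + u) - Rint y0 (S + u) - (J (\<theta> + u) - J u)" for u
      define \<phi> where "\<phi> u = - (L * (2 * C * \<epsilon>1) / \<kappa> * exp (- \<kappa> * u)) - L * \<epsilon>1 / \<kappa>0 * exp (- \<kappa>0 * u)" for u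
      have "norm (D u - D 0) \<le> \<phi> u - \<phi> 0"
      proof (rule has_vector_derivative_norm_le[OF u(1),
            where g' = "\<lambda>u. Fr F (y (S + u)) - Fr F (y0 (S + u)) - (Fr F (Y (\<theta> + u)) - Fr F (Y u))"
            and \<phi>' = "\<lambda>u. L * (2 * C * \<epsilon>1 * exp (- \<kappa> * u)) + L * (\<epsilon>1 * exp (- \<kappa>0 * u))"])
        fix v assume "v \<in> {0..u}"
        then have v: "v \<ge> 0" by simp
        show "(D has_vector_derivative Fr F (y (S + v)) - Fr F (y0 (S + v)) - (Fr F (Y (\<theta> + v)) - Fr F (Y v))) (at v)"
          unfolding D_def J_def has_real_derivative_iff_has_vector_derivative[symmetric]
          by (intro DERIV_diff Rint_deriv_shift Rint_deriv y y0 Y_sol)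
        show "(\<phi> has_real_derivative L * (2 * C * \<epsilon>1 * exp (- \<kappa> * v)) + L * (\<epsilon>1 * exp (- \<kappa>0 * v))) (at v)"
          unfolding \<phi>_def using \<kappa> \<kappa>0 by (auto intro!: derivative_eq_intros)
        have "\<bar>Fr F (y (S + v)) - Fr F (Y (v + \<theta>))\<bar> \<le> L * (2 * C * \<epsilon>1 * exp (- \<kappa> * v))"
          by (rule order_trans[OF Fr_lip[OF solution_norm[OF y] Y_norm] mult_left_mono[OF \<theta>2[OF v]]]) (use L in simp)
        moreover have "\<bar>Fr F (y0 (S + v)) - Fr F (Y v)\<bar> \<le> L * (\<epsilon>1 * exp (- \<kappa>0 * v))"
          by (rule order_trans[OF Fr_lip[OF solution_norm[OF y0] Y_norm] mult_left_mono[OF y0p[OF v]]]) (use L in simp)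
        ultimately show "norm (Fr F (y (S + v)) - Fr F (y0 (S + v)) - (Fr F (Y (\<theta> + v)) - Fr F (Y v)))
            \<le> L * (2 * C * \<epsilon>1 * exp (- \<kappa> * v)) + L * (\<epsilon>1 * exp (- \<kappa>0 * v))"
          by (simp add: add.commute)
      qed
      also have "\<dots> \<le> L * (2 * C * \<epsilon>1) / \<kappa> + L * \<epsilon>1 / \<kappa>0"
      proof -
        have "0 \<le> L * (2 * C * \<epsilon>1) / \<kappa> * exp (- \<kappa> * u)" "0 \<le> L * \<epsilon>1 / \<kappa>0 * exp (- \<kappa>0 * u)"
          using L C \<epsilon>1 \<kappa> \<kappa>0 by auto
        then show ?thesis by (simp add: \<phi>_def)
      qed
      finally have D: "\<bar>D u - D 0\<bar> \<le> L * (2 * C * \<epsilon>1) / \<kappa> + L * \<epsilon>1 / \<kappa>0" by simp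
      have J1: "\<bar>J (\<theta> + u) - J u\<bar> \<le> 2 * B * C * \<epsilon>1" using J_lipschitz[of "\<theta> + u" u] B\<theta> by simp
      have J2: "\<bar>J \<theta> - J 0\<bar> \<le> 2 * B * C * \<epsilon>1" using J_lipschitz[of \<theta> 0] B\<theta> by simp
      have "\<bar>Rint y s - Rint y0 s\<bar> \<le> \<epsilon>1 + (2 * B * C * \<epsilon>1 + 2 * B * C * \<epsilon>1) + (L * (2 * C * \<epsilon>1) / \<kappa> + L * \<epsilon>1 / \<kappa>0)"
        using D J1 J2 early_int[of S] S by (simp add: D_def u(2))
      also have "\<dots> = (1 + 4 * B * C + L * (2 * C / \<kappa> + 1 / \<kappa>0)) * \<epsilon>1" by (simp add: algebra_simps)
      also have "\<dots> \<le> Q * \<epsilon>1" using C \<epsilon>1 by (intro mult_right_mono) (auto simp: Q_def)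
      finally show ?thesis using 1 \<epsilon>1 by simp
    qed
  qed
qed

end

section \<open>The limiting profile\<close>

locale growing_cycle = stable_cycle F L B Y T
  for F :: "'a::euclidean_space \<Rightarrow> 'a" and L B :: real and Y :: "real \<Rightarrow> 'a" and T :: real +
  fixes \<alpha> :: real
  assumes alpha: "\<alpha> < 1" and mean_pos: "mean_Fr F Y T > 0"
begin

lemma T_mean: "T * mean_Fr F Y T = m"
  using T_pos by (simp add: mean_Fr_def m_def J_def Rint_def)

lemma m_pos: "m > 0"
  unfolding T_mean[symmetric] using T_pos mean_pos by simp

lemma I_fun_eq: "I_fun F Y a b = J b - J a"
  unfolding I_fun_def
  by (rule interval_integral_FTC_finite)
     (auto intro!: Fr_solution_continuous Y_sol has_field_derivative_at_within[OF J_deriv]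
       simp flip: has_real_derivative_iff_has_vector_derivative)

definition \<beta> where "\<beta> = 1 - \<alpha>"
definition q where "q = exp (- \<beta> * m)"
definition P where "P u = (LBINT x=0..u. exp (\<beta> * J x))" for u :: real
text \<open>\<open>Ef s\<close> is \<open>\<integral>\<^sub>-\<^sub>\<infinity>\<^sup>s exp (\<beta> * J u) du\<close>: over the preceding period the integrand sums to \<open>P s - P (s - T)\<close>,
  and each earlier period contributes another factor \<open>q\<close>.\<close>

definition Ef where "Ef s = (P s - P (s - T)) / (1 - q)"

lemma beta_pos: "\<beta> > 0" using alpha by (simp add: \<beta>_def)

lemma q_bounds: "0 < q" "q < 1" using beta_pos m_pos by (auto simp: q_def)

lemma J_continuous: "continuous_on S J"
  by (intro continuous_at_imp_continuous_on ballI DERIV_isCont[OF J_deriv])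

lemma J_0: "J 0 = 0" by (simp add: J_def Rint_0)

lemma P_deriv: "(P has_real_derivative exp (\<beta> * J s)) (at s)"
proof -
  have "continuous_on UNIV (\<lambda>x. exp (\<beta> * J x))" by (intro continuous_intros J_continuous)
  from antiderivative_real_line[OF this] show ?thesis
    by (simp add: P_def [abs_def] has_real_derivative_iff_has_vector_derivative)
qed

lemma shift_deriv:
  assumes "\<And>s::real. (f has_real_derivative f' s) (at s)"
  shows "((\<lambda>s. f (s + c)) has_real_derivative f' (s + c)) (at s)"
  using DERIV_shift[of f "f' (s + c)" s c] assms by simp

lemma exp_J_shift: "exp (\<beta> * J (s - T)) = q * exp (\<beta> * J s)"
  using J_shift[of "s - T"] by (simp add: q_def algebra_simps flip: exp_add)

text \<open>The integrand picks up the factor \<open>q\<close> one period earlier, so the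
  combination has zero derivative; only the base point of the integral leaves a constant.\<close>

lemma P_quasiperiodic: "P (s - T) - q * P s = P (- T) - q * P 0"
proof -
  have "((\<lambda>s. P (s + - T) - q * P s) has_real_derivative 0) (at s)" for s
    using DERIV_diff[OF shift_deriv[OF P_deriv, of "- T" s] DERIV_cmult[OF P_deriv, of q s]]
    by (simp add: exp_J_shift)
  then have "P (s + - T) - q * P s = P (0 + - T) - q * P 0" by (rule DERIV_isconst_all[rule_format])
  then show ?thesis by simp
qed

lemma Ef_deriv: "(Ef has_real_derivative exp (\<beta> * J s)) (at s)"
proof -
  have "((\<lambda>s. (P s - P (s + - T)) / (1 - q)) has_real_derivative (exp (\<beta> * J s) - exp (\<beta> * J (s + - T))) / (1 - q)) (at s)"
    by (intro DERIV_cdivide DERIV_diff P_deriv shift_deriv)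
  moreover have "(exp (\<beta> * J s) - exp (\<beta> * J (s + - T))) / (1 - q) = exp (\<beta> * J s)"
    using q_bounds by (simp add: exp_J_shift field_simps)
  ultimately have "((\<lambda>s. (P s - P (s + - T)) / (1 - q)) has_real_derivative exp (\<beta> * J s)) (at s)"
    by (simp only:)
  then show ?thesis unfolding Ef_def [abs_def] by (simp only: add_uminus_conv_diff)
qed

lemma Ef_shift: "Ef (s - T) = q * Ef s"
  using P_quasiperiodic[of s] P_quasiperiodic[of "s - T"]
  by (simp add: Ef_def algebra_simps flip: add_divide_distrib diff_divide_distrib)

lemma Ef_less: "a < b \<Longrightarrow> Ef a < Ef b"
  by (rule DERIV_pos_imp_increasing) (use Ef_deriv in \<open>auto intro!: exI\<close>)

lemma Ef_pos: "Ef s > 0"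
proof -
  have "P (s - T) < P s"
    by (rule DERIV_pos_imp_increasing) (use T_pos P_deriv in \<open>auto intro!: exI\<close>)
  then show ?thesis using q_bounds by (simp add: Ef_def)
qed

lemma Ef_at_bot: "(Ef \<longlongrightarrow> 0) at_bot"
proof (rule order_tendstoI)
  show "\<forall>\<^sub>F s in at_bot. a < Ef s" if "a < 0" for a
    using less_trans[OF that Ef_pos] by simp
  fix a :: real assume "0 < a"
  have Efn: "Ef (- (real n * T)) = q ^ n * Ef 0" for n
  proof (induction n)
    case (Suc n)
    have "- (real (Suc n) * T) = - (real n * T) - T" by (simp add: algebra_simps)
    then show ?case by (simp only: Ef_shift Suc power_Suc mult.assoc)
  qed simp
  obtain n where "q ^ n < a / Ef 0"
    using real_arch_pow_inv[of "a / Ef 0" q] \<open>0 < a\<close> Ef_pos[of 0] q_bounds by auto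
  then have n: "Ef (- (real n * T)) < a" unfolding Efn using Ef_pos[of 0] by (simp add: pos_less_divide_eq)
  have "Ef s < a" if "s \<le> - (real n * T)" for s
    using n Ef_less[of s "- (real n * T)"] that by (cases "s = - (real n * T)") auto
  then show "\<forall>\<^sub>F s in at_bot. Ef s < a" unfolding eventually_at_bot_linorder by blast
qed

text \<open>The improper integral has the antiderivative
  \<open>exp (- \<beta> * J s2) * Ef (s + s1)\<close>, which vanishes at minus infinity; this
  separates the two arguments of \<open>phi_fun\<close>.\<close>

lemma phi_fun_eq: "phi_fun \<alpha> F Y s1 s2 = ln (Ef s1) / \<beta> - J s2"
proof -
  have "(LBINT s'=-\<infinity>..0. exp (- (1 - \<alpha>) * I_fun F Y (s1 + s') s2)) = exp (- \<beta> * J s2) * Ef s1 - 0"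
  proof (rule interval_integral_FTC_nonneg(2)[where F = "\<lambda>s. exp (- \<beta> * J s2) * Ef (s + s1)"])
    have eq: "exp (- (1 - \<alpha>) * I_fun F Y (s1 + x) s2) = exp (- \<beta> * J s2) * exp (\<beta> * J (x + s1))" for x
      by (simp add: I_fun_eq \<beta>_def algebra_simps flip: exp_add)
    show "((\<lambda>s. exp (- \<beta> * J s2) * Ef (s + s1)) has_real_derivative exp (- (1 - \<alpha>) * I_fun F Y (s1 + x) s2)) (at x)" for x
      unfolding eq by (intro DERIV_cmult shift_deriv Ef_deriv)
    show "isCont (\<lambda>x. exp (- (1 - \<alpha>) * I_fun F Y (s1 + x) s2)) x" for x
      unfolding eq by (intro continuous_intros continuous_on_interior[where S = UNIV] continuous_on_compose2[OF J_continuous[of UNIV]]) auto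
    have "filterlim (\<lambda>x. x + s1) at_bot at_bot" by real_asymp
    then have "((\<lambda>s. exp (- \<beta> * J s2) * Ef (s + s1)) \<longlongrightarrow> exp (- \<beta> * J s2) * 0) at_bot"
      by (intro tendsto_mult tendsto_const filterlim_compose[OF Ef_at_bot])
    then show "(((\<lambda>s. exp (- \<beta> * J s2) * Ef (s + s1)) \<circ> real_of_ereal) \<longlongrightarrow> 0) (at_right (- \<infinity>))"
      unfolding ereal_tendsto_simps1 by simp
    have "isCont (\<lambda>s. exp (- \<beta> * J s2) * Ef (s + s1)) 0"
      by (rule DERIV_isCont[OF DERIV_cmult[OF shift_deriv[OF Ef_deriv]]])
    then have "((\<lambda>s. exp (- \<beta> * J s2) * Ef (s + s1)) \<longlongrightarrow> exp (- \<beta> * J s2) * Ef s1) (at_left 0)"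
      by (auto simp: isCont_def intro: tendsto_within_subset[where S = UNIV])
    then show "(((\<lambda>s. exp (- \<beta> * J s2) * Ef (s + s1)) \<circ> real_of_ereal) \<longlongrightarrow> exp (- \<beta> * J s2) * Ef s1) (at_left 0)"
      unfolding zero_ereal_def ereal_tendsto_simps1 by simp
  qed auto
  then have "phi_fun \<alpha> F Y s1 s2 = ln (exp (- \<beta> * J s2) * Ef s1) / \<beta>"
    by (simp add: phi_fun_def \<beta>_def)
  also have "\<dots> = ln (Ef s1) / \<beta> - J s2"
    using Ef_pos[of s1] beta_pos by (simp add: ln_mult field_simps)
  finally show ?thesis .
qed

definition psi where "psi = psi_fun \<alpha> F Y"

lemma psi_eq: "psi s = ln (Ef s) / \<beta>"
  by (simp add: psi_def psi_fun_def phi_fun_eq J_0)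

lemma psi_less: "a < b \<Longrightarrow> psi a < psi b"
  using beta_pos Ef_pos Ef_less by (simp add: psi_eq divide_strict_right_mono)

lemma psi_less_iff: "psi a < psi b \<longleftrightarrow> a < b"
  using psi_less by (metis less_irrefl less_trans linorder_neqE_linordered_idom)

lemma psi_shift: "psi (s + T) = psi s + m"
proof -
  have "ln (Ef s) = ln q + ln (Ef (s + T))"
    using Ef_shift[of "s + T"] q_bounds Ef_pos[of "s + T"] by (simp add: ln_mult)
  then show ?thesis using beta_pos by (simp add: psi_eq q_def field_simps)
qed

lemma psi_shift_nat: "psi (s + real n * T) = psi s + real n * m"
proof (induction n)
  case (Suc n)
  have "psi (s + real (Suc n) * T) = psi ((s + real n * T) + T)" by (simp add: algebra_simps)
  also have "\<dots> = psi s + real (Suc n) * m" unfolding psi_shift Suc by (simp add: algebra_simps)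
  finally show ?case .
qed simp

lemma psi_inj: "inj psi"
  using psi_less by (intro injI) (metis less_irrefl linorder_neqE_linordered_idom)

text \<open>A shift by one period raises \<open>psi\<close> by \<open>m > 0\<close>, so its values
  at multiples of \<open>T\<close> are unbounded in both directions and the intermediate value
  theorem fills the gaps.\<close>

lemma psi_surj: "surj psi"
proof -
  have ex: "\<exists>s. psi s = u" for u
  proof -
    obtain n :: nat where "\<bar>u - psi 0\<bar> / m \<le> real n" using real_arch_simple by blast
    then have n: "\<bar>u - psi 0\<bar> \<le> real n * m" using m_pos by (simp add: field_simps)
    have a: "psi (- (real n * T)) \<le> u" using psi_shift_nat[of "- (real n * T)" n, unfolded left_minus] n by linarith
    have b: "u \<le> psi (real n * T)" using psi_shift_nat[of 0 n, unfolded add_0] n by linarith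
    have "continuous_on UNIV Ef" by (intro continuous_at_imp_continuous_on ballI DERIV_isCont[OF Ef_deriv])
    then have "continuous_on UNIV psi"
      unfolding psi_eq [abs_def] using Ef_pos beta_pos by (intro continuous_intros) (auto simp: less_imp_neq[symmetric])
    then have "continuous_on {- (real n * T)..real n * T} psi" by (rule continuous_on_subset) simp
    moreover have "- (real n * T) \<le> real n * T" using T_pos by simp
    ultimately show ?thesis using IVT'[of psi, OF a b] by blast
  qed
  show ?thesis by (rule surjI[of psi "\<lambda>u. SOME s. psi s = u"], rule someI_ex[OF ex])
qed

text \<open>Writing the argument as \<open>psi s\<close> eliminates the inverse function; the later
  statements about the profile go through this formula.\<close>

lemma Xp_eq: "Xp_fun \<alpha> F Y (psi s) = exp (J s - psi s) *\<^sub>R Y s"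
  using inv_f_f[OF psi_inj] by (simp add: Xp_fun_def xp_fun_def phi_fun_eq psi_eq flip: psi_def)

lemma Xp_periodic: "Xp_fun \<alpha> F Y (u + m) = Xp_fun \<alpha> F Y u"
proof -
  obtain s where "u = psi s" using psi_surj by (metis surjD)
  then show ?thesis using Xp_eq[of "s + T"] by (simp add: psi_shift J_shift Y_per Xp_eq)
qed

text \<open>Strict monotonicity does the work of continuity of the inverse of
  \<open>psi\<close>.\<close>

lemma psi_tendsto_cancel:
  assumes "((\<lambda>n. psi (a n)) \<longlongrightarrow> psi s) A" shows "(a \<longlongrightarrow> s) A"
proof (rule order_tendstoI)
  show "\<forall>\<^sub>F x in A. b < a x" if "b < s" for b
    using order_tendstoD(1)[OF assms psi_less[OF that]] by (simp add: psi_less_iff)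
  show "\<forall>\<^sub>F x in A. a x < b" if "s < b" for b
    using order_tendstoD(2)[OF assms psi_less[OF that]] by (simp add: psi_less_iff)
qed

end

section \<open>Trajectories in the time of the sphere flow\<close>

context sphere_flow
begin

definition rad :: "(real \<Rightarrow> 'a) \<Rightarrow> real \<Rightarrow> real \<Rightarrow> real" where
  "rad y r s = r * exp (Rint y s)"

definition clock :: "real \<Rightarrow> (real \<Rightarrow> 'a) \<Rightarrow> real \<Rightarrow> real \<Rightarrow> real" where
  "clock \<alpha> y r s = (LBINT u=0..s. rad y r u powr (1 - \<alpha>))"

lemma rad_pos: "r > 0 \<Longrightarrow> rad y r s > 0" by (simp add: rad_def)

lemma rad_0: "rad y r 0 = r" by (simp add: rad_def Rint_0)

lemma rad_deriv:
  assumes "sphere_solution F y" shows "(rad y r has_real_derivative rad y r s * Fr F (y s)) (at s)"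
  unfolding rad_def [abs_def] by (auto intro!: derivative_eq_intros Rint_deriv assms)

lemma rad_continuous: "sphere_solution F y \<Longrightarrow> continuous_on S (rad y r)"
  by (intro continuous_at_imp_continuous_on ballI DERIV_isCont[OF rad_deriv])

lemma clock_0: "clock \<alpha> y r 0 = 0"
  unfolding clock_def zero_ereal_def by (rule interval_integral_endpoints_same)

lemma clock_deriv:
  assumes y: "sphere_solution F y" and r: "r > 0"
  shows "(clock \<alpha> y r has_real_derivative rad y r s powr (1 - \<alpha>)) (at s)"
proof -
  have "continuous_on UNIV (\<lambda>u. rad y r u powr (1 - \<alpha>))"
    using rad_pos[OF r] by (intro continuous_on_powr continuous_on_const rad_continuous y) (auto simp: less_imp_neq[symmetric])
  from antiderivative_real_line[OF this] show ?thesis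
    by (simp add: clock_def [abs_def] has_real_derivative_iff_has_vector_derivative)
qed

lemma clock_continuous: "sphere_solution F y \<Longrightarrow> r > 0 \<Longrightarrow> continuous_on S (clock \<alpha> y r)"
  by (intro continuous_at_imp_continuous_on ballI DERIV_isCont[OF clock_deriv])

lemma clock_less:
  assumes "sphere_solution F y" "r > 0" "a < b" shows "clock \<alpha> y r a < clock \<alpha> y r b"
proof (rule DERIV_pos_imp_increasing[OF assms(3)])
  fix x
  show "\<exists>z. (clock \<alpha> y r has_real_derivative z) (at x) \<and> 0 < z"
    using clock_deriv[OF assms(1,2)] rad_pos[OF assms(2)] by (intro exI conjI) (auto simp: less_imp_neq[symmetric])
qed

lemma clock_le:
  assumes "sphere_solution F y" "r > 0" "a \<le> b" shows "clock \<alpha> y r a \<le> clock \<alpha> y r b"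
  using clock_less[OF assms(1,2), of a b \<alpha>] assms(3) by (cases "a = b") auto

text \<open>A constant factor between radii passes through the time change as its power 1 -
  \<alpha>, so elapsed times remain comparable as ratios even when they are huge.\<close>

lemma clock_compare:
  assumes y: "sphere_solution F y" "r > 0" and y': "sphere_solution F y'" "r' > 0"
    and s: "0 \<le> s" and \<alpha>: "\<alpha> < 1" and c: "c > 0"
    and le: "\<And>u. 0 \<le> u \<Longrightarrow> u \<le> s \<Longrightarrow> rad y r u \<le> c * rad y' r' u"
  shows "clock \<alpha> y r s \<le> c powr (1 - \<alpha>) * clock \<alpha> y' r' s"
proof -
  let ?h = "\<lambda>s. c powr (1 - \<alpha>) * clock \<alpha> y' r' s - clock \<alpha> y r s"
  have "?h 0 \<le> ?h s"
  proof (rule DERIV_nonneg_imp_nondecreasing[OF s])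
    fix x assume x: "0 \<le> x" "x \<le> s"
    have "rad y r x powr (1 - \<alpha>) \<le> (c * rad y' r' x) powr (1 - \<alpha>)"
      using \<alpha> rad_pos[OF y(2), of y x] le[OF x] by (intro powr_mono2) auto
    also have "\<dots> = c powr (1 - \<alpha>) * rad y' r' x powr (1 - \<alpha>)"
      using c rad_pos[OF y'(2), of y' x] by (simp add: powr_mult)
    finally have "c powr (1 - \<alpha>) * rad y' r' x powr (1 - \<alpha>) - rad y r x powr (1 - \<alpha>) \<ge> 0" by simp
    moreover have "(?h has_real_derivative c powr (1 - \<alpha>) * rad y' r' x powr (1 - \<alpha>) - rad y r x powr (1 - \<alpha>)) (at x)"
      by (intro DERIV_diff DERIV_cmult clock_deriv y y')
    ultimately show "\<exists>z. (?h has_real_derivative z) (at x) \<and> 0 \<le> z" by blast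
  qed
  then show ?thesis by (simp add: clock_0)
qed

end

text \<open>Continuity across the interface, tested along a ray from outside. It allows trajectories
  to touch the interface, so that later conditions can be the closed
  \<open>\<nu> \<le> rad y r u\<close>.\<close>

lemma regularization_boundary:
  fixes F G :: "'a::euclidean_space \<Rightarrow> 'a"
  assumes reg: "regularization \<alpha> F G" and y: "norm y = 1"
  shows "G y = F y"
proof -
  let ?f = "reg_field \<alpha> F G 1"
  have "isCont ?f (1 *\<^sub>R y)"
    using reg zero_less_one unfolding regularization_def C1_on_def
    by (blast intro: has_derivative_continuous)
  then have 1: "((\<lambda>l. ?f (l *\<^sub>R y)) \<longlongrightarrow> ?f (1 *\<^sub>R y)) (at_right 1)"
    by (rule isCont_tendsto_compose) (intro tendsto_intros)
  have 2: "((\<lambda>l. l powr \<alpha> *\<^sub>R F y) \<longlongrightarrow> 1 powr \<alpha> *\<^sub>R F y) (at_right (1::real))"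
    by (intro tendsto_intros) auto
  have 3: "\<forall>\<^sub>F l in at_right 1. l powr \<alpha> *\<^sub>R F y = ?f (l *\<^sub>R y)"
    using eventually_at_right_less[of "1::real"] by eventually_elim (use y in \<open>auto simp: reg_field_def\<close>)
  have "?f (1 *\<^sub>R y) = 1 powr \<alpha> *\<^sub>R F y"
    by (rule tendsto_unique[OF trivial_limit_at_right_real 1 Lim_transform_eventually[OF 2 3]])
  then show ?thesis using y by (simp add: reg_field_def)
qed

section \<open>Polar form of regularized trajectories outside the core\<close>

locale regularized_flow = sphere_flow F L B
  for F :: "'a::euclidean_space \<Rightarrow> 'a" and L B :: real +
  fixes G :: "'a \<Rightarrow> 'a" and \<alpha> :: real
  assumes alpha: "\<alpha> < 1" and reg: "regularization \<alpha> F G"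
begin

lemma reg_field_ray:
  assumes y: "norm y = 1" and \<nu>: "0 < \<nu>" "\<nu> \<le> \<rho>"
  shows "reg_field \<alpha> F G \<nu> (\<rho> *\<^sub>R y) = \<rho> powr \<alpha> *\<^sub>R F y"
proof (cases "\<nu> = \<rho>")
  case True
  then show ?thesis using y \<nu> regularization_boundary[OF reg y] by (simp add: reg_field_def)
next
  case False
  then show ?thesis using y \<nu> by (simp add: reg_field_def)
qed

text \<open>In the time variable \<open>s\<close> both the trajectory \<open>X\<close> and the curve \<open>rad y r s *\<^sub>R y s\<close> solve the
  same non-autonomous equation, so no inversion of the time change is needed.\<close>

lemma tracking:
  assumes \<nu>: "\<nu> > 0" and y: "sphere_solution F y" and r: "r > 0" and s: "s \<ge> 0"
    and X: "\<And>\<tau>. \<tau>0 \<le> \<tau> \<Longrightarrow> \<tau> \<le> \<tau>0 + clock \<alpha> y r s \<Longrightarrow> 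
      (X has_vector_derivative reg_field \<alpha> F G \<nu> (X \<tau>)) (at \<tau> within {\<tau>0..\<tau>0 + clock \<alpha> y r s})"
    and X0: "X \<tau>0 = r *\<^sub>R y 0"
    and ge: "\<And>u. 0 \<le> u \<Longrightarrow> u \<le> s \<Longrightarrow> \<nu> \<le> rad y r u"
  shows "X (\<tau>0 + clock \<alpha> y r s) = rad y r s *\<^sub>R y s"
proof -
  obtain K where K: "K \<ge> 0" "\<And>x y. norm (reg_field \<alpha> F G \<nu> x - reg_field \<alpha> F G \<nu> y) \<le> K * norm (x - y)"
    using reg_field_lipschitz[OF alpha reg \<nu>] by blast
  have "continuous_on {0..s} (\<lambda>u. rad y r u powr (1 - \<alpha>))"
    using rad_pos[OF r] by (intro continuous_on_powr continuous_on_const rad_continuous y) (auto simp: less_imp_neq[symmetric])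
  then have "compact ((\<lambda>u. rad y r u powr (1 - \<alpha>)) ` {0..s})" by (rule compact_continuous_image) simp
  then have "bounded ((\<lambda>u. rad y r u powr (1 - \<alpha>)) ` {0..s})" by (rule compact_imp_bounded)
  then obtain b where b: "\<And>u. 0 \<le> u \<Longrightarrow> u \<le> s \<Longrightarrow> rad y r u powr (1 - \<alpha>) \<le> b"
    unfolding bounded_iff by force
  have b0: "b \<ge> 0" using order_trans[OF powr_ge_zero b[of 0]] s by simp
  let ?f = "\<lambda>u x. rad y r u powr (1 - \<alpha>) *\<^sub>R reg_field \<alpha> F G \<nu> x"
  have "norm (X (\<tau>0 + clock \<alpha> y r s) - rad y r s *\<^sub>R y s) \<le>
      norm (X (\<tau>0 + clock \<alpha> y r 0) - rad y r 0 *\<^sub>R y 0) * exp ((b * K) * (s - 0))"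
  proof (rule ode_lipschitz_diff[OF s, where f = ?f])
    fix u assume "u \<in> {0..s}"
    then have u: "0 \<le> u" "u \<le> s" by auto
    have cl: "0 \<le> clock \<alpha> y r u" "clock \<alpha> y r u \<le> clock \<alpha> y r s"
      using clock_le[OF y r] u clock_0 by metis+
    have "((\<lambda>u. \<tau>0 + clock \<alpha> y r u) has_vector_derivative rad y r u powr (1 - \<alpha>)) (at u within {0..s})"
      using DERIV_add[OF DERIV_const clock_deriv[OF y r]]
      by (simp add: has_real_derivative_iff_has_vector_derivative has_vector_derivative_at_within)
    moreover have "(\<lambda>u. \<tau>0 + clock \<alpha> y r u) ` {0..s} \<subseteq> {\<tau>0..\<tau>0 + clock \<alpha> y r s}"
      using clock_le[OF y r, of 0 _ \<alpha>] clock_le[OF y r, of _ s \<alpha>] by (auto simp: clock_0)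
    ultimately show "((\<lambda>u. X (\<tau>0 + clock \<alpha> y r u)) has_vector_derivative ?f u (X (\<tau>0 + clock \<alpha> y r u))) (at u within {0..s})"
      using vector_diff_chain_within[OF _ has_vector_derivative_within_subset[OF X]] cl by (fastforce simp: o_def)
    have "((\<lambda>u. rad y r u *\<^sub>R y u) has_vector_derivative rad y r u *\<^sub>R Fs F (y u) + (rad y r u * Fr F (y u)) *\<^sub>R y u) (at u)"
      by (rule has_vector_derivative_scaleR[OF rad_deriv[OF y] solution_deriv[OF y]])
    also have "rad y r u *\<^sub>R Fs F (y u) + (rad y r u * Fr F (y u)) *\<^sub>R y u = rad y r u *\<^sub>R F (y u)"
      by (simp add: Fs_def algebra_simps)
    also have "\<dots> = ?f u (rad y r u *\<^sub>R y u)"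
    proof -
      have "rad y r u powr (1 - \<alpha>) * rad y r u powr \<alpha> = rad y r u"
        using rad_pos[OF r, of y u] by (simp flip: powr_add)
      then show ?thesis using reg_field_ray[OF solution_norm[OF y] \<nu> ge[OF u]] by simp
    qed
    finally show "((\<lambda>u. rad y r u *\<^sub>R y u) has_vector_derivative ?f u (rad y r u *\<^sub>R y u)) (at u within {0..s})"
      by (rule has_vector_derivative_at_within)
    have "norm (?f u x - ?f u z) \<le> (b * K) * norm (x - z)" for x z
    proof -
      have "norm (?f u x - ?f u z) = rad y r u powr (1 - \<alpha>) * norm (reg_field \<alpha> F G \<nu> x - reg_field \<alpha> F G \<nu> z)"
        by (simp flip: scaleR_diff_right)
      also have "\<dots> \<le> b * (K * norm (x - z))" using b[OF u] K b0 by (intro mult_mono) auto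
      finally show ?thesis by (simp add: mult.assoc)
    qed
    then show "norm (?f u (X (\<tau>0 + clock \<alpha> y r u)) - ?f u (rad y r u *\<^sub>R y u)) \<le>
        (b * K) * norm (X (\<tau>0 + clock \<alpha> y r u) - rad y r u *\<^sub>R y u)" .
  qed (use b0 K in simp)
  then show ?thesis by (simp add: clock_0 rad_0 X0)
qed

end

section \<open>Growth along the cycle and asymptotics of escaping solutions\<close>

context growing_cycle
begin

text \<open>Whole periods contribute \<open>m\<close> each, the incomplete one a bounded
  error.\<close>

lemma J_lower: "s \<ge> 0 \<Longrightarrow> m / T * s - (m + B * T) \<le> J s"
proof -
  assume s: "s \<ge> 0"
  define n where "n = nat \<lfloor>s / T\<rfloor>"
  have "s / T \<ge> 0" using s T_pos by simp
  then have "real n \<le> s / T" "s / T \<le> real n + 1" unfolding n_def by linarith+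
  then have n: "real n * T \<le> s" "s \<le> real n * T + T" using T_pos by (auto simp: field_simps)
  have "J s = J (s - real n * T) + real n * m" using J_shift_nat[of "s - real n * T" n] by simp
  moreover have "\<bar>J (s - real n * T) - J 0\<bar> \<le> B * \<bar>(s - real n * T) - 0\<bar>" by (rule J_lipschitz)
  moreover have "B * \<bar>(s - real n * T) - 0\<bar> \<le> B * T" using n B by (intro mult_left_mono) auto
  moreover have "m / T * s \<le> m / T * (real n * T + T)" using n m_pos T_pos by (intro mult_left_mono) auto
  moreover have "m / T * (real n * T + T) = real n * m + m" using T_pos by (simp add: field_simps)
  ultimately show ?thesis using J_0 by linarith
qed

lemma J_at_top: "filterlim J at_top at_top"
proof (rule filterlim_at_top_mono)
  have lin: "filterlim (\<lambda>s. c * s - d) at_top at_top" if "c > 0" for c d :: real using that by real_asymp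
  show "filterlim (\<lambda>s. m / T * s - (m + B * T)) at_top at_top"
    by (rule lin) (use m_pos T_pos in simp)
  show "\<forall>\<^sub>F s in at_top. m / T * s - (m + B * T) \<le> J s"
    using eventually_ge_at_top[of 0] by eventually_elim (rule J_lower)
qed

lemma Ef_eq: "Ef s = exp (\<beta> * psi s)"
  using Ef_pos beta_pos by (simp add: psi_eq)

lemma psi_at_top: "filterlim psi at_top at_top"
proof -
  have "\<exists>N. \<forall>s\<ge>N. Z \<le> psi s" for Z
  proof -
    obtain s where "Z = psi s" using psi_surj by (metis surjD)
    then show ?thesis using psi_less by (metis le_less)
  qed
  then show ?thesis unfolding filterlim_at_top eventually_at_top_linorder by blast
qed

lemma Ef_at_top: "filterlim Ef at_top at_top"
proof -
  have "filterlim (\<lambda>x. exp (\<beta> * x)) at_top at_top" using beta_pos by real_asymp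
  from filterlim_compose[OF this psi_at_top] show ?thesis by (simp add: Ef_eq [abs_def])
qed

end

text \<open>The reference data \<open>y0\<close>, \<open>r0\<close> will be the polar form of
  \<open>X\<close> from a time after the escape; \<open>K\<close> comes from
  \<open>phase_limit\<close>.\<close>

locale escaping_solution = growing_cycle F L B Y T \<alpha>
  for F :: "'a::euclidean_space \<Rightarrow> 'a" and L B :: real and Y :: "real \<Rightarrow> 'a" and T \<alpha> :: real +
  fixes y0 :: "real \<Rightarrow> 'a" and r0 \<theta> C \<kappa> K :: real
  assumes y0: "sphere_solution F y0" and r0: "r0 > 0" and kappa: "\<kappa> > 0"
    and phase: "\<And>s. s \<ge> 0 \<Longrightarrow> norm (y0 s - Y (s + \<theta>)) \<le> C * exp (- \<kappa> * s)"
    and K: "((\<lambda>s. Rint y0 s - J (s + \<theta>)) \<longlongrightarrow> K) at_top"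
begin

text \<open>The radius is asymptotic to \<open>exp (lk + J (s + \<theta>))\<close>.\<close>

definition lk where "lk = ln r0 + K"

lemma shift_at_top: "filterlim (\<lambda>s. s + \<theta>) at_top at_top" by real_asymp

lemma rad_at_top: "filterlim (rad y0 r0) at_top at_top"
proof -
  have "filterlim (\<lambda>s. (Rint y0 s - J (s + \<theta>)) + J (s + \<theta>)) at_top at_top"
    by (rule filterlim_tendsto_add_at_top[OF K filterlim_compose[OF J_at_top shift_at_top]])
  then have "filterlim (\<lambda>s. exp (Rint y0 s)) at_top at_top"
    by (intro filterlim_compose[OF exp_at_top]) simp
  then show ?thesis unfolding rad_def [abs_def]
    by (intro filterlim_tendsto_pos_mult_at_top[OF tendsto_const r0])
qed

text \<open>By l'Hospital: the quotient of derivatives is the exponential of \<beta> times the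
  deviation of the logarithmic radius from its asymptote. The comparison function equals
  \<open>exp (\<beta> * (lk + psi (s + \<theta>)))\<close>, which is how \<open>psi\<close>
  enters.\<close>

lemma clock_asymptotic: "((\<lambda>s. ln (clock \<alpha> y0 r0 s) - \<beta> * (lk + psi (s + \<theta>))) \<longlongrightarrow> 0) at_top"
proof -
  have "((\<lambda>s. clock \<alpha> y0 r0 s / (exp (\<beta> * lk) * Ef (s + \<theta>))) \<longlongrightarrow> 1) at_top"
  proof (rule lhospital_at_top_at_top)
    show "filterlim (\<lambda>s. exp (\<beta> * lk) * Ef (s + \<theta>)) at_top at_top"
      by (intro filterlim_tendsto_pos_mult_at_top[OF tendsto_const] filterlim_compose[OF Ef_at_top shift_at_top]) simp
    show "\<forall>\<^sub>F s in at_top. exp (\<beta> * lk) * exp (\<beta> * J (s + \<theta>)) \<noteq> 0" by simp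
    show "\<forall>\<^sub>F s in at_top. (clock \<alpha> y0 r0 has_real_derivative rad y0 r0 s powr (1 - \<alpha>)) (at s)"
      by (simp add: clock_deriv[OF y0 r0])
    show "\<forall>\<^sub>F s in at_top. ((\<lambda>s. exp (\<beta> * lk) * Ef (s + \<theta>)) has_real_derivative exp (\<beta> * lk) * exp (\<beta> * J (s + \<theta>))) (at s)"
      by (intro always_eventually allI DERIV_cmult shift_deriv Ef_deriv)
    have eq: "rad y0 r0 s powr (1 - \<alpha>) / (exp (\<beta> * lk) * exp (\<beta> * J (s + \<theta>))) = exp (\<beta> * ((Rint y0 s - J (s + \<theta>)) - K))" for s
    proof -
      have "rad y0 r0 s powr (1 - \<alpha>) = exp (\<beta> * (ln r0 + Rint y0 s))"
        using r0 by (simp add: rad_def powr_def ln_mult \<beta>_def)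
      then show ?thesis by (simp add: lk_def algebra_simps flip: exp_add exp_diff)
    qed
    have "((\<lambda>s. exp (\<beta> * ((Rint y0 s - J (s + \<theta>)) - K))) \<longlongrightarrow> exp (\<beta> * (K - K))) at_top"
      by (intro tendsto_intros K)
    then show "((\<lambda>s. rad y0 r0 s powr (1 - \<alpha>) / (exp (\<beta> * lk) * exp (\<beta> * J (s + \<theta>)))) \<longlongrightarrow> 1) at_top"
      unfolding eq by simp
  qed
  then have "((\<lambda>s. ln (clock \<alpha> y0 r0 s / (exp (\<beta> * lk) * Ef (s + \<theta>)))) \<longlongrightarrow> ln 1) at_top"
    by (intro tendsto_ln) auto
  moreover have "\<forall>\<^sub>F s in at_top. ln (clock \<alpha> y0 r0 s / (exp (\<beta> * lk) * Ef (s + \<theta>))) = ln (clock \<alpha> y0 r0 s) - \<beta> * (lk + psi (s + \<theta>))"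
    using eventually_gt_at_top[of 0]
  proof eventually_elim
    fix s :: real assume "0 < s"
    then have "clock \<alpha> y0 r0 s > 0" using clock_less[OF y0 r0] clock_0 by metis
    then show "ln (clock \<alpha> y0 r0 s / (exp (\<beta> * lk) * Ef (s + \<theta>))) = ln (clock \<alpha> y0 r0 s) - \<beta> * (lk + psi (s + \<theta>))"
      by (simp add: Ef_eq ln_div ln_mult algebra_simps)
  qed
  ultimately show ?thesis by (simp add: Lim_transform_eventually)
qed

lemma clock_at_top: "filterlim (clock \<alpha> y0 r0) at_top at_top"
proof -
  have 1: "filterlim (\<lambda>s. \<beta> * (lk + psi (s + \<theta>))) at_top at_top"
    by (intro filterlim_tendsto_pos_mult_at_top[OF tendsto_const beta_pos] filterlim_tendsto_add_at_top[OF tendsto_const]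
        filterlim_compose[OF psi_at_top shift_at_top])
  have "filterlim (\<lambda>s. (ln (clock \<alpha> y0 r0 s) - \<beta> * (lk + psi (s + \<theta>))) + \<beta> * (lk + psi (s + \<theta>))) at_top at_top"
    by (rule filterlim_tendsto_add_at_top[OF clock_asymptotic 1])
  then have "filterlim (\<lambda>s. exp (ln (clock \<alpha> y0 r0 s))) at_top at_top"
    by (intro filterlim_compose[OF exp_at_top]) simp
  then show ?thesis
  proof (rule filterlim_mono_eventually)
    show "\<forall>\<^sub>F s in at_top. exp (ln (clock \<alpha> y0 r0 s)) = clock \<alpha> y0 r0 s"
      using eventually_gt_at_top[of 0]
    proof eventually_elim
      fix s :: real assume "0 < s"
      then have "clock \<alpha> y0 r0 s > 0" using clock_less[OF y0 r0] clock_0 by metis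
      then show "exp (ln (clock \<alpha> y0 r0 s)) = clock \<alpha> y0 r0 s" by simp
    qed
  qed auto
qed

text \<open>Radii are compared through logarithms: the difference of two exponentially growing radii
  cannot be bounded uniformly in \<open>s\<close>, their ratio can.\<close>

definition close :: "real \<Rightarrow> (real \<Rightarrow> 'a) \<Rightarrow> real \<Rightarrow> bool" where
  "close \<epsilon> y r \<longleftrightarrow> sphere_solution F y \<and> r > 0 \<and>
     (\<forall>s\<ge>0. norm (y s - y0 s) \<le> \<epsilon> \<and> \<bar>ln (rad y r s) - ln (rad y0 r0 s)\<bar> \<le> \<epsilon>)"

lemma ln_rad: "r > 0 \<Longrightarrow> ln (rad y r s) = ln r + Rint y s"
  by (simp add: rad_def ln_mult)

lemma eventually_close:
  assumes y: "\<And>n. sphere_solution F (y n)" and y0': "(\<lambda>n. y n 0) \<longlonglongrightarrow> y0 0" and r: "r \<longlonglongrightarrow> r0"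
    and \<epsilon>: "\<epsilon> > 0"
  shows "\<forall>\<^sub>F n in sequentially. close \<epsilon> (y n) (r n)"
proof -
  have \<epsilon>2: "\<epsilon> / 2 > 0" using \<epsilon> by simp
  obtain \<eta> where \<eta>: "\<eta> > 0" "\<And>y s. sphere_solution F y \<Longrightarrow> norm (y 0 - y0 0) < \<eta> \<Longrightarrow> s \<ge> 0 \<Longrightarrow>
      norm (y s - y0 s) \<le> \<epsilon> / 2 \<and> \<bar>Rint y s - Rint y0 s\<bar> \<le> \<epsilon> / 2"
    using uniform_stability[OF y0 kappa phase \<epsilon>2] by metis
  have "(\<lambda>n. ln (r n)) \<longlonglongrightarrow> ln r0" using r r0 by (intro tendsto_ln) auto
  from tendstoD[OF this \<epsilon>2] tendstoD[OF y0' \<eta>(1)] order_tendstoD(1)[OF r r0]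
  show ?thesis
  proof eventually_elim
    fix n assume n: "dist (ln (r n)) (ln r0) < \<epsilon> / 2" "dist (y n 0) (y0 0) < \<eta>" "0 < r n"
    have "norm (y n s - y0 s) \<le> \<epsilon> \<and> \<bar>ln (rad (y n) (r n) s) - ln (rad y0 r0 s)\<bar> \<le> \<epsilon>" if "s \<ge> 0" for s
      using \<eta>(2)[OF y _ that, of n] n(1,2) \<epsilon> unfolding ln_rad[OF n(3)] ln_rad[OF r0] dist_norm real_norm_def
      by linarith
    then show "close \<epsilon> (y n) (r n)" using y n(3) by (auto simp: close_def)
  qed
qed

lemma close_clock:
  assumes c: "close \<epsilon> y r" and s: "s > 0"
  shows "\<bar>ln (clock \<alpha> y r s) - ln (clock \<alpha> y0 r0 s)\<bar> \<le> \<beta> * \<epsilon>"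
proof -
  have y: "sphere_solution F y" and r: "r > 0"
    and cl: "\<And>s. s \<ge> 0 \<Longrightarrow> \<bar>ln (rad y r s) - ln (rad y0 r0 s)\<bar> \<le> \<epsilon>"
    using c by (auto simp: close_def)
  have pos: "clock \<alpha> y r s > 0" "clock \<alpha> y0 r0 s > 0"
    using clock_less[OF y r s, of \<alpha>] clock_less[OF y0 r0 s, of \<alpha>] by (simp_all add: clock_0)
  have exp_le: "a \<le> exp \<epsilon> * b" if "\<bar>ln a - ln b\<bar> \<le> \<epsilon>" "a > 0" "b > 0" for a b :: real
  proof -
    have "ln a \<le> \<epsilon> + ln b" using that by simp
    then have "exp (ln a) \<le> exp (\<epsilon> + ln b)" by (simp only: exp_le_cancel_iff)
    then show ?thesis using that by (simp add: exp_add)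
  qed
  have "clock \<alpha> y r s \<le> exp \<epsilon> powr (1 - \<alpha>) * clock \<alpha> y0 r0 s"
    using s by (intro clock_compare y r y0 r0 alpha exp_le cl rad_pos) auto
  then have "ln (clock \<alpha> y r s) \<le> ln (exp \<epsilon> powr (1 - \<alpha>) * clock \<alpha> y0 r0 s)" using pos by simp
  then have 1: "ln (clock \<alpha> y r s) \<le> \<beta> * \<epsilon> + ln (clock \<alpha> y0 r0 s)"
    using pos by (simp add: ln_mult ln_powr \<beta>_def)
  have "clock \<alpha> y0 r0 s \<le> exp \<epsilon> powr (1 - \<alpha>) * clock \<alpha> y r s"
    using s cl by (intro clock_compare y r y0 r0 alpha exp_le rad_pos) (auto simp: abs_minus_commute)
  then have "ln (clock \<alpha> y0 r0 s) \<le> ln (exp \<epsilon> powr (1 - \<alpha>) * clock \<alpha> y r s)" using pos by simp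
  then have 2: "ln (clock \<alpha> y0 r0 s) \<le> \<beta> * \<epsilon> + ln (clock \<alpha> y r s)"
    using pos by (simp add: ln_mult ln_powr \<beta>_def)
  show ?thesis using 1 2 by linarith
qed

text \<open>The reference clock is unbounded, and a close one is at least exp (- \<beta>) times it.
  The summand 1 in \<open>\<tau> + 1\<close> keeps the logarithm meaningful at \<tau> = 0.\<close>

lemma close_clock_surj:
  assumes c: "close 1 y r" and \<tau>: "\<tau> \<ge> 0"
  obtains s where "s \<ge> 0" "clock \<alpha> y r s = \<tau>"
proof -
  have y: "sphere_solution F y" and r: "r > 0" using c by (auto simp: close_def)
  have "\<forall>\<^sub>F s in at_top. exp \<beta> * (\<tau> + 1) \<le> clock \<alpha> y0 r0 s \<and> s > 0"
    using clock_at_top by (intro eventually_conj eventually_gt_at_top) (simp add: filterlim_at_top)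
  then obtain s where s: "exp \<beta> * (\<tau> + 1) \<le> clock \<alpha> y0 r0 s" "s > 0"
    using eventually_happens'[OF trivial_limit_at_top_linorder] by blast
  have pos: "clock \<alpha> y r s > 0" "clock \<alpha> y0 r0 s > 0"
    using clock_less[OF y r s(2), of \<alpha>] clock_less[OF y0 r0 s(2), of \<alpha>] by (simp_all add: clock_0)
  have "ln (exp \<beta> * (\<tau> + 1)) \<le> ln (clock \<alpha> y0 r0 s)" using s \<tau> pos by (subst ln_le_cancel_iff) auto
  then have "\<beta> + ln (\<tau> + 1) \<le> ln (clock \<alpha> y0 r0 s)" using \<tau> by (simp add: ln_mult)
  then have "ln (\<tau> + 1) \<le> ln (clock \<alpha> y r s)" using close_clock[OF c s(2)] by simp
  then have "\<tau> \<le> clock \<alpha> y r s" using pos \<tau> by simp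
  moreover have "clock \<alpha> y r 0 \<le> \<tau>" using \<tau> by (simp add: clock_0)
  ultimately obtain s' where "0 \<le> s'" "clock \<alpha> y r s' = \<tau>"
    using IVT'[of "clock \<alpha> y r" 0 \<tau> s] s(2) clock_continuous[OF y r] by auto
  then show ?thesis by (rule that)
qed

text \<open>The scale \<open>a * exp (\<beta> * (real n * m - chi))\<close> is the rescaled time
  belonging to the fixed time \<open>a\<close> after blowup. Comparing logarithms of clocks
  determines \<open>psi (s n + \<theta>)\<close> up to o(1) as a constant plus
  \<open>real n * m\<close>, so \<open>s n + \<theta>\<close> converges once \<open>n\<close>
  periods are removed. Only a ratio tending to 1 is assumed, since the clock will start with a fixed
  offset.\<close>

lemma profile_limit:
  assumes y: "\<And>n. sphere_solution F (y n)" and y0': "(\<lambda>n. y n 0) \<longlonglongrightarrow> y0 0" and r: "r \<longlonglongrightarrow> r0"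
    and s: "\<And>n. s n \<ge> 0" and a: "a > 0"
    and clk: "(\<lambda>n. clock \<alpha> (y n) (r n) (s n) / (a * exp (\<beta> * (real n * m - chi)))) \<longlonglongrightarrow> 1"
  shows "(\<lambda>n. (exp (chi - real n * m) * rad (y n) (r n) (s n)) *\<^sub>R y n (s n)) \<longlonglongrightarrow>
    a powr (1 / \<beta>) *\<^sub>R Xp_fun \<alpha> F Y (ln (a powr (1 / \<beta>)) + (- lk - chi))"
proof -
  note ev = eventually_close[OF y y0' r]
  define c where "c n = clock \<alpha> (y n) (r n) (s n)" for n
  define c0 where "c0 n = clock \<alpha> y0 r0 (s n)" for n
  have cpos: "\<forall>\<^sub>F n in sequentially. c n > 0"
    using order_tendstoD(1)[OF clk zero_less_one]
  proof eventually_elim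
    fix n assume "0 < clock \<alpha> (y n) (r n) (s n) / (a * exp (\<beta> * (real n * m - chi)))"
    moreover have "a * exp (\<beta> * (real n * m - chi)) > 0" using a by simp
    ultimately show "c n > 0" by (auto simp: c_def zero_less_divide_iff)
  qed
  have spos: "\<forall>\<^sub>F n in sequentially. s n > 0"
    using cpos
  proof eventually_elim
    fix n assume "0 < c n"
    then have "s n \<noteq> 0" by (auto simp: c_def clock_0)
    then show "0 < s n" using s[of n] by simp
  qed
  have lnc: "(\<lambda>n. ln (c n) - (ln a + \<beta> * (real n * m - chi))) \<longlonglongrightarrow> 0"
  proof -
    have "(\<lambda>n. ln (c n / (a * exp (\<beta> * (real n * m - chi))))) \<longlonglongrightarrow> ln 1"
      unfolding c_def by (intro tendsto_ln clk) simp
    moreover have "\<forall>\<^sub>F n in sequentially. ln (c n / (a * exp (\<beta> * (real n * m - chi)))) = ln (c n) - (ln a + \<beta> * (real n * m - chi))"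
      using cpos by eventually_elim (use a in \<open>simp add: ln_div ln_mult\<close>)
    ultimately show ?thesis by (simp add: Lim_transform_eventually)
  qed
  have cdiff: "(\<lambda>n. ln (c n) - ln (c0 n)) \<longlonglongrightarrow> 0"
  proof (rule tendstoI)
    fix e :: real assume "e > 0"
    then have "e / (2 * \<beta>) > 0" using beta_pos by simp
    from ev[OF this] spos show "\<forall>\<^sub>F n in sequentially. dist (ln (c n) - ln (c0 n)) 0 < e"
    proof eventually_elim
      fix n assume "close (e / (2 * \<beta>)) (y n) (r n)" "0 < s n"
      from close_clock[OF this] show "dist (ln (c n) - ln (c0 n)) 0 < e"
        using beta_pos \<open>e > 0\<close> by (simp add: c_def c0_def)
    qed
  qed
  have lnc0: "(\<lambda>n. ln (c0 n) - (ln a + \<beta> * (real n * m - chi))) \<longlonglongrightarrow> 0"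
    using tendsto_diff[OF lnc cdiff] by (simp add: algebra_simps)
  have lin_top: "filterlim (\<lambda>n. ln a + \<beta> * (real n * m - chi)) at_top sequentially"
  proof -
    have "filterlim (\<lambda>n. x + b * (real n * c - d)) at_top sequentially" if "b > 0" "c > 0" for x b c d :: real
      using that by real_asymp
    then show ?thesis by (simp add: beta_pos m_pos)
  qed
  have "filterlim (\<lambda>n. (ln (c0 n) - (ln a + \<beta> * (real n * m - chi))) + (ln a + \<beta> * (real n * m - chi))) at_top sequentially"
    by (rule filterlim_tendsto_add_at_top[OF lnc0 lin_top])
  then have lnc0_top: "filterlim (\<lambda>n. ln (c0 n)) at_top sequentially" by simp
  have s_top: "filterlim s at_top sequentially"
    unfolding filterlim_at_top
  proof
    fix S :: real
    define S' where "S' = max S 1"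
    have cS: "clock \<alpha> y0 r0 S' > 0" using clock_less[OF y0 r0, of 0 S' \<alpha>] by (simp add: clock_0 S'_def)
    have "\<forall>\<^sub>F n in sequentially. ln (clock \<alpha> y0 r0 S') < ln (c0 n)"
      using lnc0_top by (simp add: filterlim_at_top_dense)
    with spos show "\<forall>\<^sub>F n in sequentially. S \<le> s n"
    proof eventually_elim
      fix n assume n: "0 < s n" "ln (clock \<alpha> y0 r0 S') < ln (c0 n)"
      have "c0 n > 0" using clock_less[OF y0 r0 n(1), of \<alpha>] by (simp add: clock_0 c0_def)
      then have "clock \<alpha> y0 r0 S' < clock \<alpha> y0 r0 (s n)" using n(2) cS by (simp add: c0_def)
      then have "\<not> s n \<le> S'" using clock_le[OF y0 r0, of "s n" S' \<alpha>] by linarith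
      then show "S \<le> s n" by (simp add: S'_def)
    qed
  qed
  \<comment> \<open>Solves the limiting balance \<open>ln a + \<beta> * (real n * m - chi) = \<beta>
    * (lk + real n * m + u)\<close>.\<close>
  define u where "u = ln a / \<beta> - chi - lk"
  obtain \<sigma> where \<sigma>: "psi \<sigma> = u" using psi_surj by (metis surjD)
  define w where "w n = s n + \<theta> - real n * T" for n
  have wn: "s n + \<theta> = w n + real n * T" for n by (simp add: w_def)
  have "(\<lambda>n. psi (w n)) \<longlonglongrightarrow> psi \<sigma>"
  proof -
    have "(\<lambda>n. ln (c0 n) - \<beta> * (lk + psi (s n + \<theta>))) \<longlonglongrightarrow> 0"
      unfolding c0_def by (rule filterlim_compose[OF clock_asymptotic s_top])
    from tendsto_diff[OF lnc0 this]
    have "(\<lambda>n. (\<beta> * (lk + psi (s n + \<theta>)) - (ln a + \<beta> * (real n * m - chi))) / \<beta> + u) \<longlonglongrightarrow> 0 / \<beta> + u"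
      using beta_pos by (intro tendsto_add tendsto_divide tendsto_const) (auto simp: algebra_simps)
    moreover have "(\<beta> * (lk + psi (s n + \<theta>)) - (ln a + \<beta> * (real n * m - chi))) / \<beta> + u = psi (w n)" for n
      using beta_pos unfolding wn psi_shift_nat u_def by (simp add: field_simps)
    ultimately show ?thesis by (simp add: \<sigma>)
  qed
  then have w: "w \<longlonglongrightarrow> \<sigma>" by (rule psi_tendsto_cancel)
  have "(\<lambda>n. Y (w n)) \<longlonglongrightarrow> Y \<sigma>"
    using w solution_continuous[OF Y_sol, of UNIV] by (simp add: continuous_on_tendsto_compose)
  then have Yw: "(\<lambda>n. Y (s n + \<theta>)) \<longlonglongrightarrow> Y \<sigma>" by (simp only: wn Y_per_nat)
  have "((\<lambda>s. y0 s - Y (s + \<theta>)) \<longlongrightarrow> 0) at_top"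
  proof (rule Lim_null_comparison)
    show "\<forall>\<^sub>F s in at_top. norm (y0 s - Y (s + \<theta>)) \<le> C * exp (- \<kappa> * s)"
      using eventually_ge_at_top[of 0] by eventually_elim (rule phase)
    show "((\<lambda>s. C * exp (- \<kappa> * s)) \<longlongrightarrow> 0) at_top" using kappa by real_asymp
  qed
  from filterlim_compose[OF this s_top]
  have y0Y: "(\<lambda>n. y0 (s n) - Y (s n + \<theta>)) \<longlonglongrightarrow> 0" .
  have yy0: "(\<lambda>n. y n (s n) - y0 (s n)) \<longlonglongrightarrow> 0"
  proof (rule tendstoI)
    fix e :: real assume "e > 0"
    then have "\<forall>\<^sub>F n in sequentially. close (e / 2) (y n) (r n)" by (intro ev) simp
    then show "\<forall>\<^sub>F n in sequentially. dist (y n (s n) - y0 (s n)) 0 < e"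
    proof eventually_elim
      fix n assume "close (e / 2) (y n) (r n)"
      then have "norm (y n (s n) - y0 (s n)) \<le> e / 2" using s by (simp add: close_def)
      then show "dist (y n (s n) - y0 (s n)) 0 < e" using \<open>e > 0\<close> by simp
    qed
  qed
  have ys: "(\<lambda>n. y n (s n)) \<longlonglongrightarrow> Y \<sigma>"
    using tendsto_add[OF tendsto_add[OF yy0 y0Y] Yw] by simp
  have rr: "(\<lambda>n. ln (rad (y n) (r n) (s n)) - ln (rad y0 r0 (s n))) \<longlonglongrightarrow> 0"
  proof (rule tendstoI)
    fix e :: real assume "e > 0"
    then have "\<forall>\<^sub>F n in sequentially. close (e / 2) (y n) (r n)" by (intro ev) simp
    then show "\<forall>\<^sub>F n in sequentially. dist (ln (rad (y n) (r n) (s n)) - ln (rad y0 r0 (s n))) 0 < e"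
    proof eventually_elim
      fix n assume "close (e / 2) (y n) (r n)"
      then have "\<bar>ln (rad (y n) (r n) (s n)) - ln (rad y0 r0 (s n))\<bar> \<le> e / 2" using s by (simp add: close_def)
      then show "dist (ln (rad (y n) (r n) (s n)) - ln (rad y0 r0 (s n))) 0 < e" using \<open>e > 0\<close> by simp
    qed
  qed
  have "(\<lambda>n. J (w n)) \<longlonglongrightarrow> J \<sigma>"
    using w J_continuous[of UNIV] by (simp add: continuous_on_tendsto_compose)
  from tendsto_add[OF tendsto_add[OF rr filterlim_compose[OF K s_top]] this]
  have "(\<lambda>n. (ln (rad (y n) (r n) (s n)) - ln (rad y0 r0 (s n))) + (Rint y0 (s n) - J (s n + \<theta>)) + J (w n)) \<longlonglongrightarrow> 0 + K + J \<sigma>" .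
  moreover have "(ln (rad (y n) (r n) (s n)) - ln (rad y0 r0 (s n))) + (Rint y0 (s n) - J (s n + \<theta>)) + J (w n) =
      ln (rad (y n) (r n) (s n)) - ln r0 - real n * m" for n
    unfolding ln_rad[OF r0] wn J_shift_nat by simp
  ultimately have "(\<lambda>n. ln (rad (y n) (r n) (s n)) - ln r0 - real n * m) \<longlonglongrightarrow> K + J \<sigma>"
    by simp
  from tendsto_exp[OF tendsto_add[OF this tendsto_const[of "chi + ln r0"]]]
  have "(\<lambda>n. exp (chi - real n * m + ln (rad (y n) (r n) (s n)))) \<longlonglongrightarrow> exp (chi + lk + J \<sigma>)"
    by (simp add: lk_def algebra_simps)
  moreover have "\<forall>\<^sub>F n in sequentially. exp (chi - real n * m + ln (rad (y n) (r n) (s n))) = exp (chi - real n * m) * rad (y n) (r n) (s n)"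
    using order_tendstoD(1)[OF r r0] by eventually_elim (simp add: exp_add rad_pos)
  ultimately have "(\<lambda>n. exp (chi - real n * m) * rad (y n) (r n) (s n)) \<longlonglongrightarrow> exp (chi + lk + J \<sigma>)"
    by (rule Lim_transform_eventually)
  from tendsto_scaleR[OF this ys]
  have lim: "(\<lambda>n. (exp (chi - real n * m) * rad (y n) (r n) (s n)) *\<^sub>R y n (s n)) \<longlonglongrightarrow> exp (chi + lk + J \<sigma>) *\<^sub>R Y \<sigma>" .
  have "ln (a powr (1 / \<beta>)) + (- lk - chi) = psi \<sigma>" using a by (simp add: \<sigma> u_def ln_powr)
  moreover have "exp (chi + lk + J \<sigma>) = a powr (1 / \<beta>) * exp (J \<sigma> - psi \<sigma>)"
    using a by (simp add: powr_def \<sigma> u_def flip: exp_add)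
  ultimately show ?thesis using lim by (simp add: Xp_eq)
qed

end

section \<open>Collapse and blowup\<close>

text \<open>\<open>tracking\<close> demands that the radius be at least \<nu> throughout, so the
  hitting time must be the first one.\<close>

lemma first_crossing:
  fixes h :: "real \<Rightarrow> real"
  assumes cont: "continuous_on {0..S} h" and S: "S \<ge> 0" and h0: "\<nu> \<le> h 0" and hS: "h S \<le> \<nu>"
  obtains s where "0 \<le> s" "s \<le> S" "h s = \<nu>" "\<And>u. 0 \<le> u \<Longrightarrow> u \<le> s \<Longrightarrow> \<nu> \<le> h u"
proof -
  let ?A = "{s \<in> {0..S}. h s = \<nu>}"
  have "closed ?A" by (intro continuous_closed_preimage_constant cont) auto
  moreover have "bounded ?A" by (rule bounded_subset[of "{0..S}"]) auto
  ultimately have "compact ?A" by (simp add: compact_eq_bounded_closed)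
  moreover have "?A \<noteq> {}" using IVT2'[of h S \<nu> 0] assms by auto
  ultimately obtain s where s: "s \<in> ?A" "\<And>u. u \<in> ?A \<Longrightarrow> s \<le> u"
    using compact_attains_inf[of ?A] by blast
  have "\<nu> \<le> h u" if u: "0 \<le> u" "u \<le> s" for u
  proof (rule ccontr)
    assume "\<not> \<nu> \<le> h u"
    then have "h u \<le> \<nu>" "h u \<noteq> \<nu>" by auto
    moreover have "continuous_on {0..u} h" using cont u s(1) by (auto intro: continuous_on_subset)
    ultimately obtain v where v: "0 \<le> v" "v \<le> u" "h v = \<nu>" using IVT2'[of h u \<nu> 0] u h0 by blast
    then have "s \<le> v" using u s by auto
    then have "v = u" using v u by simp
    then show False using v \<open>h u \<noteq> \<nu>\<close> by simp
  qed
  then show ?thesis using s(1) by (intro that[of s]) auto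
qed

context regularized_flow
begin

lemma rad_lower_bound:
  assumes "sphere_solution F y" "r > 0" "s \<ge> 0"
  obtains c where "c > 0" "\<And>u. 0 \<le> u \<Longrightarrow> u \<le> s \<Longrightarrow> c \<le> rad y r u"
proof -
  obtain v where "v \<in> {0..s}" "\<And>u. u \<in> {0..s} \<Longrightarrow> rad y r v \<le> rad y r u"
    using continuous_attains_inf[of "{0..s}" "rad y r"] rad_continuous[OF assms(1)] assms(3) by auto
  then show ?thesis using that[of "rad y r v"] rad_pos[OF assms(2)] by auto
qed

lemma sing_field_eq_reg_field:
  assumes "0 < \<nu>" "\<nu> < norm x" shows "sing_field \<alpha> F x = reg_field \<alpha> F G \<nu> x"
  using assms by (simp add: sing_field_def reg_field_def)

lemma rescaled_field_eq: "rescaled_field \<alpha> F G = reg_field \<alpha> F G 1"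
  by (auto simp: rescaled_field_def reg_field_def fun_eq_iff)

lemma rescaled_field_eq_reg_field:
  assumes "0 < \<nu>" "\<nu> < 1" "norm x \<ge> 1" shows "rescaled_field \<alpha> F G x = reg_field \<alpha> F G \<nu> x"
proof (cases "norm x = 1")
  case True
  then show ?thesis using assms regularization_boundary[OF reg True]
    by (simp add: rescaled_field_def reg_field_def)
qed (use assms in \<open>auto simp: rescaled_field_def reg_field_def\<close>)

text \<open>Outside the unit ball the field of \<open>X\<close> coincides with
  \<open>reg_field\<close> for every smaller \<nu>. Taking \<nu> below the minimum of the polar
  curve makes \<open>tracking\<close> applicable without knowing in advance that this curve stays
  outside the unit ball.\<close>

lemma escape_tracking:
  assumes X: "global_solution (rescaled_field \<alpha> F G) X" and y: "sphere_solution F y" and r: "r > 0"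
    and X0: "X \<tau>0 = r *\<^sub>R y 0" and out: "\<And>\<tau>. \<tau> \<ge> \<tau>0 \<Longrightarrow> norm (X \<tau>) \<ge> 1" and s: "s \<ge> 0"
  shows "X (\<tau>0 + clock \<alpha> y r s) = rad y r s *\<^sub>R y s"
proof -
  obtain c where c: "c > 0" "\<And>u. 0 \<le> u \<Longrightarrow> u \<le> s \<Longrightarrow> c \<le> rad y r u"
    using rad_lower_bound[OF y r s] by blast
  define \<nu> where "\<nu> = min (1/2) c"
  have \<nu>: "\<nu> > 0" "\<nu> < 1" "\<nu> \<le> c" using c by (auto simp: \<nu>_def)
  show ?thesis
  proof (rule tracking[where X = X, OF \<nu>(1) y r s _ X0])
    fix \<tau> assume "\<tau>0 \<le> \<tau>" "\<tau> \<le> \<tau>0 + clock \<alpha> y r s"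
    then show "(X has_vector_derivative reg_field \<alpha> F G \<nu> (X \<tau>)) (at \<tau> within {\<tau>0..\<tau>0 + clock \<alpha> y r s})"
      using X rescaled_field_eq_reg_field[OF \<nu>(1,2) out]
      by (metis global_solution_def has_vector_derivative_at_within)
  next
    fix u assume "0 \<le> u" "u \<le> s"
    then show "\<nu> \<le> rad y r u" using c(2) \<nu>(3) by force
  qed
qed

text \<open>The space and time scalings combine to the factor \<nu> to the power - \<alpha>, which
  cancels the homogeneity of degree \<alpha> of the field.\<close>

lemma rescaled_solution:
  assumes x: "global_solution (reg_field \<alpha> F G \<nu>) x" and \<nu>: "\<nu> > 0"
  shows "global_solution (rescaled_field \<alpha> F G) (\<lambda>\<tau>. x (tb + \<nu> powr (1 - \<alpha>) * \<tau>) /\<^sub>R \<nu>)"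
  unfolding global_solution_def
proof
  fix \<tau>
  let ?z = "x (tb + \<nu> powr (1 - \<alpha>) * \<tau>)"
  have "((\<lambda>\<tau>. tb + \<nu> powr (1 - \<alpha>) * \<tau>) has_vector_derivative \<nu> powr (1 - \<alpha>)) (at \<tau>)"
    unfolding has_real_derivative_iff_has_vector_derivative[symmetric] by (auto intro!: derivative_eq_intros)
  from vector_diff_chain_at[OF this] x
  have "((\<lambda>\<tau>. x (tb + \<nu> powr (1 - \<alpha>) * \<tau>)) has_vector_derivative \<nu> powr (1 - \<alpha>) *\<^sub>R reg_field \<alpha> F G \<nu> ?z) (at \<tau>)"
    unfolding global_solution_def by (fastforce simp: o_def)
  from bounded_linear.has_vector_derivative[OF bounded_linear_scaleR_right this, of "inverse \<nu>"]
  have "((\<lambda>\<tau>. x (tb + \<nu> powr (1 - \<alpha>) * \<tau>) /\<^sub>R \<nu>) has_vector_derivative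
      inverse \<nu> *\<^sub>R \<nu> powr (1 - \<alpha>) *\<^sub>R reg_field \<alpha> F G \<nu> ?z) (at \<tau>)" .
  also have "inverse \<nu> *\<^sub>R \<nu> powr (1 - \<alpha>) *\<^sub>R reg_field \<alpha> F G \<nu> ?z = rescaled_field \<alpha> F G (?z /\<^sub>R \<nu>)"
  proof -
    have e: "inverse \<nu> * \<nu> powr (1 - \<alpha>) = \<nu> powr (- \<alpha>)"
      using \<nu> by (simp add: powr_diff powr_minus field_simps)
    show ?thesis
    proof (cases "norm ?z > \<nu>")
      case True
      have n: "norm (?z /\<^sub>R \<nu>) = norm ?z / \<nu>" using \<nu> by (simp add: divide_inverse_commute)
      have pw: "(norm ?z / \<nu>) powr \<alpha> = \<nu> powr (- \<alpha>) * norm ?z powr \<alpha>"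
        using \<nu> by (subst powr_divide) (auto simp: powr_minus divide_inverse_commute)
      have dir: "(?z /\<^sub>R \<nu>) /\<^sub>R norm (?z /\<^sub>R \<nu>) = ?z /\<^sub>R norm ?z" using \<nu> by simp
      have gt: "norm (?z /\<^sub>R \<nu>) > 1" unfolding n using True \<nu> by simp
      have "rescaled_field \<alpha> F G (?z /\<^sub>R \<nu>) = (norm ?z / \<nu>) powr \<alpha> *\<^sub>R F (?z /\<^sub>R norm ?z)"
        by (simp only: rescaled_field_def if_P[OF gt] dir) (simp only: n)
      moreover have "reg_field \<alpha> F G \<nu> ?z = norm ?z powr \<alpha> *\<^sub>R F (?z /\<^sub>R norm ?z)"
        using True by (simp add: reg_field_def)
      ultimately show ?thesis by (simp only: pw e[symmetric] scaleR_scaleR mult.assoc)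
    next
      case False
      have "\<nu> powr (- \<alpha>) * \<nu> powr \<alpha> = 1" using \<nu> by (simp flip: powr_add)
      then have "inverse \<nu> * (\<nu> powr (1 - \<alpha>) * \<nu> powr \<alpha>) = 1" by (simp only: e flip: mult.assoc)
      moreover have "\<not> norm (?z /\<^sub>R \<nu>) > 1" using \<nu> False by (simp add: field_simps)
      then have "rescaled_field \<alpha> F G (?z /\<^sub>R \<nu>) = G (?z /\<^sub>R \<nu>)"
        by (simp only: rescaled_field_def if_False)
      moreover have "reg_field \<alpha> F G \<nu> ?z = \<nu> powr \<alpha> *\<^sub>R G (?z /\<^sub>R \<nu>)"
        using False by (simp add: reg_field_def)
      ultimately show ?thesis by (simp only: scaleR_scaleR scaleR_one)
    qed
  qed
  finally show "((\<lambda>\<tau>. x (tb + \<nu> powr (1 - \<alpha>) * \<tau>) /\<^sub>R \<nu>) has_vector_derivative rescaled_field \<alpha> F G (?z /\<^sub>R \<nu>)) (at \<tau>)" .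
qed

end

section \<open>Collapse along the attracting fixed point and the entrance into the core\<close>

locale collapsing_solution = regularized_flow F L B G \<alpha>
  for F :: "'a::euclidean_space \<Rightarrow> 'a" and L B :: real and G \<alpha> +
  fixes ystar :: 'a and y :: "real \<Rightarrow> 'a" and r b :: real
  assumes y: "sphere_solution F y" and r: "r > 0" and ystar: "norm ystar = 1"
    and lim: "(y \<longlongrightarrow> ystar) at_top" and b: "Fr F ystar = - b" "b > 0"
begin

abbreviation "R \<equiv> rad y r"
abbreviation "\<Theta> \<equiv> clock \<alpha> y r"

lemma one_minus_alpha_pos: "1 - \<alpha> > 0" using alpha by simp

lemma Fr_limit: "((\<lambda>s. Fr F (y s)) \<longlongrightarrow> - b) at_top"
proof (rule Lim_transform)
  show "((\<lambda>s. Fr F ystar) \<longlongrightarrow> - b) at_top" by (simp add: b)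
  have "((\<lambda>s. L * norm (y s - ystar)) \<longlongrightarrow> L * norm (ystar - ystar)) at_top"
    by (intro tendsto_intros lim)
  then have "((\<lambda>s. L * norm (y s - ystar)) \<longlongrightarrow> 0) at_top" by simp
  then show "((\<lambda>s. Fr F (y s) - Fr F ystar) \<longlongrightarrow> 0) at_top"
    by (rule Lim_null_comparison[rotated])
       (use Fr_lip[OF solution_norm[OF y] ystar] in \<open>auto intro!: always_eventually\<close>)
qed

lemma rate_bounds:
  assumes "\<epsilon> > 0"
  obtains S where "S \<ge> 0" "\<And>s. s \<ge> S \<Longrightarrow> - (b + \<epsilon>) \<le> Fr F (y s) \<and> Fr F (y s) \<le> - (b - \<epsilon>)"
proof -
  have "\<forall>\<^sub>F s in at_top. dist (Fr F (y s)) (- b) < \<epsilon> \<and> s \<ge> 0"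
    using tendstoD[OF Fr_limit assms] by (intro eventually_conj eventually_ge_at_top)
  then obtain S where S: "\<And>s. s \<ge> S \<Longrightarrow> dist (Fr F (y s)) (- b) < \<epsilon> \<and> s \<ge> 0"
    by (auto simp: eventually_at_top_linorder)
  have "- (b + \<epsilon>) \<le> Fr F (y s) \<and> Fr F (y s) \<le> - (b - \<epsilon>)" if "s \<ge> S" for s
    using S[OF that] by (auto simp: dist_real_def)
  then show ?thesis using that[of S] S[of S] by auto
qed

lemma half_rate:
  obtains S where "S \<ge> 0" "\<And>s. s \<ge> S \<Longrightarrow> Fr F (y s) \<le> - (b / 2)"
proof -
  have "b / 2 > 0" using b(2) by simp
  then obtain S where S: "S \<ge> 0" "\<And>s. s \<ge> S \<Longrightarrow> - (b + b / 2) \<le> Fr F (y s) \<and> Fr F (y s) \<le> - (b - b / 2)"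
    by (rule rate_bounds) blast
  have "Fr F (y s) \<le> - (b / 2)" if "s \<ge> S" for s using S(2)[OF that] by simp
  with S(1) show ?thesis by (rule that)
qed

lemma R_tendsto: "(R \<longlongrightarrow> 0) at_top"
proof -
  obtain S where S: "S \<ge> 0" "\<And>s. s \<ge> S \<Longrightarrow> Fr F (y s) \<le> - (b / 2)"
    by (rule half_rate) blast
  have "Rint y s \<le> Rint y S - b / 2 * (s - S)" if "s \<ge> S" for s
  proof -
    have "Rint y s + b / 2 * s \<le> Rint y S + b / 2 * S"
    proof (rule DERIV_nonpos_imp_nonincreasing[OF that])
      fix x assume "S \<le> x" "x \<le> s"
      then have "Fr F (y x) + b / 2 \<le> 0" using S(2)[of x] by simp
      moreover have "((\<lambda>s. Rint y s + b / 2 * s) has_real_derivative Fr F (y x) + b / 2) (at x)"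
        by (auto intro!: derivative_eq_intros Rint_deriv y)
      ultimately show "\<exists>z. ((\<lambda>s. Rint y s + b / 2 * s) has_real_derivative z) (at x) \<and> z \<le> 0" by blast
    qed
    then show ?thesis by (simp add: right_diff_distrib)
  qed
  then have le: "\<forall>\<^sub>F s in at_top. norm (R s) \<le> r * exp (Rint y S - b / 2 * (s - S))"
    using r by (auto simp: eventually_at_top_linorder rad_def intro!: exI[of _ S])
  have "((\<lambda>s. r * exp (k - b / 2 * (s - S))) \<longlongrightarrow> 0) at_top" for k using b(2) by real_asymp
  from Lim_null_comparison[OF le this] show ?thesis .
qed

lemma R_powr_tendsto: "((\<lambda>s. R s powr (1 - \<alpha>)) \<longlongrightarrow> 0) at_top"
  using tendsto_powr'[OF R_tendsto tendsto_const[of "1 - \<alpha>"]] one_minus_alpha_pos rad_pos[OF r]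
  by (auto simp: less_imp_le)

lemma R_powr_deriv: "((\<lambda>s. R s powr (1 - \<alpha>)) has_real_derivative (1 - \<alpha>) * Fr F (y s) * R s powr (1 - \<alpha>)) (at s)"
proof -
  have eq: "R s powr (1 - \<alpha>) = exp ((1 - \<alpha>) * (ln r + Rint y s))" for s
    using r by (simp add: rad_def powr_def ln_mult)
  show ?thesis unfolding eq by (auto intro!: derivative_eq_intros Rint_deriv y)
qed

text \<open>The total time to collapse; \<open>blowup_time_eq\<close> identifies it with
  \<open>tb - t0\<close>.\<close>

definition "\<Omega> = (SUP s\<in>{0..}. \<Theta> s)"

text \<open>At a constant radial rate - c the remaining time to collapse is exactly
  \<open>R s powr (1 - \<alpha>) / ((1 - \<alpha>) * c)\<close>. Added to the elapsed time, it gives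
  a quantity that a one-sided bound on the rate makes monotone.\<close>

lemma clock_upper:
  assumes c: "c > 0" and S: "\<And>s. s \<ge> S \<Longrightarrow> Fr F (y s) \<le> - c" and s: "S \<le> s"
  shows "\<Theta> s + R s powr (1 - \<alpha>) / ((1 - \<alpha>) * c) \<le> \<Theta> S + R S powr (1 - \<alpha>) / ((1 - \<alpha>) * c)"
proof (rule DERIV_nonpos_imp_nonincreasing[OF s])
  fix x assume "S \<le> x" "x \<le> s"
  then have "Fr F (y x) / c \<le> - 1" using S[of x] c by (simp add: divide_simps)
  then have "(1 + Fr F (y x) / c) * R x powr (1 - \<alpha>) \<le> 0" by (simp add: mult_nonpos_nonneg)
  moreover have D: "((\<lambda>s. \<Theta> s + R s powr (1 - \<alpha>) / ((1 - \<alpha>) * c)) has_real_derivative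
      R x powr (1 - \<alpha>) + (1 - \<alpha>) * Fr F (y x) * R x powr (1 - \<alpha>) / ((1 - \<alpha>) * c)) (at x)"
    by (intro DERIV_add DERIV_cdivide clock_deriv y r R_powr_deriv)
  moreover have eq: "R x powr (1 - \<alpha>) + (1 - \<alpha>) * Fr F (y x) * R x powr (1 - \<alpha>) / ((1 - \<alpha>) * c) = (1 + Fr F (y x) / c) * R x powr (1 - \<alpha>)"
    using one_minus_alpha_pos c by (simp add: field_simps)
  ultimately show "\<exists>z. ((\<lambda>s. \<Theta> s + R s powr (1 - \<alpha>) / ((1 - \<alpha>) * c)) has_real_derivative z) (at x) \<and> z \<le> 0"
    using D unfolding eq by blast
qed

lemma clock_lower:
  assumes c: "c > 0" and S: "\<And>s. s \<ge> S \<Longrightarrow> - c \<le> Fr F (y s)" and s: "S \<le> s"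
  shows "\<Theta> S + R S powr (1 - \<alpha>) / ((1 - \<alpha>) * c) \<le> \<Theta> s + R s powr (1 - \<alpha>) / ((1 - \<alpha>) * c)"
proof (rule DERIV_nonneg_imp_nondecreasing[OF s])
  fix x assume "S \<le> x" "x \<le> s"
  then have "- 1 \<le> Fr F (y x) / c" using S[of x] c by (simp add: divide_simps)
  then have "0 \<le> (1 + Fr F (y x) / c) * R x powr (1 - \<alpha>)" by simp
  moreover have D: "((\<lambda>s. \<Theta> s + R s powr (1 - \<alpha>) / ((1 - \<alpha>) * c)) has_real_derivative
      R x powr (1 - \<alpha>) + (1 - \<alpha>) * Fr F (y x) * R x powr (1 - \<alpha>) / ((1 - \<alpha>) * c)) (at x)"
    by (intro DERIV_add DERIV_cdivide clock_deriv y r R_powr_deriv)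
  moreover have eq: "R x powr (1 - \<alpha>) + (1 - \<alpha>) * Fr F (y x) * R x powr (1 - \<alpha>) / ((1 - \<alpha>) * c) = (1 + Fr F (y x) / c) * R x powr (1 - \<alpha>)"
    using one_minus_alpha_pos c by (simp add: field_simps)
  ultimately show "\<exists>z. ((\<lambda>s. \<Theta> s + R s powr (1 - \<alpha>) / ((1 - \<alpha>) * c)) has_real_derivative z) (at x) \<and> 0 \<le> z"
    using D unfolding eq by blast
qed

lemma bdd_clock: "bdd_above (\<Theta> ` {0..})"
proof -
  obtain S where S: "S \<ge> 0" "\<And>s. s \<ge> S \<Longrightarrow> Fr F (y s) \<le> - (b / 2)"
    by (rule half_rate) blast
  define U where "U = \<Theta> S + R S powr (1 - \<alpha>) / ((1 - \<alpha>) * (b / 2))"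
  have late: "\<Theta> s \<le> U" if "s \<ge> S" for s
  proof -
    have "0 \<le> R s powr (1 - \<alpha>) / ((1 - \<alpha>) * (b / 2))" using one_minus_alpha_pos b(2) by simp
    then show ?thesis using clock_upper[OF _ S(2) that] b(2) by (simp add: U_def)
  qed
  have "\<Theta> s \<le> U" if "s \<ge> 0" for s
    using late[of "max s S"] clock_le[OF y r, of s "max s S" \<alpha>] by simp
  then show ?thesis by (auto simp: bdd_above_def)
qed

lemma clock_less_limit: "s \<ge> 0 \<Longrightarrow> \<Theta> s < \<Omega>"
proof -
  assume s: "s \<ge> 0"
  have "\<Theta> s < \<Theta> (s + 1)" by (rule clock_less[OF y r]) simp
  also have "\<Theta> (s + 1) \<le> \<Omega>" unfolding \<Omega>_def using s by (intro cSUP_upper bdd_clock) auto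
  finally show ?thesis .
qed

lemma clock_tendsto: "(\<Theta> \<longlongrightarrow> \<Omega>) at_top"
proof (rule order_tendstoI)
  fix c assume "c < \<Omega>"
  then obtain s where s: "s \<ge> 0" "c < \<Theta> s"
    unfolding \<Omega>_def by (subst (asm) less_cSUP_iff[OF _ bdd_clock]) auto
  have "c < \<Theta> u" if "u \<ge> s" for u using s clock_le[OF y r that, of \<alpha>] by simp
  then show "\<forall>\<^sub>F u in at_top. c < \<Theta> u" unfolding eventually_at_top_linorder by blast
next
  fix c assume c: "\<Omega> < c"
  show "\<forall>\<^sub>F u in at_top. \<Theta> u < c"
    using eventually_ge_at_top[of 0] by eventually_elim (use c clock_less_limit in force)
qed

lemma clock_surj:
  assumes "0 \<le> \<tau>" "\<tau> < \<Omega>" obtains s where "s \<ge> 0" "\<Theta> s = \<tau>"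
proof -
  have "\<forall>\<^sub>F s in at_top. \<tau> < \<Theta> s \<and> s \<ge> 0"
    using order_tendstoD(1)[OF clock_tendsto assms(2)] by (intro eventually_conj eventually_ge_at_top)
  then obtain s where "\<tau> < \<Theta> s" "s \<ge> 0" using eventually_happens'[OF trivial_limit_at_top_linorder] by blast
  then show ?thesis
    using IVT'[of \<Theta> 0 \<tau> s] assms(1) clock_continuous[OF y r] that by (auto simp: clock_0)
qed

text \<open>The remaining time in its natural unit; the limit is minus the entrance time
  \<open>tau_ent\<close>. The two clock bounds with rates \<open>b + \<epsilon>\<close> and
  \<open>b - \<epsilon>\<close> squeeze it.\<close>

lemma entrance_time_limit: "((\<lambda>s. (\<Omega> - \<Theta> s) / R s powr (1 - \<alpha>)) \<longlongrightarrow> 1 / ((1 - \<alpha>) * b)) at_top"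
proof -
  have lower: "1 / ((1 - \<alpha>) * (b + \<epsilon>)) \<le> (\<Omega> - \<Theta> S) / R S powr (1 - \<alpha>)"
    if \<epsilon>: "\<epsilon> > 0" and S: "\<And>s. s \<ge> S \<Longrightarrow> - (b + \<epsilon>) \<le> Fr F (y s)" for \<epsilon> S
  proof -
    have "\<Theta> S + R S powr (1 - \<alpha>) / ((1 - \<alpha>) * (b + \<epsilon>)) \<le> \<Omega> + 0 / ((1 - \<alpha>) * (b + \<epsilon>))"
    proof (rule tendsto_lowerbound)
      show "((\<lambda>s. \<Theta> s + R s powr (1 - \<alpha>) / ((1 - \<alpha>) * (b + \<epsilon>))) \<longlongrightarrow> \<Omega> + 0 / ((1 - \<alpha>) * (b + \<epsilon>))) at_top"
        using one_minus_alpha_pos b(2) \<epsilon>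
        by (intro tendsto_add tendsto_divide tendsto_const clock_tendsto R_powr_tendsto) auto
      show "\<forall>\<^sub>F s in at_top. \<Theta> S + R S powr (1 - \<alpha>) / ((1 - \<alpha>) * (b + \<epsilon>)) \<le> \<Theta> s + R s powr (1 - \<alpha>) / ((1 - \<alpha>) * (b + \<epsilon>))"
        using eventually_ge_at_top[of S] by eventually_elim (use b(2) \<epsilon> S in \<open>intro clock_lower; auto\<close>)
    qed simp
    then have "R S powr (1 - \<alpha>) * (1 / ((1 - \<alpha>) * (b + \<epsilon>))) \<le> \<Omega> - \<Theta> S" by simp
    then show ?thesis using rad_pos[OF r, of y S] by (subst pos_le_divide_eq) (auto simp: mult.commute)
  qed
  have upper: "(\<Omega> - \<Theta> S) / R S powr (1 - \<alpha>) \<le> 1 / ((1 - \<alpha>) * (b - \<epsilon>))"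
    if \<epsilon>: "\<epsilon> < b" and S: "\<And>s. s \<ge> S \<Longrightarrow> Fr F (y s) \<le> - (b - \<epsilon>)" for \<epsilon> S
  proof -
    have "\<Omega> + 0 / ((1 - \<alpha>) * (b - \<epsilon>)) \<le> \<Theta> S + R S powr (1 - \<alpha>) / ((1 - \<alpha>) * (b - \<epsilon>))"
    proof (rule tendsto_upperbound)
      show "((\<lambda>s. \<Theta> s + R s powr (1 - \<alpha>) / ((1 - \<alpha>) * (b - \<epsilon>))) \<longlongrightarrow> \<Omega> + 0 / ((1 - \<alpha>) * (b - \<epsilon>))) at_top"
        using one_minus_alpha_pos \<epsilon>
        by (intro tendsto_add tendsto_divide tendsto_const clock_tendsto R_powr_tendsto) auto
      show "\<forall>\<^sub>F s in at_top. \<Theta> s + R s powr (1 - \<alpha>) / ((1 - \<alpha>) * (b - \<epsilon>)) \<le> \<Theta> S + R S powr (1 - \<alpha>) / ((1 - \<alpha>) * (b - \<epsilon>))"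
        using eventually_ge_at_top[of S] by eventually_elim (use \<epsilon> S in \<open>intro clock_upper; auto\<close>)
    qed simp
    then have "\<Omega> - \<Theta> S \<le> R S powr (1 - \<alpha>) * (1 / ((1 - \<alpha>) * (b - \<epsilon>)))" by simp
    then show ?thesis using rad_pos[OF r, of y S] by (subst pos_divide_le_eq) (auto simp: mult.commute)
  qed
  have near: "\<forall>\<^sub>F s in at_top. 1 / ((1 - \<alpha>) * (b + \<epsilon>)) \<le> (\<Omega> - \<Theta> s) / R s powr (1 - \<alpha>) \<and>
      (\<Omega> - \<Theta> s) / R s powr (1 - \<alpha>) \<le> 1 / ((1 - \<alpha>) * (b - \<epsilon>))" if \<epsilon>: "0 < \<epsilon>" "\<epsilon> < b" for \<epsilon>
  proof -
    obtain S where S: "\<And>s. s \<ge> S \<Longrightarrow> - (b + \<epsilon>) \<le> Fr F (y s) \<and> Fr F (y s) \<le> - (b - \<epsilon>)"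
      using rate_bounds[OF \<epsilon>(1)] by blast
    show ?thesis
      using eventually_ge_at_top[of S]
      by eventually_elim (use S \<epsilon> in \<open>intro conjI lower upper; force\<close>)
  qed
  have lims: "((\<lambda>\<epsilon>. 1 / ((1 - \<alpha>) * (b + \<epsilon>))) \<longlongrightarrow> 1 / ((1 - \<alpha>) * (b + 0))) (at_right 0)"
    "((\<lambda>\<epsilon>. 1 / ((1 - \<alpha>) * (b - \<epsilon>))) \<longlongrightarrow> 1 / ((1 - \<alpha>) * (b - 0))) (at_right 0)"
    using one_minus_alpha_pos b(2) by (intro tendsto_intros; simp)+
  have small: "\<forall>\<^sub>F \<epsilon> in at_right 0. 0 < \<epsilon> \<and> \<epsilon> < b"
    using b(2) by (intro eventually_conj eventually_at_right_less) (auto simp: eventually_at_right)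
  show ?thesis
  proof (rule order_tendstoI)
    fix c assume c: "c < 1 / ((1 - \<alpha>) * b)"
    then have "\<forall>\<^sub>F \<epsilon> in at_right 0. c < 1 / ((1 - \<alpha>) * (b + \<epsilon>))" using order_tendstoD(1)[OF lims(1)] by simp
    from eventually_happens'[OF trivial_limit_at_right_real eventually_conj[OF this small]]
    obtain \<epsilon> where \<epsilon>: "c < 1 / ((1 - \<alpha>) * (b + \<epsilon>))" "0 < \<epsilon>" "\<epsilon> < b" by blast
    from near[OF \<epsilon>(2,3)] show "\<forall>\<^sub>F s in at_top. c < (\<Omega> - \<Theta> s) / R s powr (1 - \<alpha>)"
      by eventually_elim (use \<epsilon>(1) in linarith)
  next
    fix c assume c: "1 / ((1 - \<alpha>) * b) < c"
    then have "\<forall>\<^sub>F \<epsilon> in at_right 0. 1 / ((1 - \<alpha>) * (b - \<epsilon>)) < c" using order_tendstoD(2)[OF lims(2)] by simp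
    from eventually_happens'[OF trivial_limit_at_right_real eventually_conj[OF this small]]
    obtain \<epsilon> where \<epsilon>: "1 / ((1 - \<alpha>) * (b - \<epsilon>)) < c" "0 < \<epsilon>" "\<epsilon> < b" by blast
    from near[OF \<epsilon>(2,3)] show "\<forall>\<^sub>F s in at_top. (\<Omega> - \<Theta> s) / R s powr (1 - \<alpha>) < c"
      by eventually_elim (use \<epsilon>(1) in linarith)
  qed
qed

lemma incoming_tracking:
  assumes \<nu>: "\<nu> > 0" and x: "global_solution (reg_field \<alpha> F G \<nu>) x" "x t0 = r *\<^sub>R y 0"
    and s: "s \<ge> 0" and ge: "\<And>u. 0 \<le> u \<Longrightarrow> u \<le> s \<Longrightarrow> \<nu> \<le> R u"
  shows "x (t0 + \<Theta> s) = R s *\<^sub>R y s"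
  by (rule tracking[where X = x, OF \<nu> y r s _ x(2) ge])
     (use x(1) in \<open>auto simp: global_solution_def intro: has_vector_derivative_at_within\<close>)

lemma blowup_time_eq:
  assumes x\<nu>: "\<And>\<nu>. \<nu> > 0 \<Longrightarrow> global_solution (reg_field \<alpha> F G \<nu>) (x\<nu> \<nu>) \<and> x\<nu> \<nu> t0 = r *\<^sub>R y 0"
    and tb: "is_blowup_time \<alpha> F t0 (r *\<^sub>R y 0) tb"
  shows "tb = t0 + \<Omega>"
proof (rule antisym)
  \<comment> \<open>a regularized solution with small \<open>\<nu>\<close> is a nonzero solution of the singular system up to any earlier time\<close>
  show "t0 + \<Omega> \<le> tb"
  proof (rule ccontr)
    assume "\<not> t0 + \<Omega> \<le> tb"
    then have "\<forall>\<^sub>F s in at_top. tb - t0 < \<Theta> s \<and> s \<ge> 0"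
      using order_tendstoD(1)[OF clock_tendsto] by (intro eventually_conj eventually_ge_at_top) auto
    then obtain S where S: "tb - t0 < \<Theta> S" "S \<ge> 0"
      using eventually_happens'[OF trivial_limit_at_top_linorder] by blast
    obtain c where c: "c > 0" "\<And>u. 0 \<le> u \<Longrightarrow> u \<le> S \<Longrightarrow> c \<le> R u" using rad_lower_bound[OF y r S(2)] by blast
    define \<nu> where "\<nu> = c / 2"
    have \<nu>: "\<nu> > 0" "\<nu> < c" using c by (auto simp: \<nu>_def)
    note x = x\<nu>[OF \<nu>(1)]
    have "nonzero_solution \<alpha> F t0 (r *\<^sub>R y 0) (t0 + \<Theta> S) (x\<nu> \<nu>)"
      unfolding nonzero_solution_def
    proof (intro conjI ballI)
      show "x\<nu> \<nu> t0 = r *\<^sub>R y 0" using x by simp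
      fix t assume t: "t \<in> {t0..<t0 + \<Theta> S}"
      have "continuous_on {0..S} \<Theta>" by (rule clock_continuous[OF y r])
      then obtain s where s: "0 \<le> s" "s \<le> S" "\<Theta> s = t - t0"
        using IVT'[of \<Theta> 0 "t - t0" S] t S(2) by (auto simp: clock_0)
      have "x\<nu> \<nu> (t0 + \<Theta> s) = R s *\<^sub>R y s"
      proof (rule incoming_tracking[OF \<nu>(1) _ _ s(1)])
        show "\<nu> \<le> R u" if "0 \<le> u" "u \<le> s" for u using c(2)[of u] that s \<nu> by simp
      qed (use x in auto)
      then have "norm (x\<nu> \<nu> t) = R s" using s(3) solution_norm[OF y] rad_pos[OF r, of y s] by simp
      then have n: "norm (x\<nu> \<nu> t) > \<nu>" using c(2)[of s] s \<nu> by simp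
      then show "x\<nu> \<nu> t \<noteq> 0" using \<nu> by auto
      show "(x\<nu> \<nu> has_vector_derivative sing_field \<alpha> F (x\<nu> \<nu> t)) (at t within {t0..<t0 + \<Theta> S})"
        unfolding sing_field_eq_reg_field[OF \<nu>(1) n]
        using x by (auto simp: global_solution_def intro: has_vector_derivative_at_within)
    qed
    moreover have "tb < t0 + \<Theta> S" using S by simp
    ultimately show False using tb unfolding is_blowup_time_def by blast
  qed
  \<comment> \<open>A nonzero solution living longer has a positive minimum of its norm on the
    compact interval up to \<open>t0 + \<Omega>\<close>. For \<nu> below this minimum the singular
    and regularized fields agree along it, so \<open>tracking\<close> makes its norm follow
    \<open>R\<close>, which tends to 0.\<close>
  show "tb \<le> t0 + \<Omega>"
  proof (rule ccontr)
    assume gt: "\<not> tb \<le> t0 + \<Omega>"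
    obtain x where "nonzero_solution \<alpha> F t0 (r *\<^sub>R y 0) tb x" using tb unfolding is_blowup_time_def by blast
    then have x: "x t0 = r *\<^sub>R y 0" "\<And>t. t0 \<le> t \<Longrightarrow> t < tb \<Longrightarrow> x t \<noteq> 0"
      "\<And>t. t0 \<le> t \<Longrightarrow> t < tb \<Longrightarrow> (x has_vector_derivative sing_field \<alpha> F (x t)) (at t within {t0..<tb})"
      unfolding nonzero_solution_def by auto
    define t1 where "t1 = t0 + \<Omega>"
    have t1: "t0 \<le> t1" "t1 < tb" using gt clock_less_limit[of 0] by (auto simp: t1_def clock_0)
    have cx: "continuous_on {t0..t1} x"
      unfolding continuous_on_eq_continuous_within
    proof
      fix t assume "t \<in> {t0..t1}"
      then have "continuous (at t within {t0..<tb}) x"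
        using t1 by (intro has_vector_derivative_continuous[OF x(3)]) auto
      then show "continuous (at t within {t0..t1}) x" by (rule continuous_within_subset) (use t1 in auto)
    qed
    have "continuous_on {t0..t1} (\<lambda>t. norm (x t))" by (intro continuous_intros cx)
    then obtain tm where tm: "tm \<in> {t0..t1}" "\<And>t. t \<in> {t0..t1} \<Longrightarrow> norm (x tm) \<le> norm (x t)"
      using continuous_attains_inf[of "{t0..t1}" "\<lambda>t. norm (x t)"] t1 by auto
    have xm: "norm (x tm) > 0" using x(2)[of tm] tm t1 by auto
    have eq: "x (t0 + \<Theta> s) = R s *\<^sub>R y s" if s: "s \<ge> 0" for s
    proof -
      obtain c where c: "c > 0" "\<And>u. 0 \<le> u \<Longrightarrow> u \<le> s \<Longrightarrow> c \<le> R u" using rad_lower_bound[OF y r s] by blast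
      define \<nu> where "\<nu> = min c (norm (x tm) / 2)"
      have \<nu>: "\<nu> > 0" "\<nu> \<le> c" "\<nu> < norm (x tm)" using c xm by (auto simp: \<nu>_def min_less_iff_disj)
      show ?thesis
      proof (rule tracking[where X = x, OF \<nu>(1) y r s _ x(1)])
        fix t assume t: "t0 \<le> t" "t \<le> t0 + \<Theta> s"
        then have t': "t \<le> t1" using clock_less_limit[OF s] by (simp add: t1_def)
        then have "\<nu> < norm (x t)" using tm(2)[of t] t \<nu> by simp
        then have "(x has_vector_derivative reg_field \<alpha> F G \<nu> (x t)) (at t within {t0..<tb})"
          using x(3)[of t] t t' t1 sing_field_eq_reg_field[OF \<nu>(1)] by simp
        then show "(x has_vector_derivative reg_field \<alpha> F G \<nu> (x t)) (at t within {t0..t0 + \<Theta> s})"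
          by (rule has_vector_derivative_within_subset) (use clock_less_limit[OF s] t1 in \<open>auto simp: t1_def\<close>)
      next
        show "\<nu> \<le> R u" if "0 \<le> u" "u \<le> s" for u using c(2)[OF that] \<nu> by simp
      qed
    qed
    obtain s where s: "s \<ge> 0" "R s < norm (x tm)"
      using eventually_happens'[OF trivial_limit_at_top_linorder
          eventually_conj[OF order_tendstoD(2)[OF R_tendsto xm] eventually_ge_at_top[of 0]]] by blast
    have "norm (x tm) \<le> norm (x (t0 + \<Theta> s))"
      using clock_less_limit[OF s(1)] clock_le[OF y r s(1), of \<alpha>] by (intro tm(2)) (simp add: t1_def clock_0)
    also have "\<dots> = R s" using eq[OF s(1)] solution_norm[OF y] rad_pos[OF r, of y s] by simp
    finally show False using s(2) by simp
  qed
qed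

text \<open>When the radius first equals \<open>\<nu> n\<close>, the rescaled trajectory sits at
  \<open>y (s n)\<close>, close to \<open>ystar\<close>, at a rescaled time close to the entrance
  time. From there Gronwall over a bounded time compares it with \<open>X\<close>.\<close>

lemma rescaled_convergence:
  assumes x\<nu>: "\<And>\<nu>. \<nu> > 0 \<Longrightarrow> global_solution (reg_field \<alpha> F G \<nu>) (x\<nu> \<nu>) \<and> x\<nu> \<nu> t0 = r *\<^sub>R y 0"
    and tb: "tb = t0 + \<Omega>" and \<nu>: "\<And>n::nat. \<nu> n > 0" "\<nu> \<longlonglongrightarrow> 0"
    and X: "global_solution (rescaled_field \<alpha> F G) X" "X (- 1 / ((1 - \<alpha>) * b)) = ystar"
    and \<tau>: "\<tau> > - 1 / ((1 - \<alpha>) * b)"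
  shows "(\<lambda>n. x\<nu> (\<nu> n) (tb + \<nu> n powr (1 - \<alpha>) * \<tau>) /\<^sub>R \<nu> n) \<longlonglongrightarrow> X \<tau>"
proof -
  define Xn where "Xn n \<tau> = x\<nu> (\<nu> n) (tb + \<nu> n powr (1 - \<alpha>) * \<tau>) /\<^sub>R \<nu> n" for n \<tau>
  have Xn: "global_solution (rescaled_field \<alpha> F G) (Xn n)" for n
    using rescaled_solution[of "\<nu> n" "x\<nu> (\<nu> n)"] x\<nu>[OF \<nu>(1)] \<nu>(1) by (simp add: Xn_def [abs_def])
  \<comment> \<open>The guard takes care of the finitely many \<open>n\<close> for which the start
    already lies inside the core.\<close>
  have "\<exists>s. \<nu> n \<le> r \<longrightarrow> 0 \<le> s \<and> R s = \<nu> n \<and> (\<forall>u. 0 \<le> u \<longrightarrow> u \<le> s \<longrightarrow> \<nu> n \<le> R u)" for n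
  proof (cases "\<nu> n \<le> r")
    case True
    obtain S where S: "R S < \<nu> n" "S \<ge> 0"
      using eventually_happens'[OF trivial_limit_at_top_linorder
          eventually_conj[OF order_tendstoD(2)[OF R_tendsto \<nu>(1)[of n]] eventually_ge_at_top[of 0]]] by blast
    show ?thesis
      by (rule first_crossing[OF rad_continuous[OF y] S(2), of "\<nu> n" r]) (use True S rad_0 in auto)
  qed simp
  then obtain s where s: "\<And>n. \<nu> n \<le> r \<Longrightarrow> 0 \<le> s n" "\<And>n. \<nu> n \<le> r \<Longrightarrow> R (s n) = \<nu> n"
    "\<And>n u. \<nu> n \<le> r \<Longrightarrow> 0 \<le> u \<Longrightarrow> u \<le> s n \<Longrightarrow> \<nu> n \<le> R u" by metis
  have small: "\<forall>\<^sub>F n in sequentially. \<nu> n \<le> c" if "c > 0" for c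
    using order_tendstoD(2)[OF \<nu>(2) that] by (auto elim: eventually_mono)
  have s_top: "filterlim s at_top sequentially"
    unfolding filterlim_at_top
  proof
    fix S :: real
    obtain c where c: "c > 0" "\<And>u. 0 \<le> u \<Longrightarrow> u \<le> max S 0 \<Longrightarrow> c \<le> R u"
      using rad_lower_bound[OF y r, of "max S 0"] by auto
    from small[OF r] small[of "c / 2"] c(1)
    have "\<forall>\<^sub>F n in sequentially. \<nu> n \<le> r \<and> \<nu> n \<le> c / 2" by (intro eventually_conj) auto
    then show "\<forall>\<^sub>F n in sequentially. S \<le> s n"
    proof eventually_elim
      fix n assume n: "\<nu> n \<le> r \<and> \<nu> n \<le> c / 2"
      then have "R (s n) < c" using s(2)[of n] c(1) by simp
      then show "S \<le> s n" using c(2)[of "s n"] s(1)[of n] n by force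
    qed
  qed
  \<comment> \<open>Since \<open>R (s n) = \<nu> n\<close>, this is the rescaled time of entrance,
    measured from the blowup time.\<close>
  define \<tau>n where "\<tau>n n = - ((\<Omega> - \<Theta> (s n)) / R (s n) powr (1 - \<alpha>))" for n
  have \<tau>n: "\<tau>n \<longlonglongrightarrow> - 1 / ((1 - \<alpha>) * b)"
    using tendsto_minus[OF filterlim_compose[OF entrance_time_limit s_top]] by (simp add: \<tau>n_def [abs_def])
  have "\<forall>\<^sub>F n in sequentially. y (s n) = Xn n (\<tau>n n)"
    using small[OF r]
  proof eventually_elim
    fix n assume n: "\<nu> n \<le> r"
    have "x\<nu> (\<nu> n) (t0 + \<Theta> (s n)) = R (s n) *\<^sub>R y (s n)"
      using s(1,3)[OF n] x\<nu>[OF \<nu>(1)] \<nu>(1) by (intro incoming_tracking[of "\<nu> n"]) auto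
    moreover have "tb + \<nu> n powr (1 - \<alpha>) * \<tau>n n = t0 + \<Theta> (s n)"
      using \<nu>(1)[of n] by (simp add: \<tau>n_def s(2)[OF n] tb)
    ultimately show "y (s n) = Xn n (\<tau>n n)" using \<nu>(1)[of n] by (simp add: Xn_def s(2)[OF n])
  qed
  then have 1: "(\<lambda>n. Xn n (\<tau>n n)) \<longlonglongrightarrow> ystar"
    by (rule Lim_transform_eventually[OF filterlim_compose[OF lim s_top]])
  have "isCont X (- 1 / ((1 - \<alpha>) * b))"
    using X(1) has_vector_derivative_continuous unfolding global_solution_def by blast
  from isCont_tendsto_compose[OF this \<tau>n] have "(\<lambda>n. X (\<tau>n n)) \<longlonglongrightarrow> ystar" unfolding X(2) .
  from tendsto_norm[OF tendsto_diff[OF 1 this]]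
  have 2: "(\<lambda>n. norm (Xn n (\<tau>n n) - X (\<tau>n n))) \<longlonglongrightarrow> 0" by simp
  obtain K where K: "K \<ge> 0" "\<And>x z. norm (rescaled_field \<alpha> F G x - rescaled_field \<alpha> F G z) \<le> K * norm (x - z)"
    using reg_field_lipschitz[OF alpha reg zero_less_one] unfolding rescaled_field_eq by blast
  have "(\<lambda>n. Xn n \<tau> - X \<tau>) \<longlonglongrightarrow> 0"
  proof (rule Lim_null_comparison)
    have "(\<lambda>n. norm (Xn n (\<tau>n n) - X (\<tau>n n)) * exp (K * (\<tau> - \<tau>n n))) \<longlonglongrightarrow> 0 * exp (K * (\<tau> - (- 1 / ((1 - \<alpha>) * b))))"
      by (intro tendsto_intros 2 \<tau>n)
    then show "(\<lambda>n. norm (Xn n (\<tau>n n) - X (\<tau>n n)) * exp (K * (\<tau> - \<tau>n n))) \<longlonglongrightarrow> 0" by simp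
    show "\<forall>\<^sub>F n in sequentially. norm (Xn n \<tau> - X \<tau>) \<le> norm (Xn n (\<tau>n n) - X (\<tau>n n)) * exp (K * (\<tau> - \<tau>n n))"
      using order_tendstoD(2)[OF \<tau>n \<tau>]
    proof eventually_elim
      fix n assume "\<tau>n n < \<tau>"
      then show "norm (Xn n \<tau> - X \<tau>) \<le> norm (Xn n (\<tau>n n) - X (\<tau>n n)) * exp (K * (\<tau> - \<tau>n n))"
        using Xn[of n] X(1) K
        by (intro ode_lipschitz_diff[where f = "\<lambda>_. rescaled_field \<alpha> F G"])
           (auto simp: global_solution_def intro: has_vector_derivative_at_within)
    qed
  qed
  then show ?thesis unfolding Xn_def by (rule LIM_zero_cancel)
qed

text \<open>The sequence is eventually constant: once \<open>\<nu> n\<close> is below the minimal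
  radius up to time \<open>t\<close>, the trajectory is the polar curve.\<close>

lemma before_blowup_convergence:
  assumes x\<nu>: "\<And>\<nu>. \<nu> > 0 \<Longrightarrow> global_solution (reg_field \<alpha> F G \<nu>) (x\<nu> \<nu>) \<and> x\<nu> \<nu> t0 = r *\<^sub>R y 0"
    and \<nu>: "\<And>n::nat. \<nu> n > 0" "\<nu> \<longlonglongrightarrow> 0" and t: "t0 \<le> t" "t < t0 + \<Omega>"
  shows "convergent (\<lambda>n. x\<nu> (\<nu> n) t)"
proof -
  obtain s where s: "s \<ge> 0" "\<Theta> s = t - t0" using clock_surj[of "t - t0"] t by auto
  obtain c where c: "c > 0" "\<And>u. 0 \<le> u \<Longrightarrow> u \<le> s \<Longrightarrow> c \<le> R u" using rad_lower_bound[OF y r s(1)] by blast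
  have "\<forall>\<^sub>F n in sequentially. R s *\<^sub>R y s = x\<nu> (\<nu> n) t"
    using order_tendstoD(2)[OF \<nu>(2) c(1)]
  proof eventually_elim
    fix n assume n: "\<nu> n < c"
    have "x\<nu> (\<nu> n) (t0 + \<Theta> s) = R s *\<^sub>R y s"
    proof (rule incoming_tracking[OF \<nu>(1)[of n] _ _ s(1)])
      show "\<nu> n \<le> R u" if "0 \<le> u" "u \<le> s" for u using c(2)[OF that] n by simp
    qed (use x\<nu>[OF \<nu>(1)[of n]] in auto)
    then show "R s *\<^sub>R y s = x\<nu> (\<nu> n) t" by (simp add: s(2))
  qed
  then have "(\<lambda>n. x\<nu> (\<nu> n) t) \<longlonglongrightarrow> R s *\<^sub>R y s" by (rule Lim_transform_eventually[OF tendsto_const])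
  then show ?thesis by (auto simp: convergent_def)
qed

end

section \<open>Continuation after blowup\<close>

theorem corollary2:
  fixes \<alpha> T \<tau>esc :: real
    and F G :: "'a::euclidean_space \<Rightarrow> 'a"
    and ystar :: 'a
    and X Yp :: "real \<Rightarrow> 'a"
  assumes "\<alpha> < 1"
    and "C1_on_sphere F"
    and "regularization \<alpha> F G"
    and "attractor F {ystar}"
    and "Fr F ystar < 0"
    and "global_solution (rescaled_field \<alpha> F G) X"
    and "X (tau_ent \<alpha> F ystar) = ystar"
    and "is_escape_time (tau_ent \<alpha> F ystar) X \<tau>esc"
    and "exponentially_stable_cycle F Yp T"
    and "X \<tau>esc \<in> basin F (Yp ` {0..<T})"
    and "mean_Fr F Yp T > 0"
  shows "(\<forall>u. Xp_fun \<alpha> F Yp (u + T * mean_Fr F Yp T) = Xp_fun \<alpha> F Yp u) \<and>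
    (\<exists>c::real. \<forall>(t0::real) (r0::real) (y0::'a) (tb::real) (x\<nu> :: real \<Rightarrow> real \<Rightarrow> 'a).
       r0 > 0 \<and> y0 \<in> basin F {ystar} \<and>
       (\<forall>\<nu>>0. global_solution (reg_field \<alpha> F G \<nu>) (x\<nu> \<nu>) \<and> x\<nu> \<nu> t0 = r0 *\<^sub>R y0) \<and>
       is_blowup_time \<alpha> F t0 (r0 *\<^sub>R y0) tb \<longrightarrow>
       (\<forall>chi::real. \<exists>x :: real \<Rightarrow> 'a.
          (\<forall>t\<ge>t0. (\<lambda>n::nat. x\<nu> (exp (- T * mean_Fr F Yp T * real n + chi)) t) \<longlonglongrightarrow> x t) \<and>
          (\<forall>t>tb. x t = (t - tb) powr (1 / (1 - \<alpha>)) *\<^sub>R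
             Xp_fun \<alpha> F Yp (ln ((t - tb) powr (1 / (1 - \<alpha>))) + (c - chi)))))"
proof -
  note \<alpha> = assms(1) and reg = assms(3) and b = assms(5) and X = assms(6)
  obtain L B where "sphere_C1_flow F L B"
    using regularization_sphere_C1_flow[OF \<alpha> reg] .
  then interpret growing_cycle F L B Yp T \<alpha>
    by (intro growing_cycle.intro stable_cycle.intro stable_cycle_axioms.intro growing_cycle_axioms.intro assms)
  interpret regularized_flow F L B G \<alpha>
    by (intro regularized_flow.intro regularized_flow_axioms.intro sphere_flow_axioms assms)
  have ystar: "norm ystar = 1" using assms(4) by (simp add: attractor_def)
  define \<tau>ent where "\<tau>ent = - 1 / ((1 - \<alpha>) * - Fr F ystar)"
  have ent: "tau_ent \<alpha> F ystar = \<tau>ent"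
    by (simp add: tau_ent_def \<tau>ent_def algebra_simps)
  have ent_neg: "\<tau>ent < 0" using mult_pos_neg[of "1 - \<alpha>" "Fr F ystar"] b \<alpha> by (simp add: \<tau>ent_def divide_simps)
  have esc: "\<tau>ent < \<tau>esc" "norm (X \<tau>esc) = 1" and out: "\<And>\<tau>. \<tau> > \<tau>esc \<Longrightarrow> norm (X \<tau>) > 1"
    using assms(8) by (auto simp: is_escape_time_def ent)
  have out': "norm (X \<tau>) \<ge> 1" if "\<tau> \<ge> \<tau>esc" for \<tau> using esc(2) out[of \<tau>] that by (cases "\<tau> = \<tau>esc") auto
  obtain ye \<theta> C \<kappa> where ye: "sphere_solution F ye" "ye 0 = X \<tau>esc" and \<kappa>: "\<kappa> > 0"
    and ph: "\<And>s. s \<ge> 0 \<Longrightarrow> norm (ye s - Yp (s + \<theta>)) \<le> C * exp (- \<kappa> * s)"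
    by (rule basin_phase[OF assms(10)]) blast
  \<comment> \<open>At the escape itself the radius is exactly 1, and nearby trajectories could
    re-enter the core. Restarting one unit of sphere time later leaves a margin.\<close>
  define \<tau>1 where "\<tau>1 = \<tau>esc + clock \<alpha> ye 1 1"
  define r1 where "r1 = rad ye 1 1"
  define y1 where "y1 s = ye (1 + s)" for s
  have \<tau>1: "\<tau>1 > \<tau>esc" using clock_less[OF ye(1) zero_less_one zero_less_one, of \<alpha>] by (simp add: \<tau>1_def clock_0)
  have r1: "r1 > 0" by (simp add: r1_def rad_pos)
  have y1: "sphere_solution F y1" unfolding y1_def [abs_def] by (rule solution_shift[OF ye(1)])
  have X1: "X \<tau>1 = r1 *\<^sub>R y1 0"
    unfolding \<tau>1_def r1_def y1_def using ye(2) out'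
    by (simp add: escape_tracking[OF X ye(1) zero_less_one])
  have ph1: "norm (y1 s - Yp (s + (\<theta> + 1))) \<le> (C * exp (- \<kappa>)) * exp (- \<kappa> * s)" if "s \<ge> 0" for s
    using ph[of "1 + s"] that by (simp add: y1_def algebra_simps flip: exp_add)
  obtain K where K: "((\<lambda>s. Rint y1 s - J (s + (\<theta> + 1))) \<longlongrightarrow> K) at_top"
    using phase_limit[OF y1 \<kappa> ph1] .
  interpret E: escaping_solution F L B Yp T \<alpha> y1 r1 "\<theta> + 1" "C * exp (- \<kappa>)" \<kappa> K
    by unfold_locales (fact y1 r1 \<kappa> ph1 K)+
  have track1: "X (\<tau>1 + clock \<alpha> y1 r1 s) = rad y1 r1 s *\<^sub>R y1 s" if "s \<ge> 0" for s
    using out' \<tau>1 that by (intro escape_tracking[OF X y1 r1 X1]) auto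
  have rad1: "rad y1 r1 s > 1" if "s \<ge> 0" for s
  proof -
    have "\<tau>esc < \<tau>1 + clock \<alpha> y1 r1 s" using \<tau>1 clock_le[OF y1 r1 that, of \<alpha>] by (simp add: clock_0)
    from out[OF this] show ?thesis
      using rad_pos[OF r1, of y1 s] solution_norm[OF y1] by (simp add: track1[OF that])
  qed
  \<comment> \<open>The margin has to be uniform in \<open>s\<close>: growth of the radius covers
    late times, compactness the rest.\<close>
  obtain \<rho> where \<rho>: "\<rho> > 1" "\<And>s. s \<ge> 0 \<Longrightarrow> \<rho> \<le> rad y1 r1 s"
  proof -
    have "\<forall>\<^sub>F s in at_top. 2 \<le> rad y1 r1 s" using E.rad_at_top by (simp add: filterlim_at_top)
    then obtain S where S: "\<And>s. s \<ge> S \<Longrightarrow> 2 \<le> rad y1 r1 s" by (auto simp: eventually_at_top_linorder)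
    obtain v where v: "v \<in> {0..max S 0}" "\<And>s. s \<in> {0..max S 0} \<Longrightarrow> rad y1 r1 v \<le> rad y1 r1 s"
      using continuous_attains_inf[of "{0..max S 0}" "rad y1 r1"] rad_continuous[OF y1] by auto
    have "min 2 (rad y1 r1 v) \<le> rad y1 r1 s" if "s \<ge> 0" for s
      using S[of s] v(2)[of s] that by (cases "s \<ge> S") auto
    moreover have "min 2 (rad y1 r1 v) > 1" using rad1[of v] v(1) by simp
    ultimately show ?thesis using that by blast
  qed
  have Tm: "T * mean_Fr F Yp T = m" by (rule T_mean)
  show ?thesis
    unfolding Tm
  \<comment> \<open>\<open>E.lk\<close> is built from \<open>X\<close> and the cycle, so the
    constant can be fixed before the initial data and \<open>chi\<close>.\<close>
  proof (intro conjI allI exI[of _ "- E.lk"] impI)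
    show "Xp_fun \<alpha> F Yp (u + m) = Xp_fun \<alpha> F Yp u" for u by (rule Xp_periodic)
    fix t0 r0 :: real and y0 :: 'a and tb :: real and x\<nu> :: "real \<Rightarrow> real \<Rightarrow> 'a" and chi :: real
    assume *: "r0 > 0 \<and> y0 \<in> basin F {ystar} \<and>
       (\<forall>\<nu>>0. global_solution (reg_field \<alpha> F G \<nu>) (x\<nu> \<nu>) \<and> x\<nu> \<nu> t0 = r0 *\<^sub>R y0) \<and>
       is_blowup_time \<alpha> F t0 (r0 *\<^sub>R y0) tb"
    then obtain y where y: "sphere_solution F y" "y 0 = y0" and inf: "((\<lambda>s. infdist (y s) {ystar}) \<longlongrightarrow> 0) at_top"
      unfolding basin_def by blast
    have "(y \<longlongrightarrow> ystar) at_top" using inf by (simp add: tendsto_dist_iff[of y])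
    then interpret C: collapsing_solution F L B G \<alpha> ystar y r0 "- Fr F ystar"
      using * by unfold_locales (use y b ystar in auto)
    have x\<nu>: "global_solution (reg_field \<alpha> F G \<nu>) (x\<nu> \<nu>) \<and> x\<nu> \<nu> t0 = r0 *\<^sub>R y 0" if "\<nu> > 0" for \<nu>
      using * that y(2) by blast
    have tb: "tb = t0 + C.\<Omega>" using C.blowup_time_eq[of x\<nu> t0 tb] x\<nu> * y(2) by blast
    define \<nu> where "\<nu> n = exp (chi - real n * m)" for n
    have \<nu>_eq: "exp (- T * mean_Fr F Yp T * real n + chi) = \<nu> n" for n
      using Tm by (simp add: \<nu>_def mult.commute)
    have \<nu>_pos: "\<nu> n > 0" for n by (simp add: \<nu>_def)
    have \<nu>_lim: "\<nu> \<longlonglongrightarrow> 0"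
    proof -
      have "(\<lambda>n. exp (chi - real n * c)) \<longlonglongrightarrow> 0" if "c > 0" for c using that by real_asymp
      then show ?thesis using m_pos by (simp add: \<nu>_def [abs_def])
    qed
    define Xn where "Xn n \<tau> = x\<nu> (\<nu> n) (tb + \<nu> n powr (1 - \<alpha>) * \<tau>) /\<^sub>R \<nu> n" for n \<tau>
    have Xn_lim: "(\<lambda>n. Xn n \<tau>) \<longlonglongrightarrow> X \<tau>" if "\<tau> > \<tau>ent" for \<tau>
      unfolding Xn_def
      by (rule C.rescaled_convergence[OF x\<nu> tb \<nu>_pos \<nu>_lim X]) (use that assms(7) ent in \<open>auto simp: \<tau>ent_def\<close>)
    have Xn_sol: "global_solution (reg_field \<alpha> F G 1) (Xn n)" for n
      using rescaled_solution[of "\<nu> n" "x\<nu> (\<nu> n)" tb] x\<nu>[OF \<nu>_pos] \<nu>_pos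
      by (simp add: Xn_def [abs_def] rescaled_field_eq)
    \<comment> \<open>The time \<open>tb\<close> is the rescaled time 0 for every \<open>n\<close>,
      which lies after the entrance; the rescaled position converges and the factor
      \<open>\<nu> n\<close> sends it to 0.\<close>
    have at_tb: "(\<lambda>n. x\<nu> (\<nu> n) tb) \<longlonglongrightarrow> 0"
    proof -
      have "(\<lambda>n. \<nu> n *\<^sub>R Xn n 0) \<longlonglongrightarrow> 0 *\<^sub>R X 0" by (intro tendsto_scaleR \<nu>_lim Xn_lim ent_neg)
      then show ?thesis using \<nu>_pos by (simp add: Xn_def less_imp_neq[symmetric])
    qed
    have conv: "convergent (\<lambda>n. x\<nu> (\<nu> n) t)" if "t0 \<le> t" "t \<le> tb" for t
    proof (cases "t = tb")
      case True
      then show ?thesis using at_tb by (auto simp: convergent_def)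
    next
      case False
      then show ?thesis using that tb by (intro C.before_blowup_convergence[OF x\<nu> \<nu>_pos \<nu>_lim]) auto
    qed
    define prof where "prof t = (t - tb) powr (1 / (1 - \<alpha>)) *\<^sub>R
             Xp_fun \<alpha> F Yp (ln ((t - tb) powr (1 / (1 - \<alpha>))) + (- E.lk - chi))" for t
    have main: "(\<lambda>n. x\<nu> (\<nu> n) t) \<longlonglongrightarrow> prof t" if t: "t > tb" for t
    proof -
      define a where "a = t - tb"
      have a: "a > 0" using t by (simp add: a_def)
      define z where "z n = Xn n \<tau>1" for n
      have z: "z \<longlonglongrightarrow> r1 *\<^sub>R y1 0" using Xn_lim[of \<tau>1] \<tau>1 esc(1) by (simp add: z_def [abs_def] X1)
      define rr where "rr n = norm (z n)" for n
      have rr: "rr \<longlonglongrightarrow> r1"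
        using tendsto_norm[OF z] r1 solution_norm[OF y1] by (simp add: rr_def [abs_def])
      have rr_pos: "\<forall>\<^sub>F n in sequentially. rr n > 0" by (rule order_tendstoD(1)[OF rr r1])
      \<comment> \<open>For the finitely many \<open>n\<close> with \<open>rr n = 0\<close> an
        arbitrary solution serves as default.\<close>
      have "\<exists>y. sphere_solution F y \<and> (rr n > 0 \<longrightarrow> y 0 = z n /\<^sub>R rr n)" for n
      proof (cases "rr n > 0")
        case True
        then have "norm (z n /\<^sub>R rr n) = 1" by (simp add: rr_def)
        then show ?thesis using sphere_solution_exists by metis
      qed (use y1 in auto)
      then obtain yy where yy: "\<And>n. sphere_solution F (yy n)" "\<And>n. rr n > 0 \<Longrightarrow> yy n 0 = z n /\<^sub>R rr n" by metis
      have yy0: "(\<lambda>n. yy n 0) \<longlonglongrightarrow> y1 0"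
      proof (rule Lim_transform_eventually)
        have "(\<lambda>n. z n /\<^sub>R rr n) \<longlonglongrightarrow> (r1 *\<^sub>R y1 0) /\<^sub>R r1" using r1 by (intro tendsto_intros z rr) auto
        then show "(\<lambda>n. z n /\<^sub>R rr n) \<longlonglongrightarrow> y1 0" using r1 by simp
        show "\<forall>\<^sub>F n in sequentially. z n /\<^sub>R rr n = yy n 0" using rr_pos by eventually_elim (simp add: yy)
      qed
      \<comment> \<open>The rescaled time belonging to \<open>t\<close>. It tends to infinity, so
        the convergence \<open>Xn_lim\<close> is used only at the fixed time
        \<open>\<tau>1\<close>.\<close>
      define \<tau>n where "\<tau>n n = a * exp (\<beta> * (real n * m - chi))" for n
      have \<tau>n_pos: "\<tau>n n > 0" for n using a by (simp add: \<tau>n_def)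
      have \<tau>n_top: "filterlim \<tau>n at_top sequentially"
      proof -
        have "filterlim (\<lambda>n. a * exp (k * (real n * c - chi))) at_top sequentially" if "k > 0" "c > 0" for k c
          using that a by real_asymp
        then show ?thesis using beta_pos m_pos by (simp add: \<tau>n_def [abs_def])
      qed
      have \<tau>n: "tb + \<nu> n powr (1 - \<alpha>) * \<tau>n n = t" for n
      proof -
        have "\<nu> n powr (1 - \<alpha>) * exp (\<beta> * (real n * m - chi)) = 1"
          by (simp add: \<nu>_def powr_def \<beta>_def algebra_simps flip: exp_add)
        then have "\<nu> n powr (1 - \<alpha>) * \<tau>n n = a" by (simp add: \<tau>n_def mult.left_commute)
        then show ?thesis by (simp add: a_def)
      qed
      have "\<exists>s\<ge>0. E.close 1 (yy n) (rr n) \<and> \<tau>1 \<le> \<tau>n n \<longrightarrow> clock \<alpha> (yy n) (rr n) s = \<tau>n n - \<tau>1" for n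
      proof (cases "E.close 1 (yy n) (rr n) \<and> \<tau>1 \<le> \<tau>n n")
        case True
        then obtain s where "s \<ge> 0" "clock \<alpha> (yy n) (rr n) s = \<tau>n n - \<tau>1"
          using E.close_clock_surj[of "yy n" "rr n" "\<tau>n n - \<tau>1"] by auto
        then show ?thesis by blast
      qed auto
      then obtain s where s: "\<And>n. s n \<ge> 0"
        "\<And>n. E.close 1 (yy n) (rr n) \<Longrightarrow> \<tau>1 \<le> \<tau>n n \<Longrightarrow> clock \<alpha> (yy n) (rr n) (s n) = \<tau>n n - \<tau>1" by metis
      have "\<forall>\<^sub>F n in sequentially. \<tau>1 \<le> \<tau>n n" using \<tau>n_top by (simp add: filterlim_at_top)
      with E.eventually_close[OF yy(1) yy0 rr zero_less_one]
      have clk: "\<forall>\<^sub>F n in sequentially. clock \<alpha> (yy n) (rr n) (s n) = \<tau>n n - \<tau>1"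
        by eventually_elim (rule s(2))
      have "(\<lambda>n. (exp (chi - real n * m) * rad (yy n) (rr n) (s n)) *\<^sub>R yy n (s n)) \<longlonglongrightarrow>
          a powr (1 / \<beta>) *\<^sub>R Xp_fun \<alpha> F Yp (ln (a powr (1 / \<beta>)) + (- E.lk - chi))"
      proof (rule E.profile_limit[OF yy(1) yy0 rr s(1) a])
        \<comment> \<open>The clock starts at \<open>\<tau>1\<close>, a fixed offset that disappears
          in the ratio.\<close>
        have "(\<lambda>n. 1 - \<tau>1 / \<tau>n n) \<longlonglongrightarrow> 1 - 0"
          by (intro tendsto_diff tendsto_const tendsto_divide_0[OF tendsto_const] filterlim_at_top_imp_at_infinity \<tau>n_top)
        moreover have "\<forall>\<^sub>F n in sequentially. 1 - \<tau>1 / \<tau>n n = clock \<alpha> (yy n) (rr n) (s n) / (a * exp (\<beta> * (real n * m - chi)))"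
          using clk
        proof eventually_elim
          fix n assume n: "clock \<alpha> (yy n) (rr n) (s n) = \<tau>n n - \<tau>1"
          show "1 - \<tau>1 / \<tau>n n = clock \<alpha> (yy n) (rr n) (s n) / (a * exp (\<beta> * (real n * m - chi)))"
            unfolding n \<tau>n_def[symmetric] using \<tau>n_pos[of n] by (simp add: diff_divide_distrib)
        qed
        ultimately show "(\<lambda>n. clock \<alpha> (yy n) (rr n) (s n) / (a * exp (\<beta> * (real n * m - chi)))) \<longlonglongrightarrow> 1"
          using Lim_transform_eventually by force
      qed
      moreover have "\<forall>\<^sub>F n in sequentially. (exp (chi - real n * m) * rad (yy n) (rr n) (s n)) *\<^sub>R yy n (s n) = x\<nu> (\<nu> n) t"
      proof -
        \<comment> \<open>Closeness within \<open>ln \<rho>\<close> keeps the radius of the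
          comparison curve at least 1, where \<open>tracking\<close> with \<nu> = 1 identifies it
          with \<open>Xn n\<close>.\<close>
        have "ln \<rho> > 0" using \<rho>(1) by simp
        from E.eventually_close[OF yy(1) yy0 rr this] clk rr_pos show ?thesis
        proof eventually_elim
          fix n assume cl: "E.close (ln \<rho>) (yy n) (rr n)" and ck: "clock \<alpha> (yy n) (rr n) (s n) = \<tau>n n - \<tau>1"
            and pos: "rr n > 0"
          have "1 \<le> rad (yy n) (rr n) u" if "u \<ge> 0" for u
          proof -
            have "ln \<rho> \<le> ln (rad y1 r1 u)" using \<rho> that rad_pos[OF r1, of y1 u] by (subst ln_le_cancel_iff) auto
            moreover have "\<bar>ln (rad (yy n) (rr n) u) - ln (rad y1 r1 u)\<bar> \<le> ln \<rho>" using cl that by (simp add: E.close_def)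
            ultimately have "ln (rad (yy n) (rr n) u) \<ge> 0" by linarith
            then show ?thesis using rad_pos[OF pos, of "yy n" u] by simp
          qed
          then have "Xn n (\<tau>1 + clock \<alpha> (yy n) (rr n) (s n)) = rad (yy n) (rr n) (s n) *\<^sub>R yy n (s n)"
            using Xn_sol[of n] yy pos s(1)
            by (intro tracking[where X = "Xn n" and \<nu> = 1])
               (auto simp: z_def global_solution_def intro: has_vector_derivative_at_within)
          then have "Xn n (\<tau>n n) = rad (yy n) (rr n) (s n) *\<^sub>R yy n (s n)" by (simp add: ck)
          moreover have "x\<nu> (\<nu> n) t = \<nu> n *\<^sub>R Xn n (\<tau>n n)"
            unfolding Xn_def \<tau>n using \<nu>_pos[of n] by simp
          ultimately show "(exp (chi - real n * m) * rad (yy n) (rr n) (s n)) *\<^sub>R yy n (s n) = x\<nu> (\<nu> n) t"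
            by (simp add: \<nu>_def)
        qed
      qed
      ultimately show ?thesis unfolding prof_def a_def[symmetric] \<beta>_def[symmetric] by (rule Lim_transform_eventually)
    qed
    show "\<exists>x. (\<forall>t\<ge>t0. (\<lambda>n. x\<nu> (exp (- T * mean_Fr F Yp T * real n + chi)) t) \<longlonglongrightarrow> x t) \<and>
          (\<forall>t>tb. x t = (t - tb) powr (1 / (1 - \<alpha>)) *\<^sub>R
             Xp_fun \<alpha> F Yp (ln ((t - tb) powr (1 / (1 - \<alpha>))) + (- E.lk - chi)))"
      unfolding \<nu>_eq
    \<comment> \<open>Up to \<open>tb\<close> only existence of the limit is claimed, so
      \<open>lim\<close> names it.\<close>
    proof (rule exI[of _ "\<lambda>t. if t > tb then prof t else lim (\<lambda>n. x\<nu> (\<nu> n) t)"], intro conjI allI impI)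
      fix t assume "t0 \<le> t"
      then show "(\<lambda>n. x\<nu> (\<nu> n) t) \<longlonglongrightarrow> (if t > tb then prof t else lim (\<lambda>n. x\<nu> (\<nu> n) t))"
        using main[of t] conv[of t] by (simp add: convergent_LIMSEQ_iff)
    qed (simp add: prof_def)
  qed
qed

end
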